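(* Let $(\Omega,\mathcal{F},P)$ be a probability space, $\mathcal{G}\subseteq\mathcal{F}$ a $\sigma$-subalgebra, $\mathfrak{Y}$ a separable Banach space with topological dual $\mathfrak{Y}^*$, $p\in[1,\infty)$, $p'\in[p,\infty]$, and $\mathfrak{X}=\mathcal{L}_{p'}(\Omega,\mathcal{G},P;\mathfrak{Y})$. Let $f:\mathfrak{Y}\times\Omega\to\mathbb{R}$ be a convex integrand and suppose that $F:\mathfrak{X}\to\mathcal{L}_p(\Omega,\mathcal{F},P)$ is given by $[F(x)](\omega)=f(x(\omega),\omega)$, $\omega\in\Omega$. Let $x\in\mathfrak{X}$, suppose that $f(\cdot,\omega)$ is convex and continuous at $x(\omega)$ for almost all $\omega\in\Omega$, that $F$ is continuous at $x$ as well, and that $\varrho:\mathcal{L}_p(\Omega,\mathcal{F},P)\to\mathbb{R}$ is convex and nondecreasing. Then the composite function $\varphi=\varrho\circ F$ is subdifferentiable at $x$ and $$\partial\varphi(x)=\big\{\mathbb{E}[\zeta s\,|\,\mathcal{G}]:\ \zeta\in\partial\varrho(F(x)),\ s(\cdot)\ \text{is a measurable selector of}\ \partial f(x(\cdot),\cdot)\big\}.$$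
   Context: Equalities and inequalities between elements of $\mathcal{L}_p(\Omega,\mathcal{F},P)$ (real-valued functions) are understood almost surely. $1/\infty=0$. $\mathcal{L}_{p'}(\Omega,\mathcal{G},P;\mathfrak{Y})$ is the usual space of (classes of) $\mathcal{G}$-measurable functions $x:\Omega\to\mathfrak{Y}$ with $\|x(\cdot)\|\in\mathcal{L}_{p'}(\Omega,\mathcal{G},P)$. Convex integrand: a function $f:\mathfrak{Y}\times\Omega\to\mathbb{R}$ that is convex and continuous in the first argument for almost all values of the second argument, and ($\mathcal{F}$-)measurable in the second argument for all values of the first argument. $\varrho$ is nondecreasing if $Z\le V$ a.s. implies $\varrho(Z)\le\varrho(V)$. $\partial f(y,\omega)\subset\mathfrak{Y}^*$ is the usual convex subdifferential of $f(\cdot,\omega)$ at $y$. $\partial\varrho(Z)$ is the usual convex subdifferential of $\varrho$ at $Z$, a subset of $\mathcal{L}_q(\Omega,\mathcal{F},P)$ with $1/p+1/q=1$, under the pairing $\langle\zeta,Z\rangle=\mathbb{E}[\zeta Z]$. $\partial\varphi(x)\subset\mathfrak{X}^*$ is the usual convex subdifferential, and subdifferentiable at $x$ means $\partial\varphi(x)\ne\emptyset$. A measurable selector of $\partial f(x(\cdot),\cdot)$ is an ($\mathcal{F}$-)measurable function $s:\Omega\to\mathfrak{Y}^*$ with $s(\omega)\in\partial f(x(\omega),\omega)$ for almost all $\omega$. $\mathbb{E}[\zeta s|\mathcal{G}]$ is the conditional expectation of the $\mathfrak{Y}^*$-valued function $\zeta s$ given $\mathcal{G}$; it is identified with the element $h\mapsto\mathbb{E}\big[\langle\mathbb{E}[\zeta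 s|\mathcal{G}],h\rangle\big]=\mathbb{E}\big[\zeta\langle s,h\rangle\big]$ of $\mathfrak{X}^*$. *)

theory Defs
  imports "HOL-Probability.Probability"
begin

text \<open>
  The Lebesgue spaces are represented by functions instead of classes: \<^term>\<open>Lp_space M p\<close> with
  \<^term>\<open>Lp_norm M p\<close> is a seminormed space whose null elements are the functions vanishing almost
  surely.  Exponents are elements of \<^typ>\<open>ennreal\<close>, so that \<open>p = \<infinity>\<close> is allowed
  and \<open>1 / \<infinity> = 0\<close>; only exponents \<open>p \<ge> 1\<close> are meaningful.
\<close>

definition Lp_space :: "'a measure \<Rightarrow> ennreal \<Rightarrow> ('a \<Rightarrow> 'b::real_normed_vector) set" where
  "Lp_space M p = {x \<in> borel_measurable M.
     if p = \<infinity> then \<exists>C. AE \<omega> in M. norm (x \<omega>) \<le> C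
     else integrable M (\<lambda>\<omega>. norm (x \<omega>) powr enn2real p)}"

definition Lp_norm :: "'a measure \<Rightarrow> ennreal \<Rightarrow> ('a \<Rightarrow> 'b::real_normed_vector) \<Rightarrow> real" where
  "Lp_norm M p x =
     (if p = \<infinity> then real_of_ereal (esssup M (\<lambda>\<omega>. ereal (norm (x \<omega>))))
      else (\<integral>\<omega>. norm (x \<omega>) powr enn2real p \<partial>M) powr (1 / enn2real p))"

text \<open>
  The topological dual of \<^term>\<open>Lp_space M p\<close>.  A functional is only relevant on that space;
  \<^const>\<open>extensional\<close> fixes its values elsewhere, so that equality in the dual is equality of
  functions.  Boundedness by the seminorm makes functionals invariant under almost sure equality.
\<close>

definition Lp_dual :: "'a measure \<Rightarrow> ennreal \<Rightarrow> (('a \<Rightarrow> 'b::real_normed_vector) \<Rightarrow> real) set" where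
  "Lp_dual M p = {l \<in> extensional (Lp_space M p).
     (\<forall>h\<in>Lp_space M p. \<forall>k\<in>Lp_space M p. \<forall>a b::real.
        l (\<lambda>\<omega>. a *\<^sub>R h \<omega> + b *\<^sub>R k \<omega>) = a * l h + b * l k) \<and>
     (\<exists>C. \<forall>h\<in>Lp_space M p. \<bar>l h\<bar> \<le> C * Lp_norm M p h)}"

definition Lp_subdiff ::
  "'a measure \<Rightarrow> ennreal \<Rightarrow> (('a \<Rightarrow> 'b::real_normed_vector) \<Rightarrow> real) \<Rightarrow> ('a \<Rightarrow> 'b)
    \<Rightarrow> (('a \<Rightarrow> 'b) \<Rightarrow> real) set" where
  "Lp_subdiff M p \<phi> x = {l \<in> Lp_dual M p.
     \<forall>h\<in>Lp_space M p. \<phi> x + l (\<lambda>\<omega>. h \<omega> - x \<omega>) \<le> \<phi> h}"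

text \<open>
  The subdifferential of a functional on real \<open>L\<^sub>p\<close> for \<open>p < \<infinity>\<close>, as a subset of \<open>L\<^sub>q\<close>, where \<open>q\<close>
  is the conjugate exponent.
\<close>

definition Lq_subdiff ::
  "'a measure \<Rightarrow> ennreal \<Rightarrow> ennreal \<Rightarrow> (('a \<Rightarrow> real) \<Rightarrow> real) \<Rightarrow> ('a \<Rightarrow> real) \<Rightarrow> ('a \<Rightarrow> real) set" where
  "Lq_subdiff M p q \<rho> Z = {\<zeta> \<in> Lp_space M q.
     \<forall>V\<in>Lp_space M p. \<rho> Z + (\<integral>\<omega>. \<zeta> \<omega> * (V \<omega> - Z \<omega>) \<partial>M) \<le> \<rho> V}"

definition subdiff :: "('b::real_normed_vector \<Rightarrow> real) \<Rightarrow> 'b \<Rightarrow> ('b \<Rightarrow>\<^sub>L real) set" where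
  "subdiff g y = {s. \<forall>z. g y + blinfun_apply s (z - y) \<le> g z}"

definition Lp_convex :: "'a measure \<Rightarrow> ennreal \<Rightarrow> (('a \<Rightarrow> real) \<Rightarrow> real) \<Rightarrow> bool" where
  "Lp_convex M p \<rho> \<longleftrightarrow> (\<forall>Z\<in>Lp_space M p. \<forall>V\<in>Lp_space M p. \<forall>t\<in>{0..1}.
     \<rho> (\<lambda>\<omega>. (1 - t) * Z \<omega> + t * V \<omega>) \<le> (1 - t) * \<rho> Z + t * \<rho> V)"

text \<open>
  Monotonicity for the almost sure order forces \<open>\<rho>\<close> to agree on almost surely equal functions, so
  that it is a functional on classes.
\<close>

definition Lp_nondecreasing :: "'a measure \<Rightarrow> ennreal \<Rightarrow> (('a \<Rightarrow> real) \<Rightarrow> real) \<Rightarrow> bool" where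
  "Lp_nondecreasing M p \<rho> \<longleftrightarrow> (\<forall>Z\<in>Lp_space M p. \<forall>V\<in>Lp_space M p.
     (AE \<omega> in M. Z \<omega> \<le> V \<omega>) \<longrightarrow> \<rho> Z \<le> \<rho> V)"

definition convex_integrand :: "'a measure \<Rightarrow> ('b::real_normed_vector \<Rightarrow> 'a \<Rightarrow> real) \<Rightarrow> bool" where
  "convex_integrand M f \<longleftrightarrow>
     (AE \<omega> in M. convex_on UNIV (\<lambda>y. f y \<omega>) \<and> continuous_on UNIV (\<lambda>y. f y \<omega>)) \<and>
     (\<forall>y. (\<lambda>\<omega>. f y \<omega>) \<in> borel_measurable M)"

text \<open>
  Continuity at \<open>x\<close> of a map from \<^term>\<open>Lp_space N r\<close> to \<^term>\<open>Lp_space M p\<close>, for the norms.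
\<close>

definition Lp_continuous_at ::
  "'a measure \<Rightarrow> ennreal \<Rightarrow> 'a measure \<Rightarrow> ennreal \<Rightarrow>
    (('a \<Rightarrow> 'b::real_normed_vector) \<Rightarrow> ('a \<Rightarrow> real)) \<Rightarrow> ('a \<Rightarrow> 'b) \<Rightarrow> bool" where
  "Lp_continuous_at N r M p F x \<longleftrightarrow> (\<forall>\<epsilon>>0. \<exists>\<delta>>0. \<forall>h\<in>Lp_space N r.
     Lp_norm N r (\<lambda>\<omega>. h \<omega> - x \<omega>) < \<delta> \<longrightarrow> Lp_norm M p (\<lambda>\<omega>. F h \<omega> - F x \<omega>) < \<epsilon>)"

text \<open>
  Measurability of functions with values in the dual is with respect to the weak* topology.  For
  separable \<^typ>\<open>'b\<close> the Borel sets of that topology are generated by the evaluation maps.  The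
  norm Borel sets would be inadequate: on \<open>C[0,1]\<close>, the function \<open>\<omega> \<mapsto> \<delta>\<^sub>\<omega>\<close> is not
  measurable with respect to them.
\<close>

definition weakstar_measurable :: "'a measure \<Rightarrow> ('a \<Rightarrow> 'b::real_normed_vector \<Rightarrow>\<^sub>L real) \<Rightarrow> bool" where
  "weakstar_measurable M s \<longleftrightarrow> (\<forall>y. (\<lambda>\<omega>. blinfun_apply (s \<omega>) y) \<in> borel_measurable M)"

definition measurable_selector ::
  "'a measure \<Rightarrow> ('a \<Rightarrow> ('b::real_normed_vector \<Rightarrow>\<^sub>L real) set) \<Rightarrow> ('a \<Rightarrow> 'b \<Rightarrow>\<^sub>L real) \<Rightarrow> bool" where
  "measurable_selector M S s \<longleftrightarrow> weakstar_measurable M s \<and> (AE \<omega> in M. s \<omega> \<in> S \<omega>)"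

text \<open>
  Conditional expectation, given \<open>G\<close>, of a function with values in the dual of \<^typ>\<open>'b\<close>, in the
  weak* sense.  For separable \<^typ>\<open>'b\<close> it is almost surely unique if it exists.
\<close>

definition is_dual_cond_exp ::
  "'a measure \<Rightarrow> 'a measure \<Rightarrow> ('a \<Rightarrow> 'b::real_normed_vector \<Rightarrow>\<^sub>L real) \<Rightarrow> ('a \<Rightarrow> 'b \<Rightarrow>\<^sub>L real) \<Rightarrow> bool" where
  "is_dual_cond_exp M G u e \<longleftrightarrow> weakstar_measurable G e \<and>
     (\<forall>y. integrable M (\<lambda>\<omega>. blinfun_apply (u \<omega>) y) \<and>
          (AE \<omega> in M. blinfun_apply (e \<omega>) y = real_cond_exp M G (\<lambda>\<omega>'. blinfun_apply (u \<omega>') y) \<omega>))"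

definition dual_cond_exp ::
  "'a measure \<Rightarrow> 'a measure \<Rightarrow> ('a \<Rightarrow> 'b::real_normed_vector \<Rightarrow>\<^sub>L real) \<Rightarrow> ('a \<Rightarrow> 'b \<Rightarrow>\<^sub>L real)" where
  "dual_cond_exp M G u = (SOME e. is_dual_cond_exp M G u e)"

text \<open>
  The functional on \<^term>\<open>Lp_space N r\<close> with which a dual-valued function is identified.
\<close>

definition Lp_functional ::
  "'a measure \<Rightarrow> ennreal \<Rightarrow> ('a \<Rightarrow> 'b::real_normed_vector \<Rightarrow>\<^sub>L real) \<Rightarrow> (('a \<Rightarrow> 'b) \<Rightarrow> real)" where
  "Lp_functional N r e = (\<lambda>h\<in>Lp_space N r. \<integral>\<omega>. blinfun_apply (e \<omega>) (h \<omega>) \<partial>N)"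

end

theory Submission
  imports Defs "HOL-Library.Function_Algebras"
begin

text \<open>
  Write \<open>\<langle>\<cdot>, \<cdot>\<rangle>\<close> for the pairing of \<open>'y\<close> with its dual, \<open>E\<close> for the integral over \<open>M\<close>, and
  \<open>f'(x; \<cdot>)\<close> for the pointwise directional derivative of the integrand at \<open>x\<close>.

  \<^emph>\<open>Every subgradient has the stated form.\<close>  Let \<open>l\<close> be a subgradient of \<open>\<rho> \<circ> F\<close> at \<open>x\<close>.  The function
  \<open>(V, h) \<mapsto> \<rho> (V + F (x + h)) - \<rho> (F x) - l h\<close> is jointly convex, because \<open>\<rho>\<close> is convex and
  nondecreasing and \<open>F\<close> is convex almost surely, and at \<open>V = 0\<close> it is nonnegative.  The algebraic
  Hahn-Banach theorem in the form \<open>convex_sandwich\<close> gives a linear functional of \<open>V\<close> below it.  For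
  \<open>h = 0\<close> this says that the functional is a subgradient of \<open>\<rho>\<close>; for \<open>V = F x - F (x + h)\<close> it says that
  \<open>l h\<close> is at most its value at \<open>F (x + h) - F x\<close>.  Since \<open>\<rho>\<close> is nondecreasing, the functional is
  positive, and positive functionals on \<open>L\<^sub>p\<close> are integration against some \<open>\<zeta> \<ge> 0\<close> in \<open>L\<^sub>q\<close>
  (\<open>representation_by_conjugate_space\<close>).  Replacing \<open>h\<close> by \<open>t h\<close> and letting \<open>t\<close> tend to \<open>0\<close> sharpens
  the second inequality to \<open>l h \<le> E (\<zeta> f'(x; h))\<close>.

  The right-hand side is the integral of a sublinear integrand, so a theorem of Strassen's type
  applies.  By Hahn-Banach, \<open>l\<close> extends from the \<open>G\<close>-measurable functions to all measurable \<open>h\<close> with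
  finite integrals \<open>E (\<zeta> f'(x; h))\<close> and \<open>E (\<zeta> f'(x; - h))\<close>, still below the integral.  This larger
  space is closed under multiplication by indicators of measurable sets, so for each \<open>y\<close> the extension
  evaluated at \<open>y 1\<^sub>A\<close> is a signed measure in \<open>A\<close> with a density.  The densities depend linearly on
  \<open>y\<close> up to null sets and come from a dual-valued function \<open>v\<close> with \<open>\<langle>v, y\<rangle> \<le> \<zeta> f'(x; y)\<close>
  (\<open>selection_of_linear_minorant\<close>).  Where \<open>\<zeta> > 0\<close> put \<open>s = v / \<zeta>\<close>, a subgradient of the integrand;
  where \<open>\<zeta> = 0\<close> also \<open>v = 0\<close>, and \<open>s\<close> may be any measurable selector.  The same theorem with weight
  \<open>1\<close> and no prescribed functional produces a selector, so the right-hand side is nonempty.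

  \<^emph>\<open>The conditional expectation.\<close>  The norm of \<open>\<zeta> s\<close> need not be integrable; what is known is that
  \<open>E \<langle>\<zeta> s, h\<rangle> \<le> C r\<close> for \<open>G\<close>-measurable \<open>h\<close> with \<open>\<parallel>h\<parallel> \<le> r\<close>, which follows from the continuity of \<open>F\<close>
  at \<open>x\<close>.  Testing with \<open>G\<close>-measurable \<open>h\<close> that select the best of finitely many unit vectors shows
  that the supremum of the conditional expectations of \<open>\<langle>\<zeta> s, z\<rangle>\<close> over a countable dense subset of the
  unit sphere is integrable (\<open>ce_norm_bound\<close>).  Hence these conditional expectations are assembled to a dual-valued function,
  and it represents the functional \<open>h \<mapsto> E \<langle>\<zeta> s, h\<rangle>\<close> (\<open>dce_integral\<close>).

  \<^emph>\<open>Everything of the stated form is a subgradient.\<close>  If \<open>\<zeta>\<close> is a subgradient of \<open>\<rho>\<close> at \<open>F x\<close> and \<open>s\<close>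
  a selector, then \<open>\<zeta> \<ge> 0\<close> and \<open>E \<langle>\<zeta> s, h\<rangle> \<le> E (\<zeta> (F (x + h) - F x)) \<le> \<rho> (F (x + h)) - \<rho> (F x)\<close>.
\<close>

section \<open>Linear functionals below convex functions\<close>

text \<open>
  Measurable functions are plain functions here, so the Hahn-Banach arguments take place in
  subspaces of a function space, which is made a real vector space with the pointwise operations.
\<close>
instantiation "fun" :: (type, real_vector) real_vector
begin

definition scaleR_fun :: "real \<Rightarrow> ('a \<Rightarrow> 'b) \<Rightarrow> 'a \<Rightarrow> 'b" where
  "c *\<^sub>R f = (\<lambda>x. c *\<^sub>R f x)"

instance
  by standard (simp_all add: fun_eq_iff scaleR_fun_def scaleR_add_right scaleR_add_left)

end

lemma scaleR_fun_apply [simp]: "(c *\<^sub>R f) x = c *\<^sub>R f x"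
  by (simp add: scaleR_fun_def)

definition sublinear :: "('v::real_vector \<Rightarrow> real) \<Rightarrow> bool" where
  "sublinear p \<longleftrightarrow> (\<forall>x y. p (x + y) \<le> p x + p y) \<and> (\<forall>c x. 0 \<le> c \<longrightarrow> p (c *\<^sub>R x) = c * p x)"

lemma sublinear_add: "sublinear p \<Longrightarrow> p (x + y) \<le> p x + p y"
  and sublinear_scale: "sublinear p \<Longrightarrow> 0 \<le> c \<Longrightarrow> p (c *\<^sub>R x) = c * p x"
  by (auto simp: sublinear_def)

lemma sublinear_0: "sublinear p \<Longrightarrow> p 0 = 0"
  using sublinear_scale[of p 0 0] by simp

lemma sublinear_minus: assumes "sublinear p" shows "- p (- x) \<le> p x"
  using sublinear_add[OF assms, of x "-x"] sublinear_0[OF assms] by simp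

lemma sublinearI:
  assumes "\<And>x y. p (x + y) \<le> p x + p y" "\<And>c x. 0 < c \<Longrightarrow> p (c *\<^sub>R x) \<le> c * p x" "p 0 = 0"
  shows "sublinear p"
  unfolding sublinear_def
proof (intro conjI allI impI)
  fix c :: real and x assume "0 \<le> c"
  show "p (c *\<^sub>R x) = c * p x"
  proof (cases "c = 0")
    case False
    with \<open>0 \<le> c\<close> have "0 < c" by simp
    have "p ((1 / c) *\<^sub>R (c *\<^sub>R x)) \<le> (1 / c) * p (c *\<^sub>R x)"
      by (rule assms(2)) (use \<open>0 < c\<close> in simp)
    then have "c * p x \<le> p (c *\<^sub>R x)"
      using \<open>0 < c\<close> by (simp add: field_simps)
    with assms(2)[OF \<open>0 < c\<close>, of x] show ?thesis by simp
  qed (simp add: assms(3))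
qed (rule assms(1))

text \<open>
  The pattern by which several sublinear functions below arise: an infimum over a parameter, where two
  parameters can be merged when arguments are added and adjusted when the argument is scaled.
\<close>
lemma sublinear_INF:
  fixes S :: "'v::real_vector \<Rightarrow> 'i \<Rightarrow> real"
  assumes ne: "I \<noteq> {}" and bdd: "\<And>v. bdd_below (S v ` I)"
    and add: "\<And>v v' i j. i \<in> I \<Longrightarrow> j \<in> I \<Longrightarrow> \<exists>k\<in>I. S (v + v') k \<le> S v i + S v' j"
    and scale: "\<And>c v i. 0 < c \<Longrightarrow> i \<in> I \<Longrightarrow> \<exists>k\<in>I. S (c *\<^sub>R v) k \<le> c * S v i"
    and zero: "(INF i\<in>I. S 0 i) = 0"
  shows "sublinear (\<lambda>v. INF i\<in>I. S v i)"
proof (rule sublinearI)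
  let ?p = "\<lambda>v. INF i\<in>I. S v i"
  have le: "?p v \<le> S v i" if "i \<in> I" for v i by (rule cINF_lower[OF bdd that])
  fix v v'
  have "?p (v + v') - S v i \<le> S v' j" if "i \<in> I" "j \<in> I" for i j
    using add[OF that, of v v'] le by (smt (verit) order_trans)
  then have "?p (v + v') - S v i \<le> ?p v'" if "i \<in> I" for i
    using ne that by (intro cINF_greatest) auto
  then have "?p (v + v') - ?p v' \<le> S v i" if "i \<in> I" for i
    using that by (fastforce simp: algebra_simps)
  then have "?p (v + v') - ?p v' \<le> ?p v"
    using ne by (intro cINF_greatest) auto
  then show "?p (v + v') \<le> ?p v + ?p v'" by simp
next
  let ?p = "\<lambda>v. INF i\<in>I. S v i"
  fix c :: real and v assume c: "0 < c"
  have "?p (c *\<^sub>R v) / c \<le> S v i" if i: "i \<in> I" for i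
  proof -
    obtain k where k: "k \<in> I" "S (c *\<^sub>R v) k \<le> c * S v i" using scale[OF c i] by blast
    have "?p (c *\<^sub>R v) \<le> c * S v i" using cINF_lower[OF bdd k(1), of "c *\<^sub>R v"] k(2) by simp
    then show ?thesis using c by (simp add: field_simps)
  qed
  then have "?p (c *\<^sub>R v) / c \<le> ?p v"
    using ne by (intro cINF_greatest) auto
  then show "?p (c *\<^sub>R v) \<le> c * ?p v" using c by (simp add: field_simps)
qed (rule zero)

text \<open>
  By Zorn's lemma: along a chain the pointwise infimum is finite, since every sublinear
  \<open>q \<le> p\<close> satisfies \<open>- p (- x) \<le> - q (- x) \<le> q x\<close>, and it is again sublinear, since two members of a chain
  have a smaller one among them.
\<close>
lemma minimal_sublinear_below:
  fixes p :: "'v::real_vector \<Rightarrow> real"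
  assumes "sublinear p"
  obtains q where "sublinear q" "q \<le> p" "\<And>q'. sublinear q' \<Longrightarrow> q' \<le> q \<Longrightarrow> q' = q"
proof -
  define A where "A = {q. sublinear q \<and> q \<le> p}"
  define P where "P = (\<lambda>a b::'v \<Rightarrow> real. b \<le> a)"
  have po: "partial_order_on A (relation_of P A)"
    unfolding partial_order_on_def preorder_on_def refl_on_def trans_on_def antisym_on_def relation_of_def P_def
    by (auto intro: order_trans)
  have "\<exists>m\<in>A. \<forall>a\<in>A. P m a \<longrightarrow> a = m"
  proof (rule predicate_Zorn[OF po])
    fix C assume C: "C \<in> Chains (relation_of P A)"
    then have CA: "\<And>q. q \<in> C \<Longrightarrow> q \<in> A" and tot: "\<And>a b. a \<in> C \<Longrightarrow> b \<in> C \<Longrightarrow> a \<le> b \<or> b \<le> a"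
      by (auto simp: Chains_def relation_of_def P_def)
    show "\<exists>u\<in>A. \<forall>a\<in>C. P a u"
    proof (cases "C = {}")
      case True
      then show ?thesis using assms by (auto simp: A_def)
    next
      case False
      define u where "u x = (INF q\<in>C. q x)" for x
      have low: "- p (- x) \<le> q x" if "q \<in> C" for q x
      proof -
        have q: "sublinear q" "q \<le> p" using CA[OF that] by (auto simp: A_def)
        have "- p (- x) \<le> - q (- x)" using q(2) by (auto simp: le_fun_def)
        also have "\<dots> \<le> q x" by (rule sublinear_minus[OF q(1)])
        finally show ?thesis .
      qed
      have bdd: "bdd_below ((\<lambda>q. q x) ` C)" for x
        using low by (intro bdd_belowI2[where m="- p (-x)"]) auto
      have le: "u x \<le> q x" if "q \<in> C" for q x
        unfolding u_def by (rule cINF_lower[OF bdd that])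
      have "sublinear u"
        unfolding u_def[abs_def]
      proof (rule sublinear_INF[OF False bdd])
        show "\<exists>q\<in>C. q (x + y) \<le> q1 x + q2 y" if C: "q1 \<in> C" "q2 \<in> C" for q1 q2 x y
        proof -
          obtain q where q: "q \<in> C" "q \<le> q1" "q \<le> q2" using tot[OF C] C by blast
          have "q (x + y) \<le> q x + q y"
            using CA[OF q(1)] by (auto simp: A_def intro: sublinear_add)
          also have "\<dots> \<le> q1 x + q2 y" using q by (auto simp: le_fun_def intro: add_mono)
          finally show ?thesis using q(1) by blast
        qed
        show "\<exists>k\<in>C. k (c *\<^sub>R x) \<le> c * q x" if "0 < c" "q \<in> C" for c q x
          using CA[OF that(2)] that by (auto simp: A_def sublinear_scale intro!: bexI[of _ q])
        have "(\<lambda>q. q 0) ` C = {0::real}"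
          using False CA sublinear_0 unfolding A_def by (auto simp: image_iff)
        then show "(INF q\<in>C. q 0) = 0" by simp
      qed
      moreover obtain q where "q \<in> C" using False by auto
      then have "u \<le> p" using le CA[of q] by (auto simp: A_def le_fun_def intro: order_trans)
      ultimately have "u \<in> A" by (simp add: A_def)
      then show ?thesis using le by (auto simp: P_def le_fun_def)
    qed
  qed
  then obtain m where "m \<in> A" and m: "\<And>a. a \<in> A \<Longrightarrow> a \<le> m \<Longrightarrow> a = m"
    by (auto simp: P_def)
  show thesis
  proof (rule that)
    show "sublinear m" "m \<le> p" using \<open>m \<in> A\<close> by (auto simp: A_def)
    show "q' = m" if "sublinear q'" "q' \<le> m" for q'
      using m[of q'] that \<open>m \<le> p\<close> by (auto simp: A_def)
  qed
qed

text \<open>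
  A minimal sublinear function is odd, hence linear.  Indeed, the infimum of \<open>q (x + t y) - t q y\<close>
  over \<open>t \<ge> 0\<close> is sublinear in \<open>x\<close> and at most \<open>q x\<close>, so by minimality it equals \<open>q x\<close>; at
  \<open>x = - y\<close> and \<open>t = 1\<close> this yields \<open>q (- y) \<le> - q y\<close>.
\<close>
lemma linear_below_sublinear:
  fixes p :: "'v::real_vector \<Rightarrow> real"
  assumes "sublinear p"
  obtains z where "linear z" "\<And>v. z v \<le> p v"
proof -
  obtain q where q: "sublinear q" "q \<le> p"
    and min: "\<And>q'. sublinear q' \<Longrightarrow> q' \<le> q \<Longrightarrow> q' = q"
    using minimal_sublinear_below[OF assms] by metis
  have odd: "q (- y) = - q y" for y
  proof -
    define r where "r x = (INF t\<in>{0..}. q (x + t *\<^sub>R y) - t * q y)" for x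
    have bdd: "bdd_below ((\<lambda>t. q (x + t *\<^sub>R y) - t * q y) ` {0..})" for x
    proof (rule bdd_belowI2[where m="- q (- x)"])
      fix t :: real assume t: "t \<in> {0..}"
      have "t * q y = q ((x + t *\<^sub>R y) + (- x))" using sublinear_scale[OF q(1), of t y] t by simp
      also have "\<dots> \<le> q (x + t *\<^sub>R y) + q (- x)" by (rule sublinear_add[OF q(1)])
      finally show "- q (- x) \<le> q (x + t *\<^sub>R y) - t * q y" by simp
    qed
    have le: "r x \<le> q (x + t *\<^sub>R y) - t * q y" if "0 \<le> t" for x t
      unfolding r_def using that by (intro cINF_lower[OF bdd]) auto
    have "r \<le> q" using le[of 0] by (auto simp: le_fun_def)
    moreover have "sublinear r"
      unfolding r_def[abs_def]
    proof (rule sublinear_INF[OF _ bdd])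
      fix x1 x2 and t s :: real assume "t \<in> {0..}" "s \<in> {0..}"
      then have st: "0 \<le> t" "0 \<le> s" by auto
      have "x1 + x2 + (t + s) *\<^sub>R y = (x1 + t *\<^sub>R y) + (x2 + s *\<^sub>R y)"
        by (simp add: algebra_simps)
      then have "q (x1 + x2 + (t + s) *\<^sub>R y) \<le> q (x1 + t *\<^sub>R y) + q (x2 + s *\<^sub>R y)"
        using sublinear_add[OF q(1)] by metis
      then show "\<exists>k\<in>{0..}. q (x1 + x2 + k *\<^sub>R y) - k * q y
          \<le> (q (x1 + t *\<^sub>R y) - t * q y) + (q (x2 + s *\<^sub>R y) - s * q y)"
        using st by (intro bexI[of _ "t + s"]) (auto simp: algebra_simps)
    next
      fix c :: real and x and t :: real assume c: "0 < c" and t: "t \<in> {0..}"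
      have "c *\<^sub>R x + (c * t) *\<^sub>R y = c *\<^sub>R (x + t *\<^sub>R y)" by (simp add: algebra_simps)
      then have "q (c *\<^sub>R x + (c * t) *\<^sub>R y) = c * q (x + t *\<^sub>R y)"
        using sublinear_scale[OF q(1), of c] c by simp
      then show "\<exists>k\<in>{0..}. q (c *\<^sub>R x + k *\<^sub>R y) - k * q y \<le> c * (q (x + t *\<^sub>R y) - t * q y)"
        using c t by (intro bexI[of _ "c * t"]) (auto simp: algebra_simps)
    next
      have "(\<lambda>t. q (0 + t *\<^sub>R y) - t * q y) ` {0..} = {0}"
        using sublinear_scale[OF q(1)] by (auto simp: image_iff intro: exI[of _ 0])
      then show "(INF t\<in>{0..}. q (0 + t *\<^sub>R y) - t * q y) = 0" by simp
    qed simp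
    ultimately have "r = q" by (rule min[rotated])
    have "q (- y) \<le> q (- y + 1 *\<^sub>R y) - 1 * q y"
      using le[of 1 "- y"] \<open>r = q\<close> by simp
    then have "q (- y) \<le> - q y" using sublinear_0[OF q(1)] by simp
    then show ?thesis using sublinear_minus[OF q(1), of "- y"] by simp
  qed
  have "linear q"
  proof (rule linearI)
    fix x y
    have "q (- (x + y)) \<le> q (- x) + q (- y)" using sublinear_add[OF q(1), of "-x" "-y"] by simp
    then show "q (x + y) = q x + q y" using sublinear_add[OF q(1), of x y] odd[of x] odd[of y] odd[of "x + y"] by linarith
  next
    fix c :: real and x
    show "q (c *\<^sub>R x) = c *\<^sub>R q x"
    proof (cases "0 \<le> c")
      case False
      then have "q ((- c) *\<^sub>R x) = (- c) * q x" by (intro sublinear_scale[OF q(1)]) simp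
      then show ?thesis using odd[of "c *\<^sub>R x"] by simp
    qed (simp add: sublinear_scale[OF q(1)])
  qed
  then show thesis using q(2) by (intro that) (auto simp: le_fun_def)
qed

text \<open>
  A form of the Hahn-Banach theorem with a free parameter \<open>w\<close>.  The function
  \<open>p v = inf {\<Phi> (t v) w / t | t > 0, w \<in> L}\<close> is sublinear and below every \<open>\<Phi> \<cdot> w\<close>.  It is finite because
  \<open>\<Phi> (t v) w / t + \<Phi> (- s v) w' / s\<close> is, by joint convexity, at least a positive multiple of some value
  \<open>\<Phi> 0 w''\<close>.  A linear projection onto \<open>H\<close> transports the problem to the whole space.
\<close>
lemma convex_sandwich:
  fixes \<Phi> :: "'v::real_vector \<Rightarrow> 'w::real_vector \<Rightarrow> real"
  assumes H: "subspace H" and L: "subspace L"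
    and conv: "\<And>v v' w w' t. v \<in> H \<Longrightarrow> v' \<in> H \<Longrightarrow> w \<in> L \<Longrightarrow> w' \<in> L \<Longrightarrow> 0 < t \<Longrightarrow> t < 1 \<Longrightarrow>
      \<Phi> ((1 - t) *\<^sub>R v + t *\<^sub>R v') ((1 - t) *\<^sub>R w + t *\<^sub>R w') \<le> (1 - t) * \<Phi> v w + t * \<Phi> v' w'"
    and nonneg: "\<And>w. w \<in> L \<Longrightarrow> 0 \<le> \<Phi> 0 w"
  obtains z where "linear z" "\<And>v w. v \<in> H \<Longrightarrow> w \<in> L \<Longrightarrow> z v \<le> \<Phi> v w"
proof -
  obtain \<pi> where \<pi>: "range \<pi> \<subseteq> H" "linear \<pi>" "\<And>v. v \<in> H \<Longrightarrow> \<pi> v = v"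
    using linear_exists_left_inverse_on[OF linear_id H] by auto
  have \<pi>H: "\<pi> v \<in> H" for v using \<pi>(1) by auto
  have tH: "t *\<^sub>R \<pi> v \<in> H" for t v by (rule subspace_scale[OF H \<pi>H])
  \<comment> \<open>Joint convexity with the weights \<open>s / (s + t)\<close> and \<open>t / (s + t)\<close>, divided by \<open>s t / (s + t)\<close>:
    these weights bring \<open>t v\<close> and \<open>s v'\<close> to the same multiple of \<open>v\<close> and \<open>v'\<close>.\<close>
  have mix: "\<Phi> ((a * t) *\<^sub>R \<pi> (v + v')) ((s / (s + t)) *\<^sub>R w + (t / (s + t)) *\<^sub>R w') / (a * t)
      \<le> \<Phi> (t *\<^sub>R \<pi> v) w / t + \<Phi> (s *\<^sub>R \<pi> v') w' / s"
    if st: "0 < s" "0 < t" and a: "a = s / (s + t)" and w: "w \<in> L" "w' \<in> L" for s t a v v' w w'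
  proof -
    define b where "b = t / (s + t)"
    have b: "0 < b" "b < 1" "s / (s + t) = 1 - b" using st by (auto simp: b_def field_simps)
    have at: "a * t = b * s" "a = 1 - b" "0 < a * t" using st by (auto simp: a b_def field_simps)
    have "\<Phi> ((1 - b) *\<^sub>R (t *\<^sub>R \<pi> v) + b *\<^sub>R (s *\<^sub>R \<pi> v')) ((1 - b) *\<^sub>R w + b *\<^sub>R w')
        \<le> (1 - b) * \<Phi> (t *\<^sub>R \<pi> v) w + b * \<Phi> (s *\<^sub>R \<pi> v') w'"
      by (rule conv[OF tH tH w b(1,2)])
    also have "(1 - b) *\<^sub>R (t *\<^sub>R \<pi> v) + b *\<^sub>R (s *\<^sub>R \<pi> v') = (a * t) *\<^sub>R \<pi> (v + v')"
    proof -
      have "(1 - b) * t = a * t" "b * s = a * t" using at by simp_all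
      then show ?thesis by (simp add: linear_add[OF \<pi>(2)] scaleR_add_right)
    qed
    finally have "\<Phi> ((a * t) *\<^sub>R \<pi> (v + v')) ((1 - b) *\<^sub>R w + b *\<^sub>R w') / (a * t)
        \<le> ((1 - b) * \<Phi> (t *\<^sub>R \<pi> v) w + b * \<Phi> (s *\<^sub>R \<pi> v') w') / (a * t)"
      using at by (intro divide_right_mono) auto
    also have "\<dots> = ((1 - b) * \<Phi> (t *\<^sub>R \<pi> v) w) / (a * t) + (b * \<Phi> (s *\<^sub>R \<pi> v') w') / (a * t)"
      by (rule add_divide_distrib)
    also have "((1 - b) * \<Phi> (t *\<^sub>R \<pi> v) w) / (a * t) = \<Phi> (t *\<^sub>R \<pi> v) w / t"
      using b by (simp add: at(2))
    also have "(b * \<Phi> (s *\<^sub>R \<pi> v') w') / (a * t) = \<Phi> (s *\<^sub>R \<pi> v') w' / s"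
      using b by (simp add: at(1))
    finally show ?thesis by (simp add: b(3) b_def)
  qed
  have mixL: "(s / (s + t)) *\<^sub>R w + (t / (s + t)) *\<^sub>R w' \<in> L" if "w \<in> L" "w' \<in> L" for s t w w'
    using that by (intro subspace_add[OF L] subspace_scale[OF L])
  define S where "S v = (\<lambda>(t, w). \<Phi> (t *\<^sub>R \<pi> v) w / t)" for v
  define I where "I = {0::real<..} \<times> L"
  define p where "p v = (INF i\<in>I. S v i)" for v
  have I: "I \<noteq> {}" using subspace_0[OF L] by (auto simp: I_def intro: exI[of _ 1])
  have low: "0 \<le> S v i + S (- v) j" if ij: "i \<in> I" "j \<in> I" for v i j
  proof -
    obtain t w s w' where i: "i = (t, w)" "j = (s, w')" "0 < t" "0 < s" "w \<in> L" "w' \<in> L"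
      using ij by (auto simp: I_def)
    have "0 \<le> \<Phi> ((s / (s + t) * t) *\<^sub>R \<pi> (v + - v))
        ((s / (s + t)) *\<^sub>R w + (t / (s + t)) *\<^sub>R w') / (s / (s + t) * t)"
      using i nonneg[OF mixL[OF i(5,6)]] by (simp add: linear_0[OF \<pi>(2)])
    also have "\<dots> \<le> S v i + S (- v) j"
      using mix[OF i(4,3) refl i(5,6), of v "- v"] by (simp add: S_def i)
    finally show ?thesis .
  qed
  have bdd: "bdd_below (S v ` I)" for v
  proof -
    obtain j where j: "j \<in> I" using I by auto
    have "- S (- v) j \<le> S v i" if "i \<in> I" for i using low[OF that j, of v] by linarith
    then show ?thesis by (rule bdd_belowI2)
  qed
  have le: "p v \<le> S v i" if "i \<in> I" for v i
    unfolding p_def by (rule cINF_lower[OF bdd that])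
  have "sublinear p"
    unfolding p_def[abs_def]
  proof (rule sublinear_INF[OF I bdd])
    fix v v' i j assume "i \<in> I" "j \<in> I"
    then obtain t w s w' where i: "i = (t, w)" "j = (s, w')" "0 < t" "0 < s" "w \<in> L" "w' \<in> L"
      by (auto simp: I_def)
    show "\<exists>k\<in>I. S (v + v') k \<le> S v i + S v' j"
      using mix[OF i(4,3) refl i(5,6), of v v'] mixL[OF i(5,6), of s t] i
      by (intro bexI[of _ "(s / (s + t) * t, (s / (s + t)) *\<^sub>R w + (t / (s + t)) *\<^sub>R w')"])
        (auto simp: S_def I_def)
  next
    fix c :: real and v i assume c: "0 < c" and "i \<in> I"
    then obtain t w where i: "i = (t, w)" "0 < t" "w \<in> L" by (auto simp: I_def)
    show "\<exists>k\<in>I. S (c *\<^sub>R v) k \<le> c * S v i"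
      using c i by (intro bexI[of _ "(t / c, w)"]) (auto simp: S_def I_def linear_scale[OF \<pi>(2)] mult.commute)
  next
    have S0: "S 0 (t, w) = \<Phi> 0 w / t" for t w by (simp add: S_def linear_0[OF \<pi>(2)])
    have "0 \<le> p 0"
      unfolding p_def using I nonneg by (intro cINF_greatest) (auto simp: I_def S0)
    moreover have "p 0 \<le> 0"
    proof (rule LIMSEQ_le_const)
      show "(\<lambda>n. \<Phi> 0 0 / real (Suc n)) \<longlonglongrightarrow> 0"
        by (rule LIMSEQ_Suc[OF lim_const_over_n])
      show "\<exists>N. \<forall>n\<ge>N. p 0 \<le> \<Phi> 0 0 / real (Suc n)"
        using le[of "(real (Suc n), 0)" 0 for n] subspace_0[OF L] by (auto simp: I_def S0)
    qed
    ultimately show "(INF i\<in>I. S 0 i) = 0" by (simp add: p_def)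
  qed
  then obtain z where z: "linear z" "\<And>v. z v \<le> p v"
    using linear_below_sublinear by metis
  show thesis
  proof (rule that[OF z(1)])
    fix v w assume vw: "v \<in> H" "w \<in> L"
    have "z v \<le> p v" by (rule z)
    also have "\<dots> \<le> S v (1, w)" by (rule le) (use vw in \<open>auto simp: I_def\<close>)
    finally show "z v \<le> \<Phi> v w" by (simp add: S_def \<pi>(3)[OF vw(1)])
  qed
qed

section \<open>Densities of set functions\<close>

text \<open>
  Finite additivity and continuity at the empty set make \<open>\<mu>\<close> a measure, to which the Radon-Nikodym
  theorem applies; the density is finite almost everywhere because \<open>\<mu>\<close> is finite.
\<close>
lemma density_of_set_function:
  fixes \<mu> :: "'a set \<Rightarrow> real"
  assumes "finite_measure M"
    and nonneg: "\<And>A. A \<in> sets M \<Longrightarrow> 0 \<le> \<mu> A"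
    and add: "\<And>A B. A \<in> sets M \<Longrightarrow> B \<in> sets M \<Longrightarrow> A \<inter> B = {} \<Longrightarrow> \<mu> (A \<union> B) = \<mu> A + \<mu> B"
    and cont: "\<And>A. range A \<subseteq> sets M \<Longrightarrow> decseq A \<Longrightarrow> (\<Inter>i::nat. A i) = {} \<Longrightarrow> (\<lambda>i. \<mu> (A i)) \<longlonglongrightarrow> 0"
    and null: "\<And>A. A \<in> null_sets M \<Longrightarrow> \<mu> A = 0"
  obtains n where "n \<in> borel_measurable M" "\<And>\<omega>. 0 \<le> n \<omega>" "integrable M n"
    "\<And>A. A \<in> sets M \<Longrightarrow> \<mu> A = (\<integral>\<omega>. indicator A \<omega> * n \<omega> \<partial>M)"
proof -
  interpret finite_measure M by fact
  have empty: "\<mu> {} = 0" using null by simp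
  define N where "N = measure_of (space M) (sets M) (\<lambda>A. ennreal (\<mu> A))"
  have sets_N: "sets N = sets M" by (simp add: N_def)
  have ca: "countably_additive (sets M) (\<lambda>A. ennreal (\<mu> A))"
  proof (rule sets.empty_continuous_imp_countably_additive)
    show "positive (sets M) (\<lambda>A. ennreal (\<mu> A))" by (simp add: positive_def empty)
    show "additive (sets M) (\<lambda>A. ennreal (\<mu> A))"
      using add nonneg by (auto simp: additive_def ennreal_plus)
    show "(\<lambda>i. ennreal (\<mu> (A i))) \<longlonglongrightarrow> 0"
      if "range A \<subseteq> sets M" "decseq A" "(\<Inter>i. A i) = {}" for A
      using tendsto_ennrealI[OF cont[OF that]] by simp
  qed auto
  have em: "emeasure N A = ennreal (\<mu> A)" if "A \<in> sets M" for A
    using that ca by (intro emeasure_measure_of[OF N_def])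
      (auto simp: positive_def empty sets_N dest: sets.sets_into_space)
  have "absolutely_continuous M N"
    by (auto simp: absolutely_continuous_def null_sets_def sets_N em intro!: null[THEN arg_cong[of _ 0 ennreal], simplified])
  then obtain f where f [measurable]: "f \<in> borel_measurable M" and fN: "density M f = N"
    using Radon_Nikodym[OF _ sets_N] by auto
  have int: "(\<integral>\<^sup>+\<omega>. f \<omega> * indicator A \<omega> \<partial>M) = ennreal (\<mu> A)" if "A \<in> sets M" for A
    using em[OF that] that by (simp add: fN[symmetric] emeasure_density)
  have fin: "(\<integral>\<^sup>+\<omega>. f \<omega> \<partial>M) < \<infinity>"
  proof -
    have "(\<integral>\<^sup>+\<omega>. f \<omega> \<partial>M) = (\<integral>\<^sup>+\<omega>. f \<omega> * indicator (space M) \<omega> \<partial>M)"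
      by (intro nn_integral_cong) simp
    then show ?thesis using int[of "space M"] by simp
  qed
  then have "AE \<omega> in M. f \<omega> \<noteq> \<infinity>" by (intro nn_integral_PInf_AE) auto
  then have ae: "AE \<omega> in M. ennreal (enn2real (f \<omega>)) = f \<omega>"
    by eventually_elim (simp add: less_top)
  have n_int: "integrable M (\<lambda>\<omega>. enn2real (f \<omega>))"
  proof (rule integrableI_nonneg)
    have "(\<integral>\<^sup>+\<omega>. ennreal (enn2real (f \<omega>)) \<partial>M) = (\<integral>\<^sup>+\<omega>. f \<omega> \<partial>M)"
      using ae by (intro nn_integral_cong_AE) auto
    then show "(\<integral>\<^sup>+\<omega>. ennreal (enn2real (f \<omega>)) \<partial>M) < \<infinity>" using fin by simp
  qed auto
  show thesis
  proof (rule that[of "\<lambda>\<omega>. enn2real (f \<omega>)"])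
    fix A assume A [measurable]: "A \<in> sets M"
    have i: "integrable M (\<lambda>\<omega>. indicator A \<omega> * enn2real (f \<omega>))"
      using integrable_mult_indicator[OF A n_int] by simp
    have "ennreal (\<mu> A) = (\<integral>\<^sup>+\<omega>. ennreal (indicator A \<omega> * enn2real (f \<omega>)) \<partial>M)"
      unfolding int[OF A, symmetric] using ae
      by (intro nn_integral_cong_AE) (auto simp: indicator_def)
    also have "\<dots> = ennreal (\<integral>\<omega>. indicator A \<omega> * enn2real (f \<omega>) \<partial>M)"
      by (rule nn_integral_eq_integral[OF i]) simp
    finally show "\<mu> A = (\<integral>\<omega>. indicator A \<omega> * enn2real (f \<omega>) \<partial>M)"
      using nonneg[OF A] by (simp add: integral_nonneg_AE)
  qed (use n_int in auto)
qed

section \<open>Dual-valued versions of linear families\<close>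

lemma countable_dense_rational_subspace:
  obtains D :: "'y::{real_normed_vector, second_countable_topology} set"
  where "countable D" "\<And>x y. x \<in> D \<Longrightarrow> y \<in> D \<Longrightarrow> x + y \<in> D"
    "\<And>r x. x \<in> D \<Longrightarrow> real_of_rat r *\<^sub>R x \<in> D" "\<And>y. \<exists>s. (\<forall>n::nat. s n \<in> D) \<and> s \<longlonglongrightarrow> y"
proof -
  obtain D0 :: "'y set" where D0: "countable D0" "\<And>X. open X \<Longrightarrow> X \<noteq> {} \<Longrightarrow> \<exists>d\<in>D0. d \<in> X"
    by (rule countable_dense_setE) auto
  define c where "c xs = (\<Sum>(r, d)\<leftarrow>xs. real_of_rat r *\<^sub>R (d::'y))" for xs
  define D where "D = c ` lists (UNIV \<times> D0)"
  show thesis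
  proof (rule that[of D])
    show "countable D" unfolding D_def using D0(1) by (intro countable_image countable_lists countable_SIGMA) auto
    show "x + y \<in> D" if xy: "x \<in> D" "y \<in> D" for x y
    proof -
      obtain xs ys where "xs \<in> lists (UNIV \<times> D0)" "ys \<in> lists (UNIV \<times> D0)" "x = c xs" "y = c ys"
        using xy by (auto simp: D_def)
      then have "x + y = c (xs @ ys)" "xs @ ys \<in> lists (UNIV \<times> D0)" by (auto simp: c_def)
      then show ?thesis unfolding D_def by blast
    qed
    show "real_of_rat r *\<^sub>R x \<in> D" if x: "x \<in> D" for r x
    proof -
      obtain xs where xs: "xs \<in> lists (UNIV \<times> D0)" "x = c xs" using x by (auto simp: D_def)
      have "real_of_rat r *\<^sub>R c xs = c (map (\<lambda>(a, d). (r * a, d)) xs)"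
        by (induction xs) (auto simp: c_def scaleR_add_right of_rat_mult)
      moreover have "map (\<lambda>(a, d). (r * a, d)) xs \<in> lists (UNIV \<times> D0)" using xs(1) by auto
      ultimately show ?thesis unfolding D_def using xs by blast
    qed
    show "\<exists>s. (\<forall>n::nat. s n \<in> D) \<and> s \<longlonglongrightarrow> y" for y
    proof -
      have "D0 \<subseteq> D"
      proof
        fix d assume "d \<in> D0"
        then have "d = c [(1, d)]" "[(1, d)] \<in> lists (UNIV \<times> D0)" by (auto simp: c_def)
        then show "d \<in> D" unfolding D_def by blast
      qed
      then have "y \<in> closure D" using D0(2) unfolding closure_iff_nhds_not_empty by fast
      then show ?thesis by (simp add: closure_sequential)
    qed
  qed
qed

text \<open>
  On \<open>D\<close> the upper bound makes \<open>w\<close> Lipschitz, so \<open>w\<close> extends continuously; real scalars are reached as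
  limits of rational ones.
\<close>
lemma blinfun_extension_from_dense:
  fixes D :: "'y::real_normed_vector set" and w :: "'y \<Rightarrow> real"
  assumes D: "\<And>x y. x \<in> D \<Longrightarrow> y \<in> D \<Longrightarrow> x + y \<in> D" "\<And>r x. x \<in> D \<Longrightarrow> real_of_rat r *\<^sub>R x \<in> D"
      "\<And>y. \<exists>s. (\<forall>n::nat. s n \<in> D) \<and> s \<longlonglongrightarrow> y"
    and add: "\<And>x y. x \<in> D \<Longrightarrow> y \<in> D \<Longrightarrow> w (x + y) = w x + w y"
    and scale: "\<And>r x. x \<in> D \<Longrightarrow> w (real_of_rat r *\<^sub>R x) = real_of_rat r * w x"
    and bound: "\<And>x. x \<in> D \<Longrightarrow> w x \<le> K * norm x"
  obtains v :: "'y \<Rightarrow>\<^sub>L real" where "\<And>x. x \<in> D \<Longrightarrow> blinfun_apply v x = w x"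
proof -
  have minus: "- x \<in> D" "w (- x) = - w x" if "x \<in> D" for x
    using D(2)[OF that, of "-1"] scale[OF that, of "-1"] by auto
  have diff: "w x - w y \<le> K * norm (x - y)" if "x \<in> D" "y \<in> D" for x y
    using add[of x "- y"] minus[of y] bound[of "x - y"] D(1)[of x "-y"] that by simp
  have lip: "\<bar>w x - w y\<bar> \<le> K * norm (x - y)" if "x \<in> D" "y \<in> D" for x y
    using diff[OF that] diff[OF that(2,1)] by (simp add: norm_minus_commute abs_le_iff)
  obtain S where S: "\<And>y n. S y n \<in> D" "\<And>y. S y \<longlonglongrightarrow> y" using D(3) by metis
  have "Cauchy (\<lambda>n. w (S y n))" for y
  proof (rule metric_CauchyI)
    fix e :: real assume "0 < e"
    have "Cauchy (S y)" using S(2) by (rule LIMSEQ_imp_Cauchy)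
    then obtain M where M: "\<And>m n. m \<ge> M \<Longrightarrow> n \<ge> M \<Longrightarrow> dist (S y m) (S y n) < e / (\<bar>K\<bar> + 1)"
      using \<open>0 < e\<close> unfolding Cauchy_def by (metis abs_ge_zero add_nonneg_pos divide_pos_pos zero_less_one)
    have "dist (w (S y m)) (w (S y n)) < e" if "m \<ge> M" "n \<ge> M" for m n
    proof -
      have "dist (w (S y m)) (w (S y n)) \<le> K * dist (S y m) (S y n)"
        using lip[OF S(1) S(1)] by (simp add: dist_norm)
      also have "\<dots> \<le> (\<bar>K\<bar> + 1) * dist (S y m) (S y n)" by (intro mult_right_mono) auto
      also have "\<dots> < e" using M[OF that] by (simp add: field_simps add_pos_nonneg)
      finally show ?thesis .
    qed
    then show "\<exists>M. \<forall>m\<ge>M. \<forall>n\<ge>M. dist (w (S y m)) (w (S y n)) < e" by blast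
  qed
  then obtain \<phi> where \<phi>: "\<And>y. (\<lambda>n. w (S y n)) \<longlonglongrightarrow> \<phi> y"
    unfolding Cauchy_convergent_iff convergent_def by metis
  have lim: "(\<lambda>n. w (s n)) \<longlonglongrightarrow> \<phi> y" if s: "\<And>n. s n \<in> D" "s \<longlonglongrightarrow> y" for s y
  proof -
    have "(\<lambda>n. K * norm (s n - S y n)) \<longlonglongrightarrow> K * norm (y - y)"
      by (intro tendsto_intros s S)
    then have g0: "(\<lambda>n. K * norm (s n - S y n)) \<longlonglongrightarrow> 0" by simp
    have "(\<lambda>n. w (s n) - w (S y n)) \<longlonglongrightarrow> 0"
      by (rule Lim_null_comparison[OF always_eventually g0]) (use lip[OF s(1) S(1)] in simp)
    from tendsto_add[OF this \<phi>[of y]] show ?thesis by simp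
  qed
  have w_eq: "\<phi> x = w x" if "x \<in> D" for x
    using LIMSEQ_unique[OF lim[of "\<lambda>_. x" x]] that by simp
  have "bounded_linear \<phi>"
  proof (rule bounded_linear_intro)
    fix x y
    have "(\<lambda>n. w (S x n + S y n)) \<longlonglongrightarrow> \<phi> (x + y)"
      by (rule lim[OF D(1)[OF S(1) S(1)] tendsto_add[OF S(2) S(2)]])
    then have "(\<lambda>n. w (S x n) + w (S y n)) \<longlonglongrightarrow> \<phi> (x + y)" by (simp add: add S)
    with tendsto_add[OF \<phi> \<phi>] show "\<phi> (x + y) = \<phi> x + \<phi> y" by (metis LIMSEQ_unique)
  next
    fix c :: real and x
    obtain r :: "nat \<Rightarrow> rat" where r: "(\<lambda>n. real_of_rat (r n)) \<longlonglongrightarrow> c"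
    proof -
      have "c \<in> closure \<rat>" by (simp add: Rats_closure_real)
      then obtain q where q: "\<And>n::nat. q n \<in> \<rat>" "q \<longlonglongrightarrow> c" by (auto simp: closure_sequential)
      then have "\<forall>n. \<exists>r. q n = of_rat r" by (auto elim: Rats_cases)
      then obtain r where "\<And>n. q n = of_rat (r n)" by metis
      then have "q = (\<lambda>n. of_rat (r n))" by blast
      with q(2) show thesis by (intro that[of r]) simp
    qed
    have "(\<lambda>n. w (real_of_rat (r n) *\<^sub>R S x n)) \<longlonglongrightarrow> \<phi> (c *\<^sub>R x)"
      by (rule lim[OF D(2)[OF S(1)] tendsto_scaleR[OF r S(2)]])
    then have "(\<lambda>n. real_of_rat (r n) * w (S x n)) \<longlonglongrightarrow> \<phi> (c *\<^sub>R x)" by (simp add: scale S)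
    with tendsto_mult[OF r \<phi>] show "\<phi> (c *\<^sub>R x) = c *\<^sub>R \<phi> x" by (metis LIMSEQ_unique real_scaleR_def)
  next
    fix x
    have "(\<lambda>n. K * norm (S x n)) \<longlonglongrightarrow> K * norm x" by (intro tendsto_intros S)
    moreover have "(\<lambda>n. \<bar>w (S x n)\<bar>) \<longlonglongrightarrow> \<bar>\<phi> x\<bar>" by (intro tendsto_intros \<phi>)
    moreover have "\<bar>w (S x n)\<bar> \<le> K * norm (S x n)" for n
      using bound[OF S(1)[of x n]] bound[OF minus(1)[OF S(1)[of x n]]] minus(2)[OF S(1)[of x n]]
      by (auto simp: abs_le_iff)
    ultimately have "\<bar>\<phi> x\<bar> \<le> K * norm x" by (intro LIMSEQ_le) auto
    then show "norm (\<phi> x) \<le> norm x * K" by (simp add: mult.commute)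
  qed
  then show thesis using w_eq by (intro that[of "Blinfun \<phi>"]) (simp add: bounded_linear_Blinfun_apply)
qed

text \<open>
  The relations hold for each vector outside a null set that depends on it.  Restricted
  to a countable dense rational subspace they hold simultaneously outside one null set, where the
  values determine a bounded functional.  For vectors outside that subspace the bound gives
  agreement almost everywhere by approximation.
\<close>
lemma linear_version:
  fixes w :: "'y::{real_normed_vector, second_countable_topology} \<Rightarrow> 'a \<Rightarrow> real"
  assumes meas [measurable]: "\<And>y. w y \<in> borel_measurable M"
    and add: "\<And>y z. AE \<omega> in M. w (y + z) \<omega> = w y \<omega> + w z \<omega>"
    and scale: "\<And>c y. AE \<omega> in M. w (c *\<^sub>R y) \<omega> = c * w y \<omega>"
    and bound: "\<And>y. AE \<omega> in M. w y \<omega> \<le> K \<omega> * norm y"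
  obtains v :: "'a \<Rightarrow> 'y \<Rightarrow>\<^sub>L real"
  where "weakstar_measurable M v" "\<And>y. AE \<omega> in M. blinfun_apply (v \<omega>) y = w y \<omega>"
proof -
  obtain D :: "'y set" where D: "countable D" "\<And>x y. x \<in> D \<Longrightarrow> y \<in> D \<Longrightarrow> x + y \<in> D"
      "\<And>r x. x \<in> D \<Longrightarrow> real_of_rat r *\<^sub>R x \<in> D" "\<And>y. \<exists>s. (\<forall>n::nat. s n \<in> D) \<and> s \<longlonglongrightarrow> y"
    using countable_dense_rational_subspace by blast
  define good where "good \<omega> \<longleftrightarrow> (\<forall>x\<in>D. \<forall>y\<in>D. w (x + y) \<omega> = w x \<omega> + w y \<omega>) \<and>
     (\<forall>x\<in>D. \<forall>r. w (real_of_rat r *\<^sub>R x) \<omega> = real_of_rat r * w x \<omega>) \<and> (\<forall>x\<in>D. w x \<omega> \<le> K \<omega> * norm x)" for \<omega>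
  have "AE \<omega> in M. good \<omega>"
    unfolding good_def using D(1) add scale bound
    by (intro AE_conjI AE_ball_countable' ) (auto simp: AE_all_countable)
  then obtain N0 where N0: "{\<omega> \<in> space M. \<not> good \<omega>} \<subseteq> N0" "emeasure M N0 = 0" "N0 \<in> sets M"
    by (rule AE_E)
  have ex: "\<exists>v::'y \<Rightarrow>\<^sub>L real. \<forall>x\<in>D. blinfun_apply v x = w x \<omega>" if "good \<omega>" for \<omega>
  proof (rule blinfun_extension_from_dense[OF D(2-4), of "\<lambda>x. w x \<omega>" "K \<omega>"])
    show ?thesis if "\<And>x. x \<in> D \<Longrightarrow> blinfun_apply v x = w x \<omega>" for v :: "'y \<Rightarrow>\<^sub>L real"
      using that by blast
  qed (use that in \<open>auto simp: good_def\<close>)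
\<comment> \<open>The measure need not be complete, so measurability is enforced by the value 0 on a measurable
  null set that contains the exceptional points.\<close>
  define v where "v \<omega> = (if \<omega> \<in> N0 \<or> \<not> good \<omega> then 0 else SOME v::'y \<Rightarrow>\<^sub>L real. \<forall>x\<in>D. blinfun_apply v x = w x \<omega>)" for \<omega>
  have v: "blinfun_apply (v \<omega>) x = w x \<omega>" if "good \<omega>" "\<omega> \<notin> N0" "x \<in> D" for \<omega> x
    using someI_ex[OF ex[OF that(1)]] that by (simp add: v_def)
  have ae0: "AE \<omega> in M. \<omega> \<in> space M \<and> \<omega> \<notin> N0 \<and> good \<omega>"
    using AE_not_in[of N0 M] N0 AE_space[of M] by (auto simp: null_sets_def)
  show thesis
  proof (rule that)
    show "weakstar_measurable M v"
      unfolding weakstar_measurable_def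
    proof
      fix y
      obtain s where s: "\<And>n. s n \<in> D" "s \<longlonglongrightarrow> y" using D(4) by blast
      show "(\<lambda>\<omega>. blinfun_apply (v \<omega>) y) \<in> borel_measurable M"
      proof (rule borel_measurable_LIMSEQ_real)
        show "(\<lambda>n. blinfun_apply (v \<omega>) (s n)) \<longlonglongrightarrow> blinfun_apply (v \<omega>) y" for \<omega>
          by (intro tendsto_intros s)
        fix n
        have "(\<lambda>\<omega>. if \<omega> \<in> N0 then 0 else w (s n) \<omega>) \<in> borel_measurable M"
          using N0(3) by measurable
        moreover have "blinfun_apply (v \<omega>) (s n) = (if \<omega> \<in> N0 then 0 else w (s n) \<omega>)" if "\<omega> \<in> space M" for \<omega>
          using that N0(1) v[OF _ _ s(1)] by (auto simp: v_def)
        ultimately show "(\<lambda>\<omega>. blinfun_apply (v \<omega>) (s n)) \<in> borel_measurable M"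
          by (simp cong: measurable_cong)
      qed
    qed
    fix y
    obtain s where s: "\<And>n. s n \<in> D" "s \<longlonglongrightarrow> y" using D(4) by blast
    have "AE \<omega> in M. \<forall>n. w (y - s n) \<omega> \<le> K \<omega> * norm (y - s n) \<and> w (s n - y) \<omega> \<le> K \<omega> * norm (s n - y)
        \<and> w ((y - s n) + s n) \<omega> = w (y - s n) \<omega> + w (s n) \<omega> \<and> w ((s n - y) + y) \<omega> = w (s n - y) \<omega> + w y \<omega>"
      by (intro AE_all_countable[THEN iffD2] allI AE_conjI add bound)
    then show "AE \<omega> in M. blinfun_apply (v \<omega>) y = w y \<omega>"
      using ae0
    proof eventually_elim
      case (elim \<omega>)
      have "\<bar>w y \<omega> - blinfun_apply (v \<omega>) (s n)\<bar> \<le> K \<omega> * norm (y - s n)" for n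
      proof -
        have "blinfun_apply (v \<omega>) (s n) = w (s n) \<omega>" using elim(2) by (intro v s) auto
        moreover have "w (y - s n) \<omega> \<le> K \<omega> * norm (y - s n)" "w (s n - y) \<omega> \<le> K \<omega> * norm (y - s n)"
          "w y \<omega> = w (y - s n) \<omega> + w (s n) \<omega>" "w (s n) \<omega> = w (s n - y) \<omega> + w y \<omega>"
          using spec[OF elim(1), of n] unfolding diff_add_cancel norm_minus_commute[of "s n" y] by blast+
        ultimately show ?thesis by linarith
      qed
      moreover have "(\<lambda>n. K \<omega> * norm (y - s n)) \<longlonglongrightarrow> K \<omega> * norm (y - y)"
        by (intro tendsto_intros s)
      moreover have "(\<lambda>n. \<bar>w y \<omega> - blinfun_apply (v \<omega>) (s n)\<bar>) \<longlonglongrightarrow> \<bar>w y \<omega> - blinfun_apply (v \<omega>) y\<bar>"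
        by (intro tendsto_intros s)
      ultimately have "\<bar>w y \<omega> - blinfun_apply (v \<omega>) y\<bar> \<le> K \<omega> * norm (y - y)"
        by (intro LIMSEQ_le) auto
      then show ?case by simp
    qed
  qed
qed

section \<open>Convex functions and their directional derivatives\<close>

lemma measurable_caratheodory:
  fixes g :: "'y::{metric_space, second_countable_topology} \<Rightarrow> 'a \<Rightarrow> real"
  assumes cont: "\<And>\<omega>. \<omega> \<in> space M \<Longrightarrow> continuous_on UNIV (\<lambda>y. g y \<omega>)"
    and [measurable]: "\<And>y. g y \<in> borel_measurable M" and h: "h \<in> borel_measurable M"
  shows "(\<lambda>\<omega>. g (h \<omega>) \<omega>) \<in> borel_measurable M"
proof -
  obtain F where F: "\<And>i. simple_function M (F i)" "\<And>\<omega>. \<omega> \<in> space M \<Longrightarrow> (\<lambda>i. F i \<omega>) \<longlonglongrightarrow> h \<omega>"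
    using borel_measurable_implies_sequence_metric[OF h, of undefined] by blast
  show ?thesis
  proof (rule borel_measurable_LIMSEQ_real)
    show "(\<lambda>i. g (F i \<omega>) \<omega>) \<longlonglongrightarrow> g (h \<omega>) \<omega>" if "\<omega> \<in> space M" for \<omega>
      using continuous_on_tendsto_compose[OF cont[OF that] F(2)[OF that]] by simp
    fix i
    have "F i \<in> measurable M (count_space (F i ` space M))"
      using F(1)[of i] by (auto simp: measurable_count_space_eq2 simple_function_def)
    then show "(\<lambda>\<omega>. g (F i \<omega>) \<omega>) \<in> borel_measurable M"
      by (rule measurable_compose_countable'[where f=g, rotated])
        (use F(1)[of i] in \<open>auto simp: simple_function_def intro: countable_finite\<close>)
  qed
qed

text \<open>
  For convex \<open>\<phi>\<close> the difference quotient is nondecreasing in \<open>t > 0\<close>, so the infimum is the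
  one-sided directional derivative.
\<close>
definition dir_deriv :: "('y::real_normed_vector \<Rightarrow> real) \<Rightarrow> 'y \<Rightarrow> 'y \<Rightarrow> real" where
  "dir_deriv \<phi> x y = (INF t\<in>{0<..}. (\<phi> (x + t *\<^sub>R y) - \<phi> x) / t)"

context
  fixes \<phi> :: "'y::real_normed_vector \<Rightarrow> real" and x :: 'y
  assumes conv: "convex_on UNIV \<phi>"
begin

lemma convex_combD: "0 \<le> t \<Longrightarrow> t \<le> 1 \<Longrightarrow> \<phi> ((1 - t) *\<^sub>R y + t *\<^sub>R z) \<le> (1 - t) * \<phi> y + t * \<phi> z"
  using convex_onD[OF conv, of t y z] by simp

lemma difference_quotient_mono:
  assumes "0 < s" "s \<le> t"
  shows "(\<phi> (x + s *\<^sub>R y) - \<phi> x) / s \<le> (\<phi> (x + t *\<^sub>R y) - \<phi> x) / t"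
proof -
  have eq: "(1 - s / t) *\<^sub>R x + (s / t) *\<^sub>R (x + t *\<^sub>R y) = x + s *\<^sub>R y"
    using assms by (simp add: algebra_simps)
  have "\<phi> (x + s *\<^sub>R y) \<le> (1 - s / t) * \<phi> x + (s / t) * \<phi> (x + t *\<^sub>R y)"
    using convex_combD[of "s / t" x "x + t *\<^sub>R y"] assms unfolding eq by simp
  then show ?thesis using assms by (simp add: field_simps)
qed

lemma difference_quotient_lower:
  assumes "0 < t"
  shows "\<phi> x - \<phi> (x - y) \<le> (\<phi> (x + t *\<^sub>R y) - \<phi> x) / t"
proof -
  have c: "1 - 1 / (1 + t) = t / (1 + t)" using assms by (simp add: field_simps)
  have eq: "(1 - 1 / (1 + t)) *\<^sub>R (x - y) + (1 / (1 + t)) *\<^sub>R (x + t *\<^sub>R y) = x"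
  proof -
    from c have "(1 - 1 / (1 + t)) *\<^sub>R (x - y) + (1 / (1 + t)) *\<^sub>R (x + t *\<^sub>R y)
       = (t / (1 + t) + 1 / (1 + t)) *\<^sub>R x"
      by (simp add: scaleR_add_right scaleR_diff_right scaleR_add_left)
    also have "t / (1 + t) + 1 / (1 + t) = 1" using assms by (simp add: field_simps)
    finally show ?thesis by simp
  qed
  have "\<phi> x \<le> (1 - 1 / (1 + t)) * \<phi> (x - y) + 1 / (1 + t) * \<phi> (x + t *\<^sub>R y)"
    using convex_combD[of "1 / (1 + t)" "x - y" "x + t *\<^sub>R y"] assms unfolding eq by simp
  also have "\<dots> = (t * \<phi> (x - y) + \<phi> (x + t *\<^sub>R y)) / (1 + t)"
    unfolding c by (simp add: add_divide_distrib)
  finally have "\<phi> x * (1 + t) \<le> t * \<phi> (x - y) + \<phi> (x + t *\<^sub>R y)"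
    using assms by (simp add: pos_le_divide_eq)
  then have "(\<phi> x - \<phi> (x - y)) * t \<le> \<phi> (x + t *\<^sub>R y) - \<phi> x" by (simp add: algebra_simps)
  then show ?thesis by (simp only: pos_le_divide_eq[OF assms])
qed

lemma dir_deriv_le: "0 < t \<Longrightarrow> dir_deriv \<phi> x y \<le> (\<phi> (x + t *\<^sub>R y) - \<phi> x) / t"
  unfolding dir_deriv_def
  by (intro cINF_lower bdd_belowI2[where m="\<phi> x - \<phi> (x - y)"]) (auto intro: difference_quotient_lower)

lemma dir_deriv_upper: "dir_deriv \<phi> x y \<le> \<phi> (x + y) - \<phi> x"
  using dir_deriv_le[of 1 y] by simp

lemma dir_deriv_lower: "\<phi> x - \<phi> (x - y) \<le> dir_deriv \<phi> x y"
  unfolding dir_deriv_def by (intro cINF_greatest) (auto intro: difference_quotient_lower)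

lemma dir_deriv_LIMSEQ:
  "(\<lambda>n. (\<phi> (x + inverse (real (Suc n)) *\<^sub>R y) - \<phi> x) / inverse (real (Suc n))) \<longlonglongrightarrow> dir_deriv \<phi> x y"
proof (rule order_tendstoI)
  fix a assume "a < dir_deriv \<phi> x y"
  then show "\<forall>\<^sub>F n in sequentially. a < (\<phi> (x + inverse (real (Suc n)) *\<^sub>R y) - \<phi> x) / inverse (real (Suc n))"
    by (intro always_eventually allI less_le_trans[OF _ dir_deriv_le]) auto
next
  fix a assume "dir_deriv \<phi> x y < a"
  then obtain t where t: "0 < t" "(\<phi> (x + t *\<^sub>R y) - \<phi> x) / t < a"
    unfolding dir_deriv_def
    by (subst (asm) cINF_less_iff)
      (auto intro!: bdd_belowI2[where m="\<phi> x - \<phi> (x - y)"] difference_quotient_lower)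
  have "\<forall>\<^sub>F n in sequentially. inverse (real (Suc n)) < t"
    using order_tendstoD(2)[OF LIMSEQ_inverse_real_of_nat t(1)] .
  then show "\<forall>\<^sub>F n in sequentially. (\<phi> (x + inverse (real (Suc n)) *\<^sub>R y) - \<phi> x) / inverse (real (Suc n)) < a"
  proof eventually_elim
    case (elim n)
    have "(\<phi> (x + inverse (real (Suc n)) *\<^sub>R y) - \<phi> x) / inverse (real (Suc n)) \<le> (\<phi> (x + t *\<^sub>R y) - \<phi> x) / t"
      by (rule difference_quotient_mono) (use elim in auto)
    with t(2) show ?case by linarith
  qed
qed

lemma sublinear_dir_deriv: "sublinear (dir_deriv \<phi> x)"
  unfolding dir_deriv_def[abs_def]
proof (rule sublinear_INF)
  show "bdd_below ((\<lambda>t. (\<phi> (x + t *\<^sub>R y) - \<phi> x) / t) ` {0<..})" for y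
    by (intro bdd_belowI2[where m="\<phi> x - \<phi> (x - y)"]) (auto intro: difference_quotient_lower)
next
  fix y z and t s :: real assume "t \<in> {0<..}" "s \<in> {0<..}"
  then have st: "0 < t" "0 < s" by auto
  define b where "b = t / (s + t)"
  define r where "r = (1 - b) * t"
  have b1: "1 - b = s / (s + t)" using st by (simp add: b_def field_simps)
  have b: "0 < b" "0 < 1 - b" using st unfolding b1 by (simp_all add: b_def)
  have rs: "r = b * s" unfolding r_def b1 by (simp add: b_def)
  have r: "0 < r" using st b by (simp add: rs)
  have "\<phi> (x + r *\<^sub>R (y + z)) \<le> (1 - b) * \<phi> (x + t *\<^sub>R y) + b * \<phi> (x + s *\<^sub>R z)"
  proof -
    have "(1 - b) *\<^sub>R (x + t *\<^sub>R y) + b *\<^sub>R (x + s *\<^sub>R z)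
        = ((1 - b) *\<^sub>R x + b *\<^sub>R x) + ((1 - b) * t) *\<^sub>R y + (b * s) *\<^sub>R z"
      by (simp add: scaleR_add_right)
    also have "\<dots> = x + r *\<^sub>R (y + z)"
      by (simp flip: r_def rs scaleR_add_left) (simp add: scaleR_add_right)
    finally show ?thesis using convex_combD[of b "x + t *\<^sub>R y" "x + s *\<^sub>R z"] b by simp
  qed
  then have "\<phi> (x + r *\<^sub>R (y + z)) - \<phi> x \<le> (1 - b) * (\<phi> (x + t *\<^sub>R y) - \<phi> x) + b * (\<phi> (x + s *\<^sub>R z) - \<phi> x)"
    by (simp add: algebra_simps)
  then have "(\<phi> (x + r *\<^sub>R (y + z)) - \<phi> x) / r
      \<le> ((1 - b) * (\<phi> (x + t *\<^sub>R y) - \<phi> x) + b * (\<phi> (x + s *\<^sub>R z) - \<phi> x)) / r"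
    using r by (intro divide_right_mono) auto
  also have "\<dots> = (1 - b) * (\<phi> (x + t *\<^sub>R y) - \<phi> x) / r + b * (\<phi> (x + s *\<^sub>R z) - \<phi> x) / r"
    by (simp add: add_divide_distrib)
  also have "(1 - b) * (\<phi> (x + t *\<^sub>R y) - \<phi> x) / r = (\<phi> (x + t *\<^sub>R y) - \<phi> x) / t"
    using b(2) by (simp add: r_def)
  also have "b * (\<phi> (x + s *\<^sub>R z) - \<phi> x) / r = (\<phi> (x + s *\<^sub>R z) - \<phi> x) / s"
    using b(1) by (simp add: rs)
  finally show "\<exists>k\<in>{0<..}. (\<phi> (x + k *\<^sub>R (y + z)) - \<phi> x) / k
      \<le> (\<phi> (x + t *\<^sub>R y) - \<phi> x) / t + (\<phi> (x + s *\<^sub>R z) - \<phi> x) / s"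
    using r by (intro bexI[of _ r]) auto
next
  fix c :: real and y and t :: real assume "0 < c" "t \<in> {0<..}"
  then show "\<exists>k\<in>{0<..}. (\<phi> (x + k *\<^sub>R (c *\<^sub>R y)) - \<phi> x) / k \<le> c * ((\<phi> (x + t *\<^sub>R y) - \<phi> x) / t)"
    by (intro bexI[of _ "t / c"]) (auto simp: mult.commute)
qed auto

lemma dir_deriv_bound:
  assumes "isCont \<phi> x"
  obtains K where "\<And>y. dir_deriv \<phi> x y \<le> K * norm y"
proof -
  obtain d where d: "0 < d" "\<And>z. dist z x < d \<Longrightarrow> dist (\<phi> z) (\<phi> x) < 1"
    using assms by (auto simp: continuous_at_eps_delta dest: spec[of _ "1::real"])
  show thesis
  proof (rule that[of "2 / d"])
    fix y
    show "dir_deriv \<phi> x y \<le> 2 / d * norm y"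
    proof (cases "y = 0")
      case True
      then show ?thesis using dir_deriv_upper[of 0] by simp
    next
      case False
      define t where "t = d / (2 * norm y)"
      have t: "0 < t" "dist (x + t *\<^sub>R y) x < d" using d(1) False by (auto simp: t_def dist_norm)
      have "dir_deriv \<phi> x y \<le> (\<phi> (x + t *\<^sub>R y) - \<phi> x) / t" by (rule dir_deriv_le[OF t(1)])
      also have "\<dots> \<le> 1 / t"
        using d(2)[OF t(2)] t(1) by (intro divide_right_mono) (auto simp: dist_real_def)
      finally show ?thesis by (simp add: t_def)
    qed
  qed
qed

lemma subdiffI: assumes "\<And>y. blinfun_apply s y \<le> dir_deriv \<phi> x y" shows "s \<in> subdiff \<phi> x"
proof -
  have "\<phi> x + blinfun_apply s (z - x) \<le> \<phi> z" for z
    using assms[of "z - x"] dir_deriv_upper[of "z - x"] by simp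
  then show ?thesis by (simp add: subdiff_def)
qed

end

section \<open>Integrals of sublinear integrands\<close>

lemma integrable_between:
  fixes f :: "'a \<Rightarrow> real"
  assumes "integrable M a" "integrable M b" "f \<in> borel_measurable M"
    and "AE \<omega> in M. a \<omega> \<le> f \<omega>" "AE \<omega> in M. f \<omega> \<le> b \<omega>"
  shows "integrable M f"
proof (rule Bochner_Integration.integrable_bound)
  show "integrable M (\<lambda>\<omega>. \<bar>a \<omega>\<bar> + \<bar>b \<omega>\<bar>)" using assms(1,2) by simp
  show "AE \<omega> in M. norm (f \<omega>) \<le> norm (\<bar>a \<omega>\<bar> + \<bar>b \<omega>\<bar>)"
    using assms(4,5) by eventually_elim auto
qed fact

lemma AE_eq_if_set_integrals_eq:
  fixes a b :: "'a \<Rightarrow> real"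
  assumes ab: "integrable M a" "integrable M b"
    and eq: "\<And>A. A \<in> sets M \<Longrightarrow> (\<integral>\<omega>. indicator A \<omega> * a \<omega> \<partial>M) = (\<integral>\<omega>. indicator A \<omega> * b \<omega> \<partial>M)"
  shows "AE \<omega> in M. a \<omega> = b \<omega>"
proof -
  have *: "AE \<omega> in M. a \<omega> \<le> b \<omega>" if ab [measurable]: "integrable M a" "integrable M b"
    and eq: "\<And>A. A \<in> sets M \<Longrightarrow> (\<integral>\<omega>. indicator A \<omega> * a \<omega> \<partial>M) = (\<integral>\<omega>. indicator A \<omega> * b \<omega> \<partial>M)"
    for a b :: "'a \<Rightarrow> real"
  proof -
    define A where "A = {\<omega> \<in> space M. b \<omega> < a \<omega>}"
    have A: "A \<in> sets M" unfolding A_def by measurable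
    have i: "integrable M (\<lambda>\<omega>. indicator A \<omega> * a \<omega>)" "integrable M (\<lambda>\<omega>. indicator A \<omega> * b \<omega>)"
      using integrable_mult_indicator[OF A ab(1)] integrable_mult_indicator[OF A ab(2)] by simp_all
    have nn: "0 \<le> indicator A \<omega> * (a \<omega> - b \<omega>)" for \<omega> by (auto simp: A_def indicator_def)
    have "integrable M (\<lambda>\<omega>. indicator A \<omega> * (a \<omega> - b \<omega>))"
      using Bochner_Integration.integrable_diff[OF i] by (simp add: right_diff_distrib)
    moreover have "(\<integral>\<omega>. indicator A \<omega> * (a \<omega> - b \<omega>) \<partial>M) = 0"
      using eq[OF A] i by (simp add: right_diff_distrib)
    ultimately have "AE \<omega> in M. indicator A \<omega> * (a \<omega> - b \<omega>) = 0"
      using nn by (subst (asm) integral_nonneg_eq_0_iff_AE) auto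
    then show ?thesis using AE_space by eventually_elim (auto simp: A_def indicator_def split: if_splits)
  qed
  have "AE \<omega> in M. a \<omega> \<le> b \<omega>" "AE \<omega> in M. b \<omega> \<le> a \<omega>"
    using *[OF ab eq] *[OF ab(2,1) eq[symmetric]] by auto
  then show ?thesis by eventually_elim auto
qed

lemma sublinear_continuous:
  fixes p :: "'y::real_normed_vector \<Rightarrow> real"
  assumes p: "sublinear p" and K: "\<And>y. p y \<le> K * norm y"
  shows "continuous_on UNIV p"
proof -
  have diff: "p y - p z \<le> K * norm (y - z)" for y z
    using sublinear_add[OF p, of "y - z" z] K[of "y - z"] by simp
  have lip: "\<bar>p y - p z\<bar> \<le> \<bar>K\<bar> * norm (y - z)" for y z
  proof -
    have "\<bar>p y - p z\<bar> \<le> K * norm (y - z)"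
      using diff[of y z] diff[of z y] by (simp add: abs_le_iff norm_minus_commute)
    also have "\<dots> \<le> \<bar>K\<bar> * norm (y - z)" by (intro mult_right_mono) auto
    finally show ?thesis .
  qed
  have "isCont p z" for z
  proof -
    have "((\<lambda>y. \<bar>K\<bar> * norm (y - z)) \<longlongrightarrow> \<bar>K\<bar> * norm (z - z)) (at z)" by (intro tendsto_intros)
    then have g0: "((\<lambda>y. \<bar>K\<bar> * norm (y - z)) \<longlongrightarrow> 0) (at z)" by simp
    have "((\<lambda>y. p y - p z) \<longlongrightarrow> 0) (at z)"
      by (rule Lim_null_comparison[OF always_eventually g0]) (use lip in simp)
    then show ?thesis by (simp add: isCont_def LIM_zero_iff)
  qed
  then show ?thesis by (simp add: continuous_at_imp_continuous_on)
qed

text \<open>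
  Both sides are continuous in \<open>y\<close>, so it suffices to collect the exceptional null sets over a countable
  dense set.
\<close>
lemma AE_blinfun_le_sublinear:
  fixes v :: "'a \<Rightarrow> 'y::{real_normed_vector, second_countable_topology} \<Rightarrow>\<^sub>L real"
  assumes "\<And>\<omega>. continuous_on UNIV (\<lambda>y. g y \<omega>)"
    and "\<And>y. AE \<omega> in M. blinfun_apply (v \<omega>) y \<le> g y \<omega>"
  shows "AE \<omega> in M. \<forall>y. blinfun_apply (v \<omega>) y \<le> g y \<omega>"
proof -
  obtain D :: "'y set" where D: "countable D" "\<And>y. \<exists>s. (\<forall>n::nat. s n \<in> D) \<and> s \<longlonglongrightarrow> y"
    using countable_dense_rational_subspace by metis
  have "AE \<omega> in M. \<forall>y\<in>D. blinfun_apply (v \<omega>) y \<le> g y \<omega>"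
    by (rule AE_ball_countable'[OF assms(2) D(1)])
  then show ?thesis
  proof eventually_elim
    case (elim \<omega>)
    show ?case
    proof
      fix y
      obtain s where s: "\<And>n. s n \<in> D" "s \<longlonglongrightarrow> y" using D(2) by blast
      have g_lim: "(\<lambda>n. g (s n) \<omega>) \<longlonglongrightarrow> g y \<omega>"
        using continuous_on_tendsto_compose[OF assms(1) s(2)] by simp
      have v_lim: "(\<lambda>n. blinfun_apply (v \<omega>) (s n)) \<longlonglongrightarrow> blinfun_apply (v \<omega>) y"
        by (intro tendsto_intros s)
      show "blinfun_apply (v \<omega>) y \<le> g y \<omega>"
        by (rule LIMSEQ_le[OF v_lim g_lim]) (use elim s(1) in blast)
    qed
  qed
qed

lemma weakstar_measurable_apply:
  fixes v :: "'a \<Rightarrow> 'y::{real_normed_vector, second_countable_topology} \<Rightarrow>\<^sub>L real"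
  assumes "weakstar_measurable M v" "h \<in> borel_measurable M"
  shows "(\<lambda>\<omega>. blinfun_apply (v \<omega>) (h \<omega>)) \<in> borel_measurable M"
proof (rule measurable_caratheodory[where g="\<lambda>y \<omega>. blinfun_apply (v \<omega>) y"])
  show "continuous_on UNIV (\<lambda>y. blinfun_apply (v \<omega>) y)" for \<omega>
    by (rule linear_continuous_on[OF blinfun.bounded_linear_right])
qed (use assms in \<open>simp_all add: weakstar_measurable_def\<close>)

text \<open>
  A measurable choice of a point satisfying \<open>Q\<close>: the first element of a countable dense set that does.
  The chosen function has countably many values and is given by its index \<open>k\<close>.
\<close>
lemma measurable_countable_approximation:
  fixes Q :: "'a \<Rightarrow> 'y::{real_normed_vector, second_countable_topology} \<Rightarrow> bool"
  assumes "\<And>\<omega>. \<exists>U. open U \<and> U \<noteq> {} \<and> (\<forall>y\<in>U. Q \<omega> y)"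
    and [measurable]: "\<And>y. Measurable.pred M (\<lambda>\<omega>. Q \<omega> y)"
  obtains d :: "nat \<Rightarrow> 'y" and k :: "'a \<Rightarrow> nat"
  where "k \<in> measurable M (count_space UNIV)" "\<And>\<omega>. Q \<omega> (d (k \<omega>))"
proof -
  obtain D :: "'y set" where D: "countable D" "\<And>X. open X \<Longrightarrow> X \<noteq> {} \<Longrightarrow> \<exists>d\<in>D. d \<in> X"
    by (rule countable_dense_setE) auto
  have ex: "\<exists>n. Q \<omega> (from_nat_into D n)" for \<omega>
    using assms(1)[of \<omega>] D(2) from_nat_into_surj[OF D(1)] by metis
  show thesis
  proof (rule that[of "\<lambda>\<omega>. LEAST n. Q \<omega> (from_nat_into D n)" "from_nat_into D"])
    show "(\<lambda>\<omega>. LEAST n. Q \<omega> (from_nat_into D n)) \<in> measurable M (count_space UNIV)" by measurable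
    show "Q \<omega> (from_nat_into D (LEAST n. Q \<omega> (from_nat_into D n)))" for \<omega>
      by (rule LeastI_ex[OF ex])
  qed
qed

lemma measurable_countable_valued:
  assumes [measurable]: "k \<in> measurable M (count_space (UNIV::nat set))"
  shows "(\<lambda>\<omega>. d (k \<omega>)) \<in> borel_measurable M"
  by (rule measurable_compose[OF assms]) simp

lemma integral_indicator_vanishing:
  fixes b :: "'a \<Rightarrow> real" and k :: "'a \<Rightarrow> nat"
  assumes b: "integrable M b" and [measurable]: "k \<in> measurable M (count_space UNIV)"
  shows "(\<lambda>m. \<integral>\<omega>. indicator {\<omega>. k \<omega> < m} \<omega> * b \<omega> \<partial>M) \<longlonglongrightarrow> (\<integral>\<omega>. b \<omega> \<partial>M)"
proof (rule integral_dominated_convergence)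
  show "integrable M (\<lambda>\<omega>. \<bar>b \<omega>\<bar>)" using b by simp
  show "b \<in> borel_measurable M" using b by simp
  then show "(\<lambda>\<omega>. indicator {\<omega>. k \<omega> < m} \<omega> * b \<omega>) \<in> borel_measurable M" for m by measurable
  show "AE \<omega> in M. (\<lambda>m. indicator {\<omega>. k \<omega> < m} \<omega> * b \<omega>) \<longlonglongrightarrow> b \<omega>"
  proof (rule AE_I2)
    fix \<omega>
    have "\<forall>\<^sub>F m in sequentially. indicator {\<omega>. k \<omega> < m} \<omega> * b \<omega> = b \<omega>"
      using eventually_gt_at_top[of "k \<omega>"] by eventually_elim simp
    then show "(\<lambda>m. indicator {\<omega>. k \<omega> < m} \<omega> * b \<omega>) \<longlonglongrightarrow> b \<omega>" by (rule tendsto_eventually)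
  qed
  show "AE \<omega> in M. norm (indicator {\<omega>. k \<omega> < m} \<omega> * b \<omega>) \<le> \<bar>b \<omega>\<bar>" for m
    by (rule AE_I2) (auto simp: indicator_def)
qed

lemma integral_split_countable:
  fixes F :: "nat \<Rightarrow> 'a \<Rightarrow> real"
  assumes [measurable]: "k \<in> measurable M (count_space UNIV)" and F: "\<And>i. integrable M (F i)"
  shows "(\<integral>\<omega>. indicator {\<omega>. k \<omega> < m} \<omega> * F (k \<omega>) \<omega> \<partial>M) =
    (\<Sum>i<m. \<integral>\<omega>. indicator {\<omega> \<in> space M. k \<omega> = i} \<omega> * F i \<omega> \<partial>M)"
proof -
  have J: "{\<omega> \<in> space M. k \<omega> = i} \<in> sets M" for i by measurable
  have "(\<Sum>i<m. \<integral>\<omega>. indicator {\<omega> \<in> space M. k \<omega> = i} \<omega> * F i \<omega> \<partial>M) =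
      (\<integral>\<omega>. (\<Sum>i<m. indicator {\<omega> \<in> space M. k \<omega> = i} \<omega> * F i \<omega>) \<partial>M)"
    using integrable_mult_indicator[OF J F] by (intro Bochner_Integration.integral_sum[symmetric]) simp
  also have "\<dots> = (\<integral>\<omega>. indicator {\<omega>. k \<omega> < m} \<omega> * F (k \<omega>) \<omega> \<partial>M)"
  proof (rule Bochner_Integration.integral_cong[OF refl])
    fix \<omega> assume "\<omega> \<in> space M"
    then have "(\<Sum>i<m. indicator {\<omega> \<in> space M. k \<omega> = i} \<omega> * F i \<omega>) = (\<Sum>i<m. if i = k \<omega> then F (k \<omega>) \<omega> else 0)"
      by (intro sum.cong) auto
    then show "(\<Sum>i<m. indicator {\<omega> \<in> space M. k \<omega> = i} \<omega> * F i \<omega>) = indicator {\<omega>. k \<omega> < m} \<omega> * F (k \<omega>) \<omega>"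
      by simp
  qed
  finally show ?thesis by simp
qed

text \<open>
  An integrand \<open>g\<close> that is sublinear and continuous in its first argument; the linear upper bound is
  equivalent to continuity.  Its integral \<open>total\<close> is a sublinear function on \<open>dom\<close>, the
  space of all functions along which \<open>g\<close> is integrable in both directions.
\<close>
locale sublinear_integrand = finite_measure M for M :: "'a measure" +
  fixes g :: "'y::{real_normed_vector, second_countable_topology} \<Rightarrow> 'a \<Rightarrow> real"
  assumes g_measurable [measurable]: "g y \<in> borel_measurable M"
    and g_sublinear: "sublinear (\<lambda>y. g y \<omega>)"
    and g_bounded: "\<exists>K. \<forall>y. g y \<omega> \<le> K * norm y"
    and g_integrable: "integrable M (g y)"
begin

lemma g_continuous: "continuous_on UNIV (\<lambda>y. g y \<omega>)"
  using g_bounded[of \<omega>] by (auto intro: sublinear_continuous[OF g_sublinear])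

lemma g_apply_measurable [measurable]:
  "h \<in> borel_measurable M \<Longrightarrow> (\<lambda>\<omega>. g (h \<omega>) \<omega>) \<in> borel_measurable M"
  by (rule measurable_caratheodory[OF g_continuous]) auto

lemma g_minus: "- g (- y) \<omega> \<le> g y \<omega>"
  using sublinear_minus[OF g_sublinear] .

lemma g_0 [simp]: "g 0 \<omega> = 0"
  using sublinear_0[OF g_sublinear] .

definition dom :: "('a \<Rightarrow> 'y) set" where
  "dom = {h \<in> borel_measurable M. integrable M (\<lambda>\<omega>. g (h \<omega>) \<omega>) \<and> integrable M (\<lambda>\<omega>. g (- h \<omega>) \<omega>)}"

definition total :: "('a \<Rightarrow> 'y) \<Rightarrow> real" where
  "total h = (\<integral>\<omega>. g (h \<omega>) \<omega> \<partial>M)"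

lemma domD: "h \<in> dom \<Longrightarrow> h \<in> borel_measurable M" "h \<in> dom \<Longrightarrow> integrable M (\<lambda>\<omega>. g (h \<omega>) \<omega>)"
  "h \<in> dom \<Longrightarrow> integrable M (\<lambda>\<omega>. g (- h \<omega>) \<omega>)"
  by (auto simp: dom_def)

lemma dom_minus: "h \<in> dom \<Longrightarrow> - h \<in> dom"
  by (auto simp: dom_def fun_Compl_def)

lemma dom_add: assumes h: "h \<in> dom" and k: "k \<in> dom" shows "h + k \<in> dom"
proof -
  have *: "integrable M (\<lambda>\<omega>. g (h \<omega> + k \<omega>) \<omega>)" if h: "h \<in> dom" and k: "k \<in> dom" for h k
  proof (rule integrable_between)
    have [measurable]: "h \<in> borel_measurable M" "k \<in> borel_measurable M" using h k by (auto simp: dom_def)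
    show "integrable M (\<lambda>\<omega>. - (g (- h \<omega>) \<omega> + g (- k \<omega>) \<omega>))" "integrable M (\<lambda>\<omega>. g (h \<omega>) \<omega> + g (k \<omega>) \<omega>)"
      using h k by (auto simp: dom_def)
    show "(\<lambda>\<omega>. g (h \<omega> + k \<omega>) \<omega>) \<in> borel_measurable M" by measurable
    show "AE \<omega> in M. - (g (- h \<omega>) \<omega> + g (- k \<omega>) \<omega>) \<le> g (h \<omega> + k \<omega>) \<omega>"
    proof (rule AE_I2)
      fix \<omega>
      have "g (- h \<omega> + - k \<omega>) \<omega> \<le> g (- h \<omega>) \<omega> + g (- k \<omega>) \<omega>" by (rule sublinear_add[OF g_sublinear])
      then show "- (g (- h \<omega>) \<omega> + g (- k \<omega>) \<omega>) \<le> g (h \<omega> + k \<omega>) \<omega>"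
        using g_minus[of "h \<omega> + k \<omega>" \<omega>] by simp
    qed
    show "AE \<omega> in M. g (h \<omega> + k \<omega>) \<omega> \<le> g (h \<omega>) \<omega> + g (k \<omega>) \<omega>"
      by (intro AE_I2 sublinear_add[OF g_sublinear])
  qed
  have "integrable M (\<lambda>\<omega>. g ((- h) \<omega> + (- k) \<omega>) \<omega>)" by (rule *[OF dom_minus dom_minus]) fact+
  then show ?thesis using *[OF h k] h k by (auto simp: dom_def plus_fun_def)
qed

lemma dom_scale: assumes h: "h \<in> dom" shows "c *\<^sub>R h \<in> dom"
proof -
  have *: "c *\<^sub>R h \<in> dom" if "0 \<le> c" "h \<in> dom" for c h
  proof -
    have "g (c *\<^sub>R y) \<omega> = c * g y \<omega>" for y \<omega>
      using sublinear_scale[OF g_sublinear that(1)] .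
    from this[of "- y" for y] this show ?thesis using that(2)
      by (auto simp: dom_def scaleR_fun_def simp flip: scaleR_minus_right)
  qed
  show ?thesis
  proof (cases "0 \<le> c")
    case False
    then have "(- c) *\<^sub>R (- h) \<in> dom" by (intro * dom_minus h) auto
    then show ?thesis by simp
  qed (use * h in auto)
qed

lemma subspace_dom: "subspace dom"
  unfolding subspace_def using dom_add dom_scale by (auto simp: dom_def zero_fun_def)

lemma g_indicator: "g (indicator A \<omega> *\<^sub>R y) \<omega> = indicator A \<omega> * g y \<omega>"
  using sublinear_scale[OF g_sublinear, of "indicator A \<omega>" y \<omega>] by simp

lemma dom_indicator:
  assumes h: "h \<in> dom" and A: "A \<in> sets M" shows "(\<lambda>\<omega>. indicator A \<omega> *\<^sub>R h \<omega>) \<in> dom"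
proof -
  have [measurable]: "h \<in> borel_measurable M" "A \<in> sets M" using h A by (auto simp: dom_def)
  have "integrable M (\<lambda>\<omega>. g (indicator A \<omega> *\<^sub>R h \<omega>) \<omega>)" if "h \<in> dom" for h
    using integrable_mult_indicator[OF A domD(2)[OF that]] by (simp add: g_indicator)
  from this[OF h] this[OF dom_minus[OF h]] show ?thesis by (simp add: dom_def)
qed

lemma const_in_dom: "(\<lambda>_. y) \<in> dom"
  using g_integrable by (auto simp: dom_def)

lemma total_add: assumes h: "h \<in> dom" and k: "k \<in> dom" shows "total (h + k) \<le> total h + total k"
proof -
  have "total (h + k) \<le> (\<integral>\<omega>. g (h \<omega>) \<omega> + g (k \<omega>) \<omega> \<partial>M)"
    unfolding total_def
    by (intro integral_mono) (use domD[OF h] domD[OF k] domD(2)[OF dom_add[OF h k]] in \<open>auto intro: sublinear_add[OF g_sublinear]\<close>)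
  also have "\<dots> = total h + total k" using domD[OF h] domD[OF k] by (simp add: total_def)
  finally show ?thesis .
qed

lemma total_scale: "0 \<le> c \<Longrightarrow> total (c *\<^sub>R h) = c * total h"
  using sublinear_scale[OF g_sublinear] by (simp add: total_def)

text \<open>
  Hahn-Banach for the integral functional, obtained from \<open>convex_sandwich\<close> with \<open>total (h + k) - l k\<close>.
  The choice \<open>h = - k\<close> gives \<open>l k \<le> z k\<close>, and equality follows by passing to \<open>- k\<close>.
\<close>
lemma linear_minorant_extending:
  assumes L: "subspace L" "L \<subseteq> dom"
    and lin: "\<And>h k a b. h \<in> L \<Longrightarrow> k \<in> L \<Longrightarrow> l (a *\<^sub>R h + b *\<^sub>R k) = a * l h + b * l k"
    and le: "\<And>h. h \<in> L \<Longrightarrow> l h \<le> total h"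
  obtains z where "linear z" "\<And>h. h \<in> dom \<Longrightarrow> z h \<le> total h" "\<And>h. h \<in> L \<Longrightarrow> z h = l h"
proof -
  have l0: "l 0 = 0" using lin[of 0 0 0 0] subspace_0[OF L(1)] by simp
  obtain z where z: "linear z" "\<And>h k. h \<in> dom \<Longrightarrow> k \<in> L \<Longrightarrow> z h \<le> total (h + k) - l k"
  proof (rule convex_sandwich[OF subspace_dom L(1), of "\<lambda>h k. total (h + k) - l k"])
    fix h h' k k' and t :: real
    assume in_dom: "h \<in> dom" "h' \<in> dom" "k \<in> L" "k' \<in> L" and t: "0 < t" "t < 1"
    have d: "h + k \<in> dom" "h' + k' \<in> dom" using in_dom L(2) by (auto intro: dom_add)
    have "(1 - t) *\<^sub>R h + t *\<^sub>R h' + ((1 - t) *\<^sub>R k + t *\<^sub>R k') = (1 - t) *\<^sub>R (h + k) + t *\<^sub>R (h' + k')"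
      by (simp add: scaleR_add_right)
    moreover have "total ((1 - t) *\<^sub>R (h + k) + t *\<^sub>R (h' + k')) \<le> (1 - t) * total (h + k) + t * total (h' + k')"
      using total_add[OF dom_scale[OF d(1)] dom_scale[OF d(2)], of "1 - t" t] t by (simp add: total_scale)
    ultimately show "total ((1 - t) *\<^sub>R h + t *\<^sub>R h' + ((1 - t) *\<^sub>R k + t *\<^sub>R k')) - l ((1 - t) *\<^sub>R k + t *\<^sub>R k')
        \<le> (1 - t) * (total (h + k) - l k) + t * (total (h' + k') - l k')"
      using lin[OF in_dom(3,4), of "1 - t" t] by (simp add: right_diff_distrib)
  qed (use le in auto)
  have dom_le: "z h \<le> total h" if "h \<in> dom" for h
    using z(2)[OF that subspace_0[OF L(1)]] l0 by simp
  have ge: "l k \<le> z k" if "k \<in> L" for k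
  proof -
    have "- k \<in> dom" using that L(2) by (auto intro: dom_minus)
    from z(2)[OF this that] have "z (- k) \<le> total (- k + k) - l k" .
    moreover have "total (- k + k) = 0" by (simp add: total_def)
    ultimately show ?thesis by (simp add: linear_neg[OF z(1)])
  qed
  have "z k = l k" if "k \<in> L" for k
  proof -
    have "- k \<in> L" using subspace_neg[OF L(1) that] .
    then have "l (- k) \<le> z (- k)" by (rule ge)
    moreover have "l (- k) = - l k" using lin[OF that that, of "-1" 0] by simp
    ultimately show ?thesis using ge[OF that] by (simp add: linear_neg[OF z(1)])
  qed
  with z(1) dom_le show thesis by (rule that)
qed

text \<open>
  A theorem of Strassen's type.  For fixed \<open>y\<close> the set function \<open>A \<mapsto> \<integral>\<^sub>A g y - z (y 1\<^sub>A)\<close> is nonnegative and additive, and it is controlled by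
  the integrals of \<open>\<bar>g (\<plusminus>y)\<bar>\<close> over \<open>A\<close>, so it has a density \<open>n\<close>.  The functions \<open>g y - n \<le> g y\<close>
  are linear in \<open>y\<close> almost everywhere, since densities are unique, and this gives \<open>v\<close>.  The identity \<open>z h = \<integral>\<langle>v, h\<rangle>\<close> then holds for
  \<open>h = y 1\<^sub>A\<close>; it passes to countably valued \<open>h\<close> in \<open>dom\<close> by dominated convergence, and to all \<open>h\<close> in
  \<open>dom\<close> by approximation.
\<close>
lemma selection_of_linear_minorant:
  assumes z: "linear z" and le: "\<And>h. h \<in> dom \<Longrightarrow> z h \<le> total h"
  obtains v :: "'a \<Rightarrow> 'y \<Rightarrow>\<^sub>L real"
  where "weakstar_measurable M v" "AE \<omega> in M. \<forall>y. blinfun_apply (v \<omega>) y \<le> g y \<omega>"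
    "\<And>h. h \<in> dom \<Longrightarrow> integrable M (\<lambda>\<omega>. blinfun_apply (v \<omega>) (h \<omega>)) \<and> z h = (\<integral>\<omega>. blinfun_apply (v \<omega>) (h \<omega>) \<partial>M)"
proof -
  have abs_le: "\<bar>z h\<bar> \<le> (\<integral>\<omega>. \<bar>g (h \<omega>) \<omega>\<bar> + \<bar>g (- h \<omega>) \<omega>\<bar> \<partial>M)" if h: "h \<in> dom" for h
  proof -
    have i: "integrable M (\<lambda>\<omega>. \<bar>g (h \<omega>) \<omega>\<bar> + \<bar>g (- h \<omega>) \<omega>\<bar>)" using domD[OF h] by simp
    have "total h \<le> (\<integral>\<omega>. \<bar>g (h \<omega>) \<omega>\<bar> + \<bar>g (- h \<omega>) \<omega>\<bar> \<partial>M)"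
      unfolding total_def by (intro integral_mono domD h i) auto
    moreover have "total (- h) \<le> (\<integral>\<omega>. \<bar>g (h \<omega>) \<omega>\<bar> + \<bar>g (- h \<omega>) \<omega>\<bar> \<partial>M)"
      unfolding total_def fun_Compl_def by (intro integral_mono domD h i) auto
    ultimately show ?thesis
      using le[OF h] le[OF dom_minus[OF h]] by (simp add: linear_neg[OF z] abs_le_iff)
  qed
  define E where "E A y = (\<lambda>\<omega>. indicator A \<omega> *\<^sub>R (y::'y))" for A :: "'a set" and y
  have E_dom: "E A y \<in> dom" if "A \<in> sets M" for A y
    unfolding E_def by (rule dom_indicator[OF const_in_dom that])
  have E_abs: "\<bar>z (E A y)\<bar> \<le> (\<integral>\<omega>. indicator A \<omega> * (\<bar>g y \<omega>\<bar> + \<bar>g (- y) \<omega>\<bar>) \<partial>M)" if "A \<in> sets M" for A y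
  proof -
    have eq: "\<bar>g (E A y \<omega>) \<omega>\<bar> + \<bar>g (- E A y \<omega>) \<omega>\<bar> = indicator A \<omega> * (\<bar>g y \<omega>\<bar> + \<bar>g (- y) \<omega>\<bar>)" for \<omega>
      using g_indicator[of A \<omega> "- y"] by (simp add: E_def g_indicator abs_mult distrib_left)
    show ?thesis using abs_le[OF E_dom[OF that, of y]] unfolding eq .
  qed
  have "\<exists>w. integrable M w \<and> (\<forall>\<omega>. w \<omega> \<le> g y \<omega>) \<and> (\<forall>A\<in>sets M. z (E A y) = (\<integral>\<omega>. indicator A \<omega> * w \<omega> \<partial>M))" for y
  proof -
    define \<mu> where "\<mu> A = (\<integral>\<omega>. indicator A \<omega> * g y \<omega> \<partial>M) - z (E A y)" for A
    have ig: "integrable M (\<lambda>\<omega>. indicator A \<omega> * b \<omega>)" if "integrable M b" "A \<in> sets M" for A and b :: "'a \<Rightarrow> real"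
      using integrable_mult_indicator[OF that(2,1)] by simp
    have bd: "\<bar>\<mu> A\<bar> \<le> (\<integral>\<omega>. indicator A \<omega> * (2 * \<bar>g y \<omega>\<bar> + \<bar>g (- y) \<omega>\<bar>) \<partial>M)" if A: "A \<in> sets M" for A
    proof -
      have i: "integrable M (\<lambda>\<omega>. indicator A \<omega> * \<bar>g y \<omega>\<bar>)" "integrable M (\<lambda>\<omega>. indicator A \<omega> * \<bar>g (- y) \<omega>\<bar>)"
        using g_integrable A by (auto intro!: ig)
      have "\<bar>\<integral>\<omega>. indicator A \<omega> * g y \<omega> \<partial>M\<bar> \<le> (\<integral>\<omega>. \<bar>indicator A \<omega> * g y \<omega>\<bar> \<partial>M)" by (rule integral_abs_bound)
      also have "\<dots> = (\<integral>\<omega>. indicator A \<omega> * \<bar>g y \<omega>\<bar> \<partial>M)" by (simp add: abs_mult)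
      finally have "\<bar>\<mu> A\<bar> \<le> (\<integral>\<omega>. indicator A \<omega> * \<bar>g y \<omega>\<bar> \<partial>M) + (\<integral>\<omega>. indicator A \<omega> * (\<bar>g y \<omega>\<bar> + \<bar>g (- y) \<omega>\<bar>) \<partial>M)"
        using E_abs[OF A, of y] unfolding \<mu>_def by linarith
      also have "\<dots> = (\<integral>\<omega>. indicator A \<omega> * \<bar>g y \<omega>\<bar> + indicator A \<omega> * (\<bar>g y \<omega>\<bar> + \<bar>g (- y) \<omega>\<bar>) \<partial>M)"
        using i by (simp add: distrib_left)
      also have "(\<lambda>\<omega>. indicator A \<omega> * \<bar>g y \<omega>\<bar> + indicator A \<omega> * (\<bar>g y \<omega>\<bar> + \<bar>g (- y) \<omega>\<bar>)) =
          (\<lambda>\<omega>. indicator A \<omega> * (2 * \<bar>g y \<omega>\<bar> + \<bar>g (- y) \<omega>\<bar>))" by (simp add: algebra_simps)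
      finally show ?thesis .
    qed
    have bint: "integrable M (\<lambda>\<omega>. 2 * \<bar>g y \<omega>\<bar> + \<bar>g (- y) \<omega>\<bar>)" using g_integrable by simp
    obtain n where n: "n \<in> borel_measurable M" "\<And>\<omega>. 0 \<le> n \<omega>" "integrable M n"
      "\<And>A. A \<in> sets M \<Longrightarrow> \<mu> A = (\<integral>\<omega>. indicator A \<omega> * n \<omega> \<partial>M)"
    proof (rule density_of_set_function[of M \<mu>])
      show "0 \<le> \<mu> A" if "A \<in> sets M" for A
        using le[OF E_dom[OF that], of y] by (simp add: \<mu>_def total_def E_def g_indicator)
      show "\<mu> (A \<union> B) = \<mu> A + \<mu> B" if "A \<in> sets M" "B \<in> sets M" "A \<inter> B = {}" for A B
      proof -
        have ind: "indicator (A \<union> B) \<omega> = (indicator A \<omega> + indicator B \<omega> :: real)" for \<omega>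
          using that(3) by (auto simp: indicator_def)
        have "E (A \<union> B) y = E A y + E B y"
          by (auto simp: E_def fun_eq_iff ind scaleR_add_left)
        then show ?thesis using ig[OF g_integrable that(1)] ig[OF g_integrable that(2)]
          by (simp add: \<mu>_def linear_add[OF z] ind distrib_right)
      qed
      show "(\<lambda>i. \<mu> (A i)) \<longlonglongrightarrow> 0" if A: "range A \<subseteq> sets M" "decseq A" "(\<Inter>i. A i) = {}" for A
      proof -
        have "(\<lambda>i. \<integral>\<omega>. indicator (A i) \<omega> * (2 * \<bar>g y \<omega>\<bar> + \<bar>g (- y) \<omega>\<bar>) \<partial>M) \<longlonglongrightarrow> (\<integral>\<omega>. 0 \<partial>M)"
        proof (rule integral_dominated_convergence)
          show "integrable M (\<lambda>\<omega>. 2 * \<bar>g y \<omega>\<bar> + \<bar>g (- y) \<omega>\<bar>)" by (rule bint)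
          show "(\<lambda>\<omega>. indicator (A i) \<omega> * (2 * \<bar>g y \<omega>\<bar> + \<bar>g (- y) \<omega>\<bar>)) \<in> borel_measurable M" for i
            using borel_measurable_integrable[OF ig[OF bint]] A(1) by blast
          show "AE \<omega> in M. (\<lambda>i. indicator (A i) \<omega> * (2 * \<bar>g y \<omega>\<bar> + \<bar>g (- y) \<omega>\<bar>)) \<longlonglongrightarrow> 0"
          proof (rule AE_I2)
            fix \<omega>
            have "(\<lambda>i. indicator (A i) \<omega>) \<longlonglongrightarrow> (indicator (\<Inter>i. A i) \<omega> :: real)"
              by (rule LIMSEQ_indicator_decseq) (use A in auto)
            then have "(\<lambda>i. indicator (A i) \<omega>) \<longlonglongrightarrow> (0 :: real)" using A(3) by simp
            from tendsto_mult_left_zero[OF this]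
            show "(\<lambda>i. indicator (A i) \<omega> * (2 * \<bar>g y \<omega>\<bar> + \<bar>g (- y) \<omega>\<bar>)) \<longlonglongrightarrow> 0" .
          qed
        qed (auto simp: indicator_def)
        then have "(\<lambda>i. \<integral>\<omega>. indicator (A i) \<omega> * (2 * \<bar>g y \<omega>\<bar> + \<bar>g (- y) \<omega>\<bar>) \<partial>M) \<longlonglongrightarrow> 0" by simp
        then show ?thesis
          by (rule Lim_null_comparison[OF always_eventually, rotated]) (use bd A(1) in auto)
      qed
      show "\<mu> A = 0" if "A \<in> null_sets M" for A
      proof -
        have "AE \<omega> in M. indicator A \<omega> * (2 * \<bar>g y \<omega>\<bar> + \<bar>g (- y) \<omega>\<bar>) = 0"
          using AE_not_in[OF that] by eventually_elim simp
        then have "(\<integral>\<omega>. indicator A \<omega> * (2 * \<bar>g y \<omega>\<bar> + \<bar>g (- y) \<omega>\<bar>) \<partial>M) = 0"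
          by (rule integral_eq_zero_AE)
        then show ?thesis using bd[of A] that by auto
      qed
    qed (use finite_measure_axioms in auto)
    show ?thesis
    proof (intro exI[of _ "\<lambda>\<omega>. g y \<omega> - n \<omega>"] conjI ballI allI)
      show "integrable M (\<lambda>\<omega>. g y \<omega> - n \<omega>)" using g_integrable n(3) by simp
      show "g y \<omega> - n \<omega> \<le> g y \<omega>" for \<omega> using n(2) by simp
      show "z (E A y) = (\<integral>\<omega>. indicator A \<omega> * (g y \<omega> - n \<omega>) \<partial>M)" if "A \<in> sets M" for A
        using ig[OF g_integrable that] ig[OF n(3) that] n(4)[OF that]
        by (simp add: right_diff_distrib \<mu>_def)
    qed
  qed
  then obtain w where w: "\<And>y. integrable M (w y)" "\<And>y \<omega>. w y \<omega> \<le> g y \<omega>"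
    "\<And>A y. A \<in> sets M \<Longrightarrow> z (E A y) = (\<integral>\<omega>. indicator A \<omega> * w y \<omega> \<partial>M)" by metis
  have ind_int: "integrable M (\<lambda>\<omega>. indicator A \<omega> * w y \<omega>)" if "A \<in> sets M" for A y
    using integrable_mult_indicator[OF that w(1)] by simp
  obtain K where K: "\<And>\<omega> y. g y \<omega> \<le> K \<omega> * norm y" using g_bounded by metis
  obtain v :: "'a \<Rightarrow> 'y \<Rightarrow>\<^sub>L real" where v: "weakstar_measurable M v" "\<And>y. AE \<omega> in M. blinfun_apply (v \<omega>) y = w y \<omega>"
  proof (rule linear_version[of w M K])
    show "w y \<in> borel_measurable M" for y using w(1) by simp
    show "AE \<omega> in M. w (y + y') \<omega> = w y \<omega> + w y' \<omega>" for y y'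
    proof (rule AE_eq_if_set_integrals_eq)
      fix A assume A: "A \<in> sets M"
      have "E A (y + y') = E A y + E A y'" by (auto simp: E_def fun_eq_iff scaleR_add_right)
      then have "z (E A (y + y')) = z (E A y) + z (E A y')" by (simp add: linear_add[OF z])
      then show "(\<integral>\<omega>. indicator A \<omega> * w (y + y') \<omega> \<partial>M) = (\<integral>\<omega>. indicator A \<omega> * (w y \<omega> + w y' \<omega>) \<partial>M)"
        using ind_int[OF A] by (simp add: w(3)[OF A] distrib_left)
    qed (use w(1) in auto)
    show "AE \<omega> in M. w (c *\<^sub>R y) \<omega> = c * w y \<omega>" for c y
    proof (rule AE_eq_if_set_integrals_eq)
      fix A assume A: "A \<in> sets M"
      have "E A (c *\<^sub>R y) = c *\<^sub>R E A y" by (auto simp: E_def fun_eq_iff)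
      then have "z (E A (c *\<^sub>R y)) = c * z (E A y)" by (simp add: linear_scale[OF z])
      then show "(\<integral>\<omega>. indicator A \<omega> * w (c *\<^sub>R y) \<omega> \<partial>M) = (\<integral>\<omega>. indicator A \<omega> * (c * w y \<omega>) \<partial>M)"
        by (simp add: w(3)[OF A] mult.left_commute)
    qed (use w(1) in auto)
    show "AE \<omega> in M. w y \<omega> \<le> K \<omega> * norm y" for y
      using w(2) K by (intro AE_I2) (rule order_trans)
  qed blast
  have zE: "z (E A y) = (\<integral>\<omega>. indicator A \<omega> * blinfun_apply (v \<omega>) y \<partial>M)" if A: "A \<in> sets M" for A y
  proof -
    have "AE \<omega> in M. indicator A \<omega> * w y \<omega> = indicator A \<omega> * blinfun_apply (v \<omega>) y"
      using v(2)[of y] by eventually_elim simp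
    then show ?thesis unfolding w(3)[OF A]
      using ind_int[OF A] weakstar_measurable_apply[OF v(1), of "\<lambda>_. y"] A
      by (intro integral_cong_AE) auto
  qed
  have v_le: "AE \<omega> in M. \<forall>y. blinfun_apply (v \<omega>) y \<le> g y \<omega>"
  proof (rule AE_blinfun_le_sublinear[OF g_continuous])
    show "AE \<omega> in M. blinfun_apply (v \<omega>) y \<le> g y \<omega>" for y
      using v(2)[of y] by eventually_elim (use w(2) in auto)
  qed
  have v_int: "integrable M (\<lambda>\<omega>. blinfun_apply (v \<omega>) (h \<omega>))" if h: "h \<in> dom" for h
  proof (rule integrable_between)
    show "integrable M (\<lambda>\<omega>. - g (- h \<omega>) \<omega>)" "integrable M (\<lambda>\<omega>. g (h \<omega>) \<omega>)" using domD[OF h] by auto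
    show "(\<lambda>\<omega>. blinfun_apply (v \<omega>) (h \<omega>)) \<in> borel_measurable M"
      by (rule weakstar_measurable_apply[OF v(1) domD(1)[OF h]])
    show "AE \<omega> in M. blinfun_apply (v \<omega>) (h \<omega>) \<le> g (h \<omega>) \<omega>" using v_le by eventually_elim auto
    show "AE \<omega> in M. - g (- h \<omega>) \<omega> \<le> blinfun_apply (v \<omega>) (h \<omega>)" using v_le
    proof eventually_elim
      case (elim \<omega>)
      have "blinfun_apply (v \<omega>) (- h \<omega>) \<le> g (- h \<omega>) \<omega>" using elim by blast
      then show ?case by (simp add: blinfun.minus_right)
    qed
  qed
  have countable_valued: "z (\<lambda>\<omega>. d (k \<omega>)) = (\<integral>\<omega>. blinfun_apply (v \<omega>) (d (k \<omega>)) \<partial>M)"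
    if h: "(\<lambda>\<omega>. d (k \<omega>)) \<in> dom" and k [measurable]: "k \<in> measurable M (count_space (UNIV::nat set))"
    for d and k :: "'a \<Rightarrow> nat"
  proof -
    define b where "b \<omega> = \<bar>g (d (k \<omega>)) \<omega>\<bar> + \<bar>g (- d (k \<omega>)) \<omega>\<bar>" for \<omega>
    have b: "integrable M b" unfolding b_def using domD(2,3)[OF h] by simp
    define I where "I m = {\<omega> \<in> space M. k \<omega> < m}" for m
    have I: "I m \<in> sets M" for m unfolding I_def by measurable
    define J where "J i = {\<omega> \<in> space M. k \<omega> = i}" for i
    have J: "J i \<in> sets M" for i unfolding J_def by measurable
    define h where "h = (\<lambda>\<omega>. d (k \<omega>))"
    have hd: "h \<in> dom" using h by (simp add: h_def)
    define R where "R m = h - (\<Sum>i<m. E (J i) (d i))" for m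
    have sum_E: "(\<Sum>i<m. E (J i) (d i)) \<omega> = (if k \<omega> < m then h \<omega> else 0)" if "\<omega> \<in> space M" for m \<omega>
    proof -
      have "(\<Sum>i<m. E (J i) (d i)) \<omega> = (\<Sum>i<m. if i = k \<omega> then h \<omega> else 0)"
        using that by (induction m) (auto simp: E_def J_def h_def)
      then show ?thesis by simp
    qed
    have sum_dom: "(\<Sum>i<m. E (J i) (d i)) \<in> dom" for m
      by (intro subspace_sum[OF subspace_dom] E_dom J)
    have R_dom: "R m \<in> dom" for m
      unfolding R_def using hd sum_dom by (rule subspace_diff[OF subspace_dom])
    have "\<bar>z (R m)\<bar> \<le> (\<integral>\<omega>. b \<omega> - indicator {\<omega>. k \<omega> < m} \<omega> * b \<omega> \<partial>M)" for m
    proof -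
      have "\<bar>z (R m)\<bar> \<le> (\<integral>\<omega>. \<bar>g (R m \<omega>) \<omega>\<bar> + \<bar>g (- R m \<omega>) \<omega>\<bar> \<partial>M)" by (rule abs_le[OF R_dom])
      also have "\<dots> = (\<integral>\<omega>. b \<omega> - indicator {\<omega>. k \<omega> < m} \<omega> * b \<omega> \<partial>M)"
      proof (rule Bochner_Integration.integral_cong[OF refl])
        fix \<omega> assume "\<omega> \<in> space M"
        then have "R m \<omega> = (if k \<omega> < m then 0 else h \<omega>)" by (simp add: R_def sum_E)
        then show "\<bar>g (R m \<omega>) \<omega>\<bar> + \<bar>g (- R m \<omega>) \<omega>\<bar> = b \<omega> - indicator {\<omega>. k \<omega> < m} \<omega> * b \<omega>"
          by (auto simp: b_def h_def)
      qed
      finally show ?thesis .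
    qed
    moreover have "(\<integral>\<omega>. b \<omega> - indicator {\<omega>. k \<omega> < m} \<omega> * b \<omega> \<partial>M) = (\<integral>\<omega>. b \<omega> \<partial>M) - (\<integral>\<omega>. indicator {\<omega>. k \<omega> < m} \<omega> * b \<omega> \<partial>M)" for m
    proof (rule Bochner_Integration.integral_diff[OF b])
      show "integrable M (\<lambda>\<omega>. indicator {\<omega>. k \<omega> < m} \<omega> * b \<omega>)"
        using b by (rule Bochner_Integration.integrable_bound) (use b in \<open>auto simp: indicator_def\<close>)
    qed
    ultimately have R_le: "\<bar>z (R m)\<bar> \<le> (\<integral>\<omega>. b \<omega> \<partial>M) - (\<integral>\<omega>. indicator {\<omega>. k \<omega> < m} \<omega> * b \<omega> \<partial>M)" for m
      by simp
    have "(\<lambda>m. (\<integral>\<omega>. b \<omega> \<partial>M) - (\<integral>\<omega>. indicator {\<omega>. k \<omega> < m} \<omega> * b \<omega> \<partial>M)) \<longlonglongrightarrow> (\<integral>\<omega>. b \<omega> \<partial>M) - (\<integral>\<omega>. b \<omega> \<partial>M)"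
      by (intro tendsto_intros integral_indicator_vanishing b k)
    then have "(\<lambda>m. (\<integral>\<omega>. b \<omega> \<partial>M) - (\<integral>\<omega>. indicator {\<omega>. k \<omega> < m} \<omega> * b \<omega> \<partial>M)) \<longlonglongrightarrow> 0" by simp
    then have R0: "(\<lambda>m. z (R m)) \<longlonglongrightarrow> 0"
      by (rule Lim_null_comparison[OF always_eventually, rotated]) (use R_le in simp)
    have "z h - z (R m) = (\<integral>\<omega>. indicator {\<omega>. k \<omega> < m} \<omega> * blinfun_apply (v \<omega>) (h \<omega>) \<partial>M)" for m
    proof -
      have "z h - z (R m) = z (\<Sum>i<m. E (J i) (d i))" by (simp add: R_def linear_diff[OF z])
      also have "\<dots> = (\<Sum>i<m. \<integral>\<omega>. indicator (J i) \<omega> * blinfun_apply (v \<omega>) (d i) \<partial>M)"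
        by (simp add: linear_sum[OF z] zE[OF J])
      also have "\<dots> = (\<integral>\<omega>. indicator {\<omega>. k \<omega> < m} \<omega> * blinfun_apply (v \<omega>) (h \<omega>) \<partial>M)"
        unfolding h_def J_def by (rule integral_split_countable[OF k v_int[OF const_in_dom], symmetric])
      finally show ?thesis .
    qed
    then have "(\<lambda>m. z h - z (R m)) \<longlonglongrightarrow> (\<integral>\<omega>. blinfun_apply (v \<omega>) (h \<omega>) \<partial>M)"
      using integral_indicator_vanishing[OF v_int[OF hd] k] by simp
    moreover have "(\<lambda>m. z h - z (R m)) \<longlonglongrightarrow> z h - 0" by (intro tendsto_intros R0)
    ultimately show ?thesis using LIMSEQ_unique by (fastforce simp: h_def)
  qed
  have "z h = (\<integral>\<omega>. blinfun_apply (v \<omega>) (h \<omega>) \<partial>M)" if h: "h \<in> dom" for h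
  proof -
    have [measurable]: "h \<in> borel_measurable M" by (rule domD(1)[OF h])
    have "\<bar>z h - (\<integral>\<omega>. blinfun_apply (v \<omega>) (h \<omega>) \<partial>M)\<bar> \<le> 2 * measure M (space M) * e" if e: "0 < e" for e
    proof -
\<comment> \<open>Closeness is measured by g itself, not by the norm: the bound of g by a multiple of the
  norm need not be integrable, so uniformly small differences could have large integrals.\<close>
      obtain d k where k: "k \<in> measurable M (count_space (UNIV::nat set))"
        "\<And>\<omega>. \<bar>g (h \<omega> - d (k \<omega>)) \<omega>\<bar> < e \<and> \<bar>g (d (k \<omega>) - h \<omega>) \<omega>\<bar> < e"
      proof (rule measurable_countable_approximation[of "\<lambda>\<omega> y. \<bar>g (h \<omega> - y) \<omega>\<bar> < e \<and> \<bar>g (y - h \<omega>) \<omega>\<bar> < e" M])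
        fix \<omega>
        have "continuous_on UNIV (\<lambda>y. \<bar>g (h \<omega> - y) \<omega>\<bar>)" "continuous_on UNIV (\<lambda>y. \<bar>g (y - h \<omega>) \<omega>\<bar>)"
          by (intro continuous_intros continuous_on_compose2[OF g_continuous]; simp)+
        then have "open ({y. \<bar>g (h \<omega> - y) \<omega>\<bar> < e} \<inter> {y. \<bar>g (y - h \<omega>) \<omega>\<bar> < e})"
          by (intro open_Int open_Collect_less) auto
        moreover have "h \<omega> \<in> {y. \<bar>g (h \<omega> - y) \<omega>\<bar> < e} \<inter> {y. \<bar>g (y - h \<omega>) \<omega>\<bar> < e}" using e by simp
        ultimately show "\<exists>U. open U \<and> U \<noteq> {} \<and> (\<forall>y\<in>U. \<bar>g (h \<omega> - y) \<omega>\<bar> < e \<and> \<bar>g (y - h \<omega>) \<omega>\<bar> < e)"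
          by blast
      next
        show "Measurable.pred M (\<lambda>\<omega>. \<bar>g (h \<omega> - y) \<omega>\<bar> < e \<and> \<bar>g (y - h \<omega>) \<omega>\<bar> < e)" for y by measurable
      qed blast
      note k(1) [measurable]
      define h' where "h' = (\<lambda>\<omega>. d (k \<omega>))"
      have [measurable]: "h' \<in> borel_measurable M" unfolding h'_def by (rule measurable_countable_valued[OF k(1)])
      have diff: "h - h' \<in> dom"
      proof -
        have "integrable M (\<lambda>\<omega>. g (h \<omega> - h' \<omega>) \<omega>)"
          by (rule integrable_const_bound[where B=e]) (use k(2) in \<open>auto simp: h'_def less_imp_le intro!: AE_I2\<close>, measurable)
        moreover have "integrable M (\<lambda>\<omega>. g (h' \<omega> - h \<omega>) \<omega>)"
          by (rule integrable_const_bound[where B=e]) (use k(2) in \<open>auto simp: h'_def less_imp_le intro!: AE_I2\<close>, measurable)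
        moreover have "h - h' \<in> borel_measurable M" unfolding fun_diff_def by measurable
        ultimately show ?thesis by (simp add: dom_def)
      qed
      have h': "h' \<in> dom"
        using subspace_diff[OF subspace_dom h diff] by simp
      have "z h' = (\<integral>\<omega>. blinfun_apply (v \<omega>) (h' \<omega>) \<partial>M)"
        using countable_valued[OF _ k(1), of d] h' by (simp add: h'_def)
      moreover have "z (h - h') = z h - z h'" by (rule linear_diff[OF z])
      moreover have "(\<integral>\<omega>. blinfun_apply (v \<omega>) ((h - h') \<omega>) \<partial>M) =
          (\<integral>\<omega>. blinfun_apply (v \<omega>) (h \<omega>) \<partial>M) - (\<integral>\<omega>. blinfun_apply (v \<omega>) (h' \<omega>) \<partial>M)"
        using v_int[OF h] v_int[OF h'] by (simp add: blinfun.diff_right)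
      moreover have "\<bar>z (h - h')\<bar> \<le> measure M (space M) * e"
      proof -
        have tot: "total b \<le> measure M (space M) * e" if "b \<in> dom" "\<And>\<omega>. g (b \<omega>) \<omega> \<le> e" for b
        proof -
          have "total b \<le> (\<integral>\<omega>. e \<partial>M)" unfolding total_def
            using that by (intro integral_mono domD) auto
          then show ?thesis by simp
        qed
        have lt: "g (h \<omega> - h' \<omega>) \<omega> \<le> e" "g (h' \<omega> - h \<omega>) \<omega> \<le> e" for \<omega>
          using k(2)[of \<omega>] unfolding h'_def by linarith+
        have "total (h - h') \<le> measure M (space M) * e" by (rule tot[OF diff]) (simp add: lt)
        moreover have "total (- (h - h')) \<le> measure M (space M) * e"
          by (rule tot[OF dom_minus[OF diff]]) (simp add: lt)
        ultimately show ?thesis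
          using le[OF diff] le[OF dom_minus[OF diff]] linear_neg[OF z, of "h - h'"] by linarith
      qed
      moreover have "\<bar>\<integral>\<omega>. blinfun_apply (v \<omega>) ((h - h') \<omega>) \<partial>M\<bar> \<le> measure M (space M) * e"
      proof -
        have "AE \<omega> in M. \<bar>blinfun_apply (v \<omega>) ((h - h') \<omega>)\<bar> \<le> e" using v_le
        proof eventually_elim
          case (elim \<omega>)
          have "blinfun_apply (v \<omega>) (h \<omega> - h' \<omega>) \<le> g (h \<omega> - h' \<omega>) \<omega>"
            "blinfun_apply (v \<omega>) (h' \<omega> - h \<omega>) \<le> g (h' \<omega> - h \<omega>) \<omega>" using elim by auto
          moreover have "blinfun_apply (v \<omega>) (h' \<omega> - h \<omega>) = - blinfun_apply (v \<omega>) (h \<omega> - h' \<omega>)"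
            by (simp add: blinfun.diff_right)
          ultimately show ?case using k(2)[of \<omega>] unfolding h'_def fun_diff_def by linarith
        qed
        then have "(\<integral>\<omega>. \<bar>blinfun_apply (v \<omega>) ((h - h') \<omega>)\<bar> \<partial>M) \<le> (\<integral>\<omega>. e \<partial>M)"
          using v_int[OF diff] by (intro integral_mono_AE) auto
        then show ?thesis
          by (intro order_trans[OF integral_abs_bound]) simp
      qed
      ultimately show ?thesis by linarith
    qed
    note small = this
    have "((\<lambda>e. 2 * measure M (space M) * e) \<longlongrightarrow> 2 * measure M (space M) * 0) (at_right 0)"
      by (intro tendsto_intros)
    then have "\<bar>z h - (\<integral>\<omega>. blinfun_apply (v \<omega>) (h \<omega>) \<partial>M)\<bar> \<le> 2 * measure M (space M) * 0"
      by (rule tendsto_lowerbound) (auto simp: eventually_at_right_less intro!: eventually_mono[OF eventually_at_right_less[of 0]] small)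
    then show ?thesis by simp
  qed
  with v(1) v_le v_int show thesis by (intro that) auto
qed

end

section \<open>Conditional expectations of dual-valued functions\<close>

text \<open>
  The norm of \<open>u\<close> need not be integrable.  It is only assumed that the pairings of \<open>u\<close> with bounded
  \<open>G\<close>-measurable functions have integrals bounded in terms of the supremum norm.
\<close>
locale weakly_bounded_dual_function = prob_space M for M :: "'a measure" +
  fixes G :: "'a measure" and u :: "'a \<Rightarrow> 'y::{real_normed_vector, second_countable_topology} \<Rightarrow>\<^sub>L real"
    and C :: real
  assumes subalgebra: "subalgebra M G"
    and u_measurable: "weakstar_measurable M u"
    and u_integrable: "h \<in> borel_measurable G \<Longrightarrow> (\<And>\<omega>. norm (h \<omega>) \<le> r) \<Longrightarrow>
      integrable M (\<lambda>\<omega>. blinfun_apply (u \<omega>) (h \<omega>))"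
    and u_bound: "h \<in> borel_measurable G \<Longrightarrow> (\<And>\<omega>. norm (h \<omega>) \<le> r) \<Longrightarrow>
      (\<integral>\<omega>. blinfun_apply (u \<omega>) (h \<omega>) \<partial>M) \<le> C * r"
begin

sublocale sigma_finite_subalgebra M G
proof -
  interpret finite_measure_subalgebra M G by unfold_locales (rule subalgebra)
  show "sigma_finite_subalgebra M G" by unfold_locales
qed

lemma from_G: "f \<in> measurable G N \<Longrightarrow> f \<in> measurable M N"
  by (rule measurable_from_subalg[OF subalgebra])

definition ce :: "'y \<Rightarrow> 'a \<Rightarrow> real" where
  "ce y = real_cond_exp M G (\<lambda>\<omega>. blinfun_apply (u \<omega>) y)"

lemma ce_measurable [measurable]: "ce y \<in> borel_measurable G"
  by (simp add: ce_def)

lemma u_apply_measurable [measurable]: "(\<lambda>\<omega>. blinfun_apply (u \<omega>) y) \<in> borel_measurable M"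
  using u_measurable by (simp add: weakstar_measurable_def)

lemma u_const_integrable: "integrable M (\<lambda>\<omega>. blinfun_apply (u \<omega>) y)"
  by (rule u_integrable[of "\<lambda>_. y" "norm y"]) auto

lemma ce_integrable: "integrable M (ce y)"
  unfolding ce_def by (rule real_cond_exp_int(1)[OF u_const_integrable])

lemma ce_mult:
  assumes f: "f \<in> borel_measurable G" "\<And>\<omega>. \<bar>f \<omega>\<bar> \<le> 1"
  shows "(\<integral>\<omega>. f \<omega> * ce y \<omega> \<partial>M) = (\<integral>\<omega>. blinfun_apply (u \<omega>) (f \<omega> *\<^sub>R y) \<partial>M)"
proof -
  have "integrable M (\<lambda>\<omega>. blinfun_apply (u \<omega>) (f \<omega> *\<^sub>R y))"
    by (rule u_integrable[of _ "norm y"]) (use f in \<open>auto intro: mult_left_le_one_le\<close>)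
  then have "integrable M (\<lambda>\<omega>. f \<omega> * blinfun_apply (u \<omega>) y)" by (simp add: blinfun.scaleR_right)
  then have "(\<integral>\<omega>. f \<omega> * ce y \<omega> \<partial>M) = (\<integral>\<omega>. f \<omega> * blinfun_apply (u \<omega>) y \<partial>M)"
    unfolding ce_def by (rule real_cond_exp_intg(2)[OF _ f(1)]) measurable
  then show ?thesis by (simp add: blinfun.scaleR_right)
qed

text \<open>
  The left-hand side is the integral of the pairing of \<open>u\<close> with \<open>sgn (ce y) y\<close>, a \<open>G\<close>-measurable function of norm at
  most \<open>norm y\<close>.
\<close>
lemma ce_L1: "(\<integral>\<omega>. \<bar>ce y \<omega>\<bar> \<partial>M) \<le> C * norm y"
proof -
  have "(\<integral>\<omega>. \<bar>ce y \<omega>\<bar> \<partial>M) = (\<integral>\<omega>. sgn (ce y \<omega>) * ce y \<omega> \<partial>M)"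
    by (simp add: abs_sgn mult.commute)
  also have "\<dots> = (\<integral>\<omega>. blinfun_apply (u \<omega>) (sgn (ce y \<omega>) *\<^sub>R y) \<partial>M)"
    by (rule ce_mult) (auto simp: abs_sgn_eq)
  also have "\<dots> \<le> C * norm y"
    by (rule u_bound) (auto simp: abs_sgn_eq)
  finally show ?thesis .
qed

lemma ce_add: "AE \<omega> in M. ce (y + y') \<omega> = ce y \<omega> + ce y' \<omega>"
  using real_cond_exp_add[OF u_const_integrable u_const_integrable] by (simp add: ce_def blinfun.add_right)

lemma ce_scale: "AE \<omega> in M. ce (c *\<^sub>R y) \<omega> = c * ce y \<omega>"
  using real_cond_exp_cmult[OF u_const_integrable] by (simp add: ce_def blinfun.scaleR_right)

text \<open>
  Take \<open>\<kappa>\<close> to be the supremum of \<open>ce z\<close> over a countable dense set of unit vectors \<open>z\<close>, and \<open>0\<close>.  The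
  maximum of finitely many of these is \<open>ce z\<^sub>k\<close> for a \<open>G\<close>-measurable index \<open>k\<close>, so its integral is that of
  the pairing of \<open>u\<close> with the bounded \<open>G\<close>-measurable function \<open>z\<^sub>k\<close> and is at most \<open>C\<close>; by monotone
  convergence \<open>\<kappa>\<close> is integrable.  For the remaining vectors the estimate follows since \<open>ce\<close> is continuous
  into \<open>L\<^sub>1\<close> by \<open>ce_L1\<close>.
\<close>
lemma ce_norm_bound:
  obtains \<kappa> where "\<kappa> \<in> borel_measurable G" "integrable M \<kappa>" "\<And>\<omega>. 0 \<le> \<kappa> \<omega>"
    "\<And>y. AE \<omega> in M. ce y \<omega> \<le> \<kappa> \<omega> * norm y"
proof -
  obtain D :: "'y set" where D: "countable D" "\<And>y. \<exists>s. (\<forall>n::nat. s n \<in> D) \<and> s \<longlonglongrightarrow> y"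
    using countable_dense_rational_subspace by metis
\<comment> \<open>Index 0 stands for the zero vector, so that all the maxima are nonnegative.\<close>
  define z where "z i = (case i of 0 \<Rightarrow> 0 | Suc j \<Rightarrow> sgn (from_nat_into D j))" for i :: nat
  define W where "W i = (case i of 0 \<Rightarrow> (\<lambda>_. 0) | Suc j \<Rightarrow> ce (z i))" for i :: nat
  have z_norm: "norm (z i) \<le> 1" for i by (simp add: z_def norm_sgn split: nat.split)
  have W_meas [measurable]: "W i \<in> borel_measurable G" for i by (simp add: W_def split: nat.split)
  have W_int: "integrable M (W i)" for i using ce_integrable by (auto simp: W_def split: nat.split)
  have W_mult: "(\<integral>\<omega>. f \<omega> * W i \<omega> \<partial>M) = (\<integral>\<omega>. f \<omega> * blinfun_apply (u \<omega>) (z i) \<partial>M)"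
    if "f \<in> borel_measurable G" "\<And>\<omega>. \<bar>f \<omega>\<bar> \<le> 1" for f i
    using ce_mult[OF that, of "z i"] by (cases i) (auto simp: W_def z_def blinfun.scaleR_right)
  define S where "S m \<omega> = Max ((\<lambda>i. W i \<omega>) ` {..m})" for m \<omega>
  have S_meas [measurable]: "S m \<in> borel_measurable G" for m unfolding S_def by measurable
  have W_le_S: "W i \<omega> \<le> S m \<omega>" if "i \<le> m" for i m \<omega> unfolding S_def using that by (intro Max_ge) auto
  have S_nonneg: "0 \<le> S m \<omega>" for m \<omega> using W_le_S[of 0 m \<omega>] by (simp add: W_def)
  have S_int: "integrable M (S m)" for m
  proof (rule integrable_between[where a="\<lambda>_. 0" and b="\<lambda>\<omega>. \<Sum>i\<le>m. \<bar>W i \<omega>\<bar>"])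
    show "integrable M (\<lambda>\<omega>. \<Sum>i\<le>m. \<bar>W i \<omega>\<bar>)" using W_int by simp
    show "AE \<omega> in M. S m \<omega> \<le> (\<Sum>i\<le>m. \<bar>W i \<omega>\<bar>)"
      unfolding S_def
    proof (intro AE_I2 Max.boundedI)
      fix \<omega> a assume "a \<in> (\<lambda>i. W i \<omega>) ` {..m}"
      then obtain i where i: "i \<in> {..m}" "a = W i \<omega>" by auto
      have "a \<le> \<bar>W i \<omega>\<bar>" using i by simp
      also have "\<dots> \<le> (\<Sum>i\<le>m. \<bar>W i \<omega>\<bar>)" by (rule member_le_sum[OF i(1)]) auto
      finally show "a \<le> (\<Sum>i\<le>m. \<bar>W i \<omega>\<bar>)" .
    qed auto
    show "S m \<in> borel_measurable M" by (rule from_G[OF S_meas])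
  qed (use S_nonneg in auto)
  have S_bound: "(\<integral>\<omega>. S m \<omega> \<partial>M) \<le> C" for m
  proof -
    define k where "k \<omega> = (LEAST i. i \<le> m \<and> W i \<omega> = S m \<omega>)" for \<omega>
    have kG: "k \<in> measurable G (count_space UNIV)" unfolding k_def by measurable
    then have k: "k \<in> measurable M (count_space UNIV)" by (rule from_G)
    have "k \<omega> \<le> m \<and> W (k \<omega>) \<omega> = S m \<omega>" for \<omega>
    proof -
      have "S m \<omega> \<in> (\<lambda>i. W i \<omega>) ` {..m}" unfolding S_def by (intro Max_in) auto
      then have "\<exists>i. i \<le> m \<and> W i \<omega> = S m \<omega>" by auto
      then show ?thesis unfolding k_def by (rule LeastI_ex)
    qed
    then have k_le: "k \<omega> < Suc m" and kW: "W (k \<omega>) \<omega> = S m \<omega>" for \<omega> by (auto simp: less_Suc_eq_le)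
    have "(\<integral>\<omega>. S m \<omega> \<partial>M) = (\<integral>\<omega>. indicator {\<omega>. k \<omega> < Suc m} \<omega> * W (k \<omega>) \<omega> \<partial>M)"
      by (simp add: k_le kW)
    also have "\<dots> = (\<Sum>i<Suc m. \<integral>\<omega>. indicator {\<omega> \<in> space M. k \<omega> = i} \<omega> * W i \<omega> \<partial>M)"
      by (rule integral_split_countable[OF k W_int])
    also have "\<dots> = (\<Sum>i<Suc m. \<integral>\<omega>. indicator {\<omega> \<in> space M. k \<omega> = i} \<omega> * blinfun_apply (u \<omega>) (z i) \<partial>M)"
    proof (intro sum.cong refl W_mult)
      have "space M = space G" using subalgebra by (simp add: subalgebra_def)
      then show "(\<lambda>\<omega>. indicator {\<omega> \<in> space M. k \<omega> = i} \<omega>) \<in> borel_measurable G" for i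
        using kG by (simp, measurable)
    qed (auto simp: indicator_def)
    also have "\<dots> = (\<integral>\<omega>. indicator {\<omega>. k \<omega> < Suc m} \<omega> * blinfun_apply (u \<omega>) (z (k \<omega>)) \<partial>M)"
      by (rule integral_split_countable[OF k u_const_integrable, symmetric])
    also have "\<dots> = (\<integral>\<omega>. blinfun_apply (u \<omega>) (z (k \<omega>)) \<partial>M)" by (simp add: k_le)
    also have "\<dots> \<le> C * 1"
      by (rule u_bound[OF measurable_countable_valued[OF kG] z_norm])
    finally show ?thesis by simp
  qed
  have C: "0 \<le> C" using S_bound[of 0] integral_nonneg_AE[of "S 0" M] S_nonneg by fastforce
  define \<Sigma> where "\<Sigma> \<omega> = (SUP m. ennreal (S m \<omega>))" for \<omega>
  have \<Sigma>_meas [measurable]: "\<Sigma> \<in> borel_measurable G" unfolding \<Sigma>_def by measurable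
  have "(\<integral>\<^sup>+\<omega>. \<Sigma> \<omega> \<partial>M) = (SUP m. \<integral>\<^sup>+\<omega>. ennreal (S m \<omega>) \<partial>M)"
    unfolding \<Sigma>_def
  proof (rule nn_integral_monotone_convergence_SUP)
    show "incseq (\<lambda>m \<omega>. ennreal (S m \<omega>))"
      unfolding incseq_def le_fun_def S_def
      by (intro allI impI ennreal_leI Max_mono image_mono) auto
  qed (use from_G[OF S_meas] in simp)
  also have "\<dots> \<le> ennreal C"
  proof (rule SUP_least)
    fix m
    have "(\<integral>\<^sup>+\<omega>. ennreal (S m \<omega>) \<partial>M) = ennreal (\<integral>\<omega>. S m \<omega> \<partial>M)"
      by (rule nn_integral_eq_integral[OF S_int]) (simp add: S_nonneg)
    also have "\<dots> \<le> ennreal C" by (rule ennreal_leI[OF S_bound])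
    finally show "(\<integral>\<^sup>+\<omega>. ennreal (S m \<omega>) \<partial>M) \<le> ennreal C" .
  qed
  finally have \<Sigma>_int: "(\<integral>\<^sup>+\<omega>. \<Sigma> \<omega> \<partial>M) \<le> ennreal C" .
  then have "(\<integral>\<^sup>+\<omega>. \<Sigma> \<omega> \<partial>M) \<noteq> \<infinity>" by (auto simp: top_unique)
  then have "AE \<omega> in M. \<Sigma> \<omega> \<noteq> \<infinity>" by (intro nn_integral_PInf_AE) (auto intro: from_G[OF \<Sigma>_meas])
  then have \<Sigma>_fin: "AE \<omega> in M. ennreal (enn2real (\<Sigma> \<omega>)) = \<Sigma> \<omega>"
    by eventually_elim (simp add: less_top)
  define \<kappa> where "\<kappa> \<omega> = enn2real (\<Sigma> \<omega>)" for \<omega>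
  have \<kappa>_meas [measurable]: "\<kappa> \<in> borel_measurable G" unfolding \<kappa>_def by measurable
  have \<kappa>_int: "integrable M \<kappa>"
  proof (rule integrableI_nonneg)
    have "(\<integral>\<^sup>+\<omega>. ennreal (\<kappa> \<omega>) \<partial>M) = (\<integral>\<^sup>+\<omega>. \<Sigma> \<omega> \<partial>M)"
      using \<Sigma>_fin unfolding \<kappa>_def by (rule nn_integral_cong_AE)
    then show "(\<integral>\<^sup>+\<omega>. ennreal (\<kappa> \<omega>) \<partial>M) < \<infinity>"
      using \<Sigma>_int by (simp add: le_less_trans)
  qed (use from_G[OF \<kappa>_meas] in \<open>auto simp: \<kappa>_def\<close>)
  have W_\<kappa>: "AE \<omega> in M. \<forall>i. W i \<omega> \<le> \<kappa> \<omega>"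
    using \<Sigma>_fin
  proof eventually_elim
    case (elim \<omega>)
    show ?case
    proof
      fix i
      have "ennreal (W i \<omega>) \<le> ennreal (S i \<omega>)" by (intro ennreal_leI W_le_S) simp
      also have "\<dots> \<le> \<Sigma> \<omega>" unfolding \<Sigma>_def by (rule SUP_upper) simp
      also have "\<dots> = ennreal (\<kappa> \<omega>)" using elim by (simp add: \<kappa>_def)
      finally show "W i \<omega> \<le> \<kappa> \<omega>"
        by (simp add: \<kappa>_def ennreal_le_iff)
    qed
  qed
  have sphere: "AE \<omega> in M. ce (sgn y) \<omega> \<le> \<kappa> \<omega>" if "y \<noteq> 0" for y
  proof -
    obtain s where s: "\<And>n. s n \<in> D" "s \<longlonglongrightarrow> y" using D(2) by blast
\<comment> \<open>The positive part of the error in the estimate has integral 0: it is dominated by the value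
  of ce at a difference of unit vectors, which is small in L1.\<close>
    define P where "P \<omega> = max 0 (ce (sgn y) \<omega> - \<kappa> \<omega>)" for \<omega>
    have P_int: "integrable M P" unfolding P_def
      by (intro integrable_max Bochner_Integration.integrable_diff ce_integrable \<kappa>_int) simp
    have "(\<integral>\<omega>. P \<omega> \<partial>M) \<le> C * norm (sgn y - sgn (s n))" for n
    proof -
      obtain i where "s n = from_nat_into D i" using from_nat_into_surj[OF D(1) s(1)] by metis
      then have ceW: "ce (sgn (s n)) = W (Suc i)" by (simp add: W_def z_def)
      have "AE \<omega> in M. P \<omega> \<le> \<bar>ce (sgn y - sgn (s n)) \<omega>\<bar>"
        using W_\<kappa> ce_add[of "sgn y - sgn (s n)" "sgn (s n)"]
      proof eventually_elim
        case (elim \<omega>)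
        then have "ce (sgn (s n)) \<omega> \<le> \<kappa> \<omega>" by (simp add: ceW)
        with elim show ?case by (auto simp: P_def)
      qed
      then have "(\<integral>\<omega>. P \<omega> \<partial>M) \<le> (\<integral>\<omega>. \<bar>ce (sgn y - sgn (s n)) \<omega>\<bar> \<partial>M)"
        using ce_integrable P_int by (intro integral_mono_AE) auto
      also have "\<dots> \<le> C * norm (sgn y - sgn (s n))" by (rule ce_L1)
      finally show ?thesis .
    qed
    moreover have "(\<lambda>n. C * norm (sgn y - sgn (s n))) \<longlonglongrightarrow> C * norm (sgn y - sgn y)"
      by (intro tendsto_intros s that)
    ultimately have "(\<integral>\<omega>. P \<omega> \<partial>M) \<le> C * norm (sgn y - sgn y)" by (intro LIMSEQ_le_const) auto
    moreover have "0 \<le> (\<integral>\<omega>. P \<omega> \<partial>M)" by (intro integral_nonneg_AE AE_I2) (simp add: P_def)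
    ultimately have "(\<integral>\<omega>. P \<omega> \<partial>M) = 0" by simp
    then have "AE \<omega> in M. P \<omega> = 0"
      by (subst (asm) integral_nonneg_eq_0_iff_AE[OF P_int]) (simp_all add: P_def)
    then show ?thesis by eventually_elim (simp add: P_def)
  qed
  show thesis
  proof (rule that[OF \<kappa>_meas \<kappa>_int])
    show "0 \<le> \<kappa> \<omega>" for \<omega> by (simp add: \<kappa>_def)
    show "AE \<omega> in M. ce y \<omega> \<le> \<kappa> \<omega> * norm y" for y
    proof (cases "y = 0")
      case True
      have "AE \<omega> in M. ce 0 \<omega> = 0" using ce_scale[of 0 0] by simp
      then have "AE \<omega> in M. ce 0 \<omega> \<le> 0" by eventually_elim simp
      with True show ?thesis by simp
    next
      case False
      have "norm y *\<^sub>R sgn y = y" using False by (simp add: sgn_div_norm)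
      with ce_scale[of "norm y" "sgn y"] have "AE \<omega> in M. ce y \<omega> = norm y * ce (sgn y) \<omega>" by simp
      then show ?thesis using sphere[OF False]
      proof eventually_elim
        case (elim \<omega>)
        then show ?case
          using mult_left_mono[of "ce (sgn y) \<omega>" "\<kappa> \<omega>" "norm y"] by (simp add: mult.commute)
      qed
    qed
  qed
qed

lemma dual_cond_exp_exists: "is_dual_cond_exp M G u (dual_cond_exp M G u)"
proof -
  obtain \<kappa> where \<kappa> [measurable]: "\<kappa> \<in> borel_measurable G" and \<kappa>_bound: "\<And>y. AE \<omega> in M. ce y \<omega> \<le> \<kappa> \<omega> * norm y"
    using ce_norm_bound by metis
  obtain v where v: "weakstar_measurable (restr_to_subalg M G) v"
    "\<And>y. AE \<omega> in restr_to_subalg M G. blinfun_apply (v \<omega>) y = ce y \<omega>"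
  proof (rule linear_version[of ce "restr_to_subalg M G" \<kappa>])
    show "ce y \<in> borel_measurable (restr_to_subalg M G)" for y
      by (rule measurable_in_subalg[OF subalgebra ce_measurable])
    show "AE \<omega> in restr_to_subalg M G. ce (y + y') \<omega> = ce y \<omega> + ce y' \<omega>" for y y'
      by (rule AE_restr_to_subalg2[OF subalgebra ce_add]) measurable
    show "AE \<omega> in restr_to_subalg M G. ce (c *\<^sub>R y) \<omega> = c * ce y \<omega>" for c y
      by (rule AE_restr_to_subalg2[OF subalgebra ce_scale]) measurable
    show "AE \<omega> in restr_to_subalg M G. ce y \<omega> \<le> \<kappa> \<omega> * norm y" for y
      by (rule AE_restr_to_subalg2[OF subalgebra \<kappa>_bound]) measurable
  qed blast
  have "is_dual_cond_exp M G u v"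
    unfolding is_dual_cond_exp_def ce_def[symmetric]
  proof (intro conjI allI)
    show "weakstar_measurable G v"
      using v(1) measurable_in_subalg'[OF subalgebra] by (auto simp: weakstar_measurable_def)
    show "integrable M (\<lambda>\<omega>. blinfun_apply (u \<omega>) y)" for y by (rule u_const_integrable)
    show "AE \<omega> in M. blinfun_apply (v \<omega>) y = ce y \<omega>" for y
      by (rule AE_restr_to_subalg[OF subalgebra v(2)])
  qed
  then show ?thesis unfolding dual_cond_exp_def by (rule someI[of "is_dual_cond_exp M G u"])
qed

context
  fixes e :: "'a \<Rightarrow> 'y \<Rightarrow>\<^sub>L real"
  assumes e: "is_dual_cond_exp M G u e"
begin

lemma dce_measurable: "h \<in> borel_measurable G \<Longrightarrow> (\<lambda>\<omega>. blinfun_apply (e \<omega>) (h \<omega>)) \<in> borel_measurable G"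
  using e by (intro weakstar_measurable_apply) (auto simp: is_dual_cond_exp_def)

lemma dce_eq_ce: "AE \<omega> in M. blinfun_apply (e \<omega>) y = ce y \<omega>"
  using e by (simp add: is_dual_cond_exp_def ce_def)

lemma dce_norm_bound:
  obtains \<kappa> where "integrable M \<kappa>" "\<And>\<omega>. 0 \<le> \<kappa> \<omega>" "AE \<omega> in M. \<forall>y. \<bar>blinfun_apply (e \<omega>) y\<bar> \<le> \<kappa> \<omega> * norm y"
proof -
  obtain \<kappa> where \<kappa>: "integrable M \<kappa>" "\<And>\<omega>. 0 \<le> \<kappa> \<omega>" "\<And>y. AE \<omega> in M. ce y \<omega> \<le> \<kappa> \<omega> * norm y"
    by (rule ce_norm_bound) blast
  have "AE \<omega> in M. \<forall>y. blinfun_apply (e \<omega>) y \<le> \<kappa> \<omega> * norm y"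
  proof (rule AE_blinfun_le_sublinear)
    show "continuous_on UNIV (\<lambda>y. \<kappa> \<omega> * norm (y::'y))" for \<omega> by (intro continuous_intros)
    show "AE \<omega> in M. blinfun_apply (e \<omega>) y \<le> \<kappa> \<omega> * norm y" for y
      using dce_eq_ce[of y] \<kappa>(3)[of y] by eventually_elim simp
  qed
  then have "AE \<omega> in M. \<forall>y. \<bar>blinfun_apply (e \<omega>) y\<bar> \<le> \<kappa> \<omega> * norm y"
  proof eventually_elim
    case (elim \<omega>)
    show ?case
    proof
      fix y
      show "\<bar>blinfun_apply (e \<omega>) y\<bar> \<le> \<kappa> \<omega> * norm y"
        using elim[rule_format, of y] elim[rule_format, of "- y"] by (simp add: abs_le_iff blinfun.minus_right)
    qed
  qed
  with \<kappa>(1,2) show thesis by (rule that)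
qed

lemma dce_integrable_bounded:
  assumes h: "h \<in> borel_measurable G" "\<And>\<omega>. norm (h \<omega>) \<le> r"
  shows "integrable M (\<lambda>\<omega>. blinfun_apply (e \<omega>) (h \<omega>))"
proof -
  obtain \<kappa> where \<kappa>: "integrable M \<kappa>" "\<And>\<omega>. 0 \<le> \<kappa> \<omega>" "AE \<omega> in M. \<forall>y. \<bar>blinfun_apply (e \<omega>) y\<bar> \<le> \<kappa> \<omega> * norm y"
    by (rule dce_norm_bound) blast
  show ?thesis
  proof (rule Bochner_Integration.integrable_bound)
    show "integrable M (\<lambda>\<omega>. \<kappa> \<omega> * r)" using \<kappa>(1) by simp
    show "AE \<omega> in M. norm (blinfun_apply (e \<omega>) (h \<omega>)) \<le> norm (\<kappa> \<omega> * r)" using \<kappa>(3)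
    proof eventually_elim
      case (elim \<omega>)
      have "\<bar>blinfun_apply (e \<omega>) (h \<omega>)\<bar> \<le> \<kappa> \<omega> * norm (h \<omega>)" using elim by blast
      also have "\<dots> \<le> \<kappa> \<omega> * r" by (intro mult_left_mono h \<kappa>)
      finally show ?case by simp
    qed
  qed (use from_G[OF dce_measurable[OF h(1)]] in simp)
qed

lemma dce_integral_countable_valued:
  assumes k: "k \<in> measurable G (count_space (UNIV::nat set))" and d: "\<And>\<omega>. norm (d (k \<omega>)) \<le> r"
  shows "(\<integral>\<omega>. blinfun_apply (e \<omega>) (d (k \<omega>)) \<partial>M) = (\<integral>\<omega>. blinfun_apply (u \<omega>) (d (k \<omega>)) \<partial>M)"
proof -
  have kM: "k \<in> measurable M (count_space UNIV)" by (rule from_G[OF k])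
  have dk: "(\<lambda>\<omega>. d (k \<omega>)) \<in> borel_measurable G" by (rule measurable_countable_valued[OF k])
  have e_const: "integrable M (\<lambda>\<omega>. blinfun_apply (e \<omega>) y)" for y
    by (rule dce_integrable_bounded[of "\<lambda>_. y" "norm y"]) auto
  have part: "(\<integral>\<omega>. indicator {\<omega>. k \<omega> < m} \<omega> * blinfun_apply (e \<omega>) (d (k \<omega>)) \<partial>M) =
      (\<integral>\<omega>. indicator {\<omega>. k \<omega> < m} \<omega> * blinfun_apply (u \<omega>) (d (k \<omega>)) \<partial>M)" for m
  proof -
    have "(\<integral>\<omega>. indicator {\<omega> \<in> space M. k \<omega> = i} \<omega> * blinfun_apply (e \<omega>) (d i) \<partial>M) =
        (\<integral>\<omega>. indicator {\<omega> \<in> space M. k \<omega> = i} \<omega> * blinfun_apply (u \<omega>) (d i) \<partial>M)" for i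
    proof -
      have "space M = space G" using subalgebra by (simp add: subalgebra_def)
      then have J: "(\<lambda>\<omega>. indicator {\<omega> \<in> space M. k \<omega> = i} \<omega> :: real) \<in> borel_measurable G"
        using k by (simp, measurable)
      have "(\<integral>\<omega>. indicator {\<omega> \<in> space M. k \<omega> = i} \<omega> * blinfun_apply (e \<omega>) (d i) \<partial>M) =
          (\<integral>\<omega>. indicator {\<omega> \<in> space M. k \<omega> = i} \<omega> * ce (d i) \<omega> \<partial>M)"
      proof (rule integral_cong_AE)
        show "AE \<omega> in M. indicator {\<omega> \<in> space M. k \<omega> = i} \<omega> * blinfun_apply (e \<omega>) (d i) =
            indicator {\<omega> \<in> space M. k \<omega> = i} \<omega> * ce (d i) \<omega>"
          using dce_eq_ce[of "d i"] by eventually_elim simp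
      qed (use from_G[OF J] e_const[of "d i"] ce_integrable[of "d i"] in auto)
      also have "\<dots> = (\<integral>\<omega>. blinfun_apply (u \<omega>) (indicator {\<omega> \<in> space M. k \<omega> = i} \<omega> *\<^sub>R d i) \<partial>M)"
        by (rule ce_mult[OF J]) (simp add: indicator_def)
      finally show ?thesis by (simp add: blinfun.scaleR_right)
    qed
    then show ?thesis
      using integral_split_countable[OF kM e_const, of m d] integral_split_countable[OF kM u_const_integrable, of m d]
      by simp
  qed
  have "(\<lambda>m. \<integral>\<omega>. indicator {\<omega>. k \<omega> < m} \<omega> * blinfun_apply (e \<omega>) (d (k \<omega>)) \<partial>M)
      \<longlonglongrightarrow> (\<integral>\<omega>. blinfun_apply (e \<omega>) (d (k \<omega>)) \<partial>M)"
    by (rule integral_indicator_vanishing[OF dce_integrable_bounded[OF dk d] kM])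
  moreover have "(\<lambda>m. \<integral>\<omega>. indicator {\<omega>. k \<omega> < m} \<omega> * blinfun_apply (e \<omega>) (d (k \<omega>)) \<partial>M)
      \<longlonglongrightarrow> (\<integral>\<omega>. blinfun_apply (u \<omega>) (d (k \<omega>)) \<partial>M)"
    unfolding part by (rule integral_indicator_vanishing[OF u_integrable[OF dk d] kM])
  ultimately show ?thesis by (rule LIMSEQ_unique)
qed

text \<open>
  Uniform approximation by countably valued functions: an error of norm at most \<open>\<epsilon>\<close> changes the first
  integral by at most \<open>\<epsilon> \<integral>\<kappa>\<close>, where \<open>\<kappa>\<close> bounds the norm of \<open>e\<close>, and the second by at most \<open>C \<epsilon>\<close>.
\<close>
lemma dce_integral_bounded:
  assumes h [measurable]: "h \<in> borel_measurable G" and r: "\<And>\<omega>. norm (h \<omega>) \<le> r"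
  shows "(\<integral>\<omega>. blinfun_apply (e \<omega>) (h \<omega>) \<partial>M) = (\<integral>\<omega>. blinfun_apply (u \<omega>) (h \<omega>) \<partial>M)"
proof -
  obtain \<kappa> where \<kappa>: "integrable M \<kappa>" "\<And>\<omega>. 0 \<le> \<kappa> \<omega>" "AE \<omega> in M. \<forall>y. \<bar>blinfun_apply (e \<omega>) y\<bar> \<le> \<kappa> \<omega> * norm y"
    by (rule dce_norm_bound) blast
  let ?I = "\<lambda>w h. \<integral>\<omega>. blinfun_apply (w \<omega>) (h \<omega>) \<partial>M"
  have small: "\<bar>?I e h - ?I u h\<bar> \<le> ((\<integral>\<omega>. \<kappa> \<omega> \<partial>M) + C) * \<epsilon>" if \<epsilon>: "0 < \<epsilon>" for \<epsilon>
  proof -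
    obtain d k where k: "k \<in> measurable G (count_space (UNIV::nat set))" "\<And>\<omega>. dist (h \<omega>) (d (k \<omega>)) < \<epsilon>"
    proof (rule measurable_countable_approximation[of "\<lambda>\<omega> y. dist (h \<omega>) y < \<epsilon>" G])
      show "\<exists>U. open U \<and> U \<noteq> {} \<and> (\<forall>y\<in>U. dist (h \<omega>) y < \<epsilon>)" for \<omega>
        using \<epsilon> by (intro exI[of _ "ball (h \<omega>) \<epsilon>"]) auto
    qed (measurable, blast)
    define b where "b \<omega> = h \<omega> - d (k \<omega>)" for \<omega>
    have dk [measurable]: "(\<lambda>\<omega>. d (k \<omega>)) \<in> borel_measurable G" by (rule measurable_countable_valued[OF k(1)])
    have bG [measurable]: "b \<in> borel_measurable G" unfolding b_def by measurable
    have b: "norm (b \<omega>) \<le> \<epsilon>" for \<omega> using k(2)[of \<omega>] by (simp add: b_def dist_norm)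
    have dr: "norm (d (k \<omega>)) \<le> r + \<epsilon>" for \<omega>
      using r[of \<omega>] b[of \<omega>] norm_triangle_ineq4[of "h \<omega>" "b \<omega>"] by (simp add: b_def)
    have split: "?I e h = ?I e b + ?I e (\<lambda>\<omega>. d (k \<omega>))" "?I u h = ?I u b + ?I u (\<lambda>\<omega>. d (k \<omega>))"
      using dce_integrable_bounded[OF h r] dce_integrable_bounded[OF dk dr] u_integrable[OF h r] u_integrable[OF dk dr]
      by (simp_all add: b_def blinfun.diff_right)
    have "\<bar>?I u b\<bar> \<le> C * \<epsilon>"
      using u_bound[OF bG b] u_bound[of "\<lambda>\<omega>. - b \<omega>" \<epsilon>] b by (simp add: abs_le_iff blinfun.minus_right)
    moreover have "\<bar>?I e b\<bar> \<le> (\<integral>\<omega>. \<kappa> \<omega> \<partial>M) * \<epsilon>"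
    proof -
      have "\<bar>?I e b\<bar> \<le> (\<integral>\<omega>. \<bar>blinfun_apply (e \<omega>) (b \<omega>)\<bar> \<partial>M)" by (rule integral_abs_bound)
      also have "\<dots> \<le> (\<integral>\<omega>. \<kappa> \<omega> * \<epsilon> \<partial>M)"
      proof (rule integral_mono_AE)
        show "AE \<omega> in M. \<bar>blinfun_apply (e \<omega>) (b \<omega>)\<bar> \<le> \<kappa> \<omega> * \<epsilon>" using \<kappa>(3)
        proof eventually_elim
          case (elim \<omega>)
          then have "\<bar>blinfun_apply (e \<omega>) (b \<omega>)\<bar> \<le> \<kappa> \<omega> * norm (b \<omega>)" by blast
          also have "\<dots> \<le> \<kappa> \<omega> * \<epsilon>" by (intro mult_left_mono b \<kappa>)
          finally show ?case .
        qed
      qed (use dce_integrable_bounded[OF bG b] \<kappa>(1) in auto)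
      finally show ?thesis by simp
    qed
    ultimately show ?thesis
      using dce_integral_countable_valued[of k d, OF k(1) dr] by (simp add: split distrib_right)
  qed
  have "((\<lambda>\<epsilon>. ((\<integral>\<omega>. \<kappa> \<omega> \<partial>M) + C) * \<epsilon>) \<longlongrightarrow> ((\<integral>\<omega>. \<kappa> \<omega> \<partial>M) + C) * 0) (at_right 0)"
    by (intro tendsto_intros)
  then have "\<bar>?I e h - ?I u h\<bar> \<le> ((\<integral>\<omega>. \<kappa> \<omega> \<partial>M) + C) * 0"
    by (rule tendsto_lowerbound) (auto intro!: eventually_mono[OF eventually_at_right_less[of 0]] small)
  then show ?thesis by simp
qed

text \<open>
  The truncations of \<open>h\<close> to the sets where \<open>norm h \<le> m\<close> are bounded.  Multiplied by the sign of the
  pairing of \<open>e\<close> with \<open>h\<close>, they show that the integrals of the absolute values on these sets stay below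
  \<open>\<integral>\<bar>\<langle>u, h\<rangle>\<bar>\<close>, whence integrability; then dominated convergence applies on both sides.
\<close>
lemma dce_integral:
  assumes h [measurable]: "h \<in> borel_measurable G" and int: "integrable M (\<lambda>\<omega>. blinfun_apply (u \<omega>) (h \<omega>))"
  shows "integrable M (\<lambda>\<omega>. blinfun_apply (e \<omega>) (h \<omega>))"
    and "(\<integral>\<omega>. blinfun_apply (e \<omega>) (h \<omega>) \<partial>M) = (\<integral>\<omega>. blinfun_apply (u \<omega>) (h \<omega>) \<partial>M)"
proof -
  define B where "B m \<omega> = (if norm (h \<omega>) \<le> real m then 1 else 0 :: real)" for m :: nat and \<omega>
  have B_meas [measurable]: "B m \<in> borel_measurable G" for m unfolding B_def by measurable
  note eG [measurable] = dce_measurable[OF h]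
  have B_ev: "\<forall>\<^sub>F m in sequentially. B m \<omega> = 1" for \<omega>
  proof -
    obtain m0 where "norm (h \<omega>) \<le> real m0" using real_arch_simple by blast
    then have "B m \<omega> = 1" if "m \<ge> m0" for m using that by (auto simp: B_def)
    then show ?thesis by (auto simp: eventually_sequentially)
  qed
  have trunc: "(\<integral>\<omega>. (c \<omega> * B m \<omega>) * blinfun_apply (e \<omega>) (h \<omega>) \<partial>M) = (\<integral>\<omega>. (c \<omega> * B m \<omega>) * blinfun_apply (u \<omega>) (h \<omega>) \<partial>M)"
    "integrable M (\<lambda>\<omega>. (c \<omega> * B m \<omega>) * blinfun_apply (e \<omega>) (h \<omega>))"
    if [measurable]: "c \<in> borel_measurable G" and c: "\<And>\<omega>. \<bar>c \<omega>\<bar> \<le> 1" for c m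
  proof -
    have m: "(\<lambda>\<omega>. (c \<omega> * B m \<omega>) *\<^sub>R h \<omega>) \<in> borel_measurable G" by measurable
    have b: "norm ((c \<omega> * B m \<omega>) *\<^sub>R h \<omega>) \<le> real m" for \<omega>
      using c[of \<omega>] mult_mono[of "\<bar>c \<omega>\<bar>" 1 "norm (h \<omega>)" "real m"] by (auto simp: B_def)
    show "(\<integral>\<omega>. (c \<omega> * B m \<omega>) * blinfun_apply (e \<omega>) (h \<omega>) \<partial>M) = (\<integral>\<omega>. (c \<omega> * B m \<omega>) * blinfun_apply (u \<omega>) (h \<omega>) \<partial>M)"
      "integrable M (\<lambda>\<omega>. (c \<omega> * B m \<omega>) * blinfun_apply (e \<omega>) (h \<omega>))"
      using dce_integral_bounded[OF m b] dce_integrable_bounded[OF m b] by (simp_all add: blinfun.scaleR_right)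
  qed
  define s where "s \<omega> = sgn (blinfun_apply (e \<omega>) (h \<omega>))" for \<omega>
  have s [measurable]: "s \<in> borel_measurable G" unfolding s_def by measurable
  have s1: "\<bar>s \<omega>\<bar> \<le> 1" for \<omega> by (simp add: s_def abs_sgn_eq)
  have se: "s \<omega> * B m \<omega> * blinfun_apply (e \<omega>) (h \<omega>) = B m \<omega> * \<bar>blinfun_apply (e \<omega>) (h \<omega>)\<bar>" for m \<omega>
    by (simp add: s_def abs_sgn mult_ac)
  have abs_int: "integrable M (\<lambda>\<omega>. B m \<omega> * \<bar>blinfun_apply (e \<omega>) (h \<omega>)\<bar>)" for m
    using trunc(2)[OF s s1, of m] by (simp only: se)
  have abs_le: "(\<integral>\<omega>. B m \<omega> * \<bar>blinfun_apply (e \<omega>) (h \<omega>)\<bar> \<partial>M) \<le> (\<integral>\<omega>. \<bar>blinfun_apply (u \<omega>) (h \<omega>)\<bar> \<partial>M)" for m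
  proof -
    have le: "\<bar>(s \<omega> * B m \<omega>) * b\<bar> \<le> \<bar>b\<bar>" for \<omega> b
      using s1[of \<omega>] by (auto simp: B_def abs_mult mult_left_le_one_le)
    have "integrable M (\<lambda>\<omega>. (s \<omega> * B m \<omega>) * blinfun_apply (u \<omega>) (h \<omega>))"
      using int by (rule Bochner_Integration.integrable_bound) (use le int in \<open>auto intro!: borel_measurable_times from_G[OF s] from_G[OF B_meas]\<close>)
    then have "(\<integral>\<omega>. (s \<omega> * B m \<omega>) * blinfun_apply (u \<omega>) (h \<omega>) \<partial>M) \<le> (\<integral>\<omega>. \<bar>blinfun_apply (u \<omega>) (h \<omega>)\<bar> \<partial>M)"
      using int by (intro integral_mono) (auto intro: order_trans[OF abs_ge_self le])
    then show ?thesis using trunc(1)[OF s s1, of m] by (simp only: se)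
  qed
  have "incseq (\<lambda>m. \<integral>\<omega>. B m \<omega> * \<bar>blinfun_apply (e \<omega>) (h \<omega>)\<bar> \<partial>M)"
    unfolding incseq_def by (intro allI impI integral_mono abs_int) (auto simp: B_def)
  then obtain L where L: "(\<lambda>m. \<integral>\<omega>. B m \<omega> * \<bar>blinfun_apply (e \<omega>) (h \<omega>)\<bar> \<partial>M) \<longlonglongrightarrow> L"
    by (rule incseq_convergent) (use abs_le in blast)
  have "integrable M (\<lambda>\<omega>. \<bar>blinfun_apply (e \<omega>) (h \<omega>)\<bar>)"
  proof (rule integrable_monotone_convergence[OF abs_int _ _ L])
    show "AE \<omega> in M. mono (\<lambda>m. B m \<omega> * \<bar>blinfun_apply (e \<omega>) (h \<omega>)\<bar>)"
      by (intro AE_I2 monoI) (auto simp: B_def)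
    show "AE \<omega> in M. (\<lambda>m. B m \<omega> * \<bar>blinfun_apply (e \<omega>) (h \<omega>)\<bar>) \<longlonglongrightarrow> \<bar>blinfun_apply (e \<omega>) (h \<omega>)\<bar>"
    proof (rule AE_I2)
      fix \<omega>
      show "(\<lambda>m. B m \<omega> * \<bar>blinfun_apply (e \<omega>) (h \<omega>)\<bar>) \<longlonglongrightarrow> \<bar>blinfun_apply (e \<omega>) (h \<omega>)\<bar>"
        by (rule tendsto_eventually) (use B_ev[of \<omega>] in eventually_elim, simp)
    qed
    show "(\<lambda>\<omega>. \<bar>blinfun_apply (e \<omega>) (h \<omega>)\<bar>) \<in> borel_measurable M" by (rule from_G) measurable
  qed
  then show e_int: "integrable M (\<lambda>\<omega>. blinfun_apply (e \<omega>) (h \<omega>))"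
    using from_G[OF eG] by (subst (asm) integrable_abs_iff) auto
  have lim: "(\<lambda>m. \<integral>\<omega>. B m \<omega> * w \<omega> \<partial>M) \<longlonglongrightarrow> (\<integral>\<omega>. w \<omega> \<partial>M)" if w: "integrable M w" for w
  proof (rule integral_dominated_convergence)
    show "integrable M (\<lambda>\<omega>. \<bar>w \<omega>\<bar>)" "w \<in> borel_measurable M" using w by auto
    then show "(\<lambda>\<omega>. B m \<omega> * w \<omega>) \<in> borel_measurable M" for m using from_G[OF B_meas] by simp
    show "AE \<omega> in M. (\<lambda>m. B m \<omega> * w \<omega>) \<longlonglongrightarrow> w \<omega>"
    proof (rule AE_I2)
      fix \<omega>
      show "(\<lambda>m. B m \<omega> * w \<omega>) \<longlonglongrightarrow> w \<omega>"
        by (rule tendsto_eventually) (use B_ev[of \<omega>] in eventually_elim, simp)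
    qed
    show "AE \<omega> in M. norm (B m \<omega> * w \<omega>) \<le> \<bar>w \<omega>\<bar>" for m by (auto simp: B_def)
  qed
  have "(\<lambda>m. \<integral>\<omega>. B m \<omega> * blinfun_apply (e \<omega>) (h \<omega>) \<partial>M) \<longlonglongrightarrow> (\<integral>\<omega>. blinfun_apply (u \<omega>) (h \<omega>) \<partial>M)"
    using lim[OF int] trunc(1)[of "\<lambda>_. 1"] by simp
  with lim[OF e_int] show "(\<integral>\<omega>. blinfun_apply (e \<omega>) (h \<omega>) \<partial>M) = (\<integral>\<omega>. blinfun_apply (u \<omega>) (h \<omega>) \<partial>M)"
    by (rule LIMSEQ_unique)
qed

end

end

section \<open>Lebesgue spaces and conjugate exponents\<close>

lemma Lp_spaceD:
  assumes "x \<in> Lp_space M p"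
  shows "x \<in> borel_measurable M"
    and "p \<noteq> \<infinity> \<Longrightarrow> integrable M (\<lambda>\<omega>. norm (x \<omega>) powr enn2real p)"
  using assms by (auto simp: Lp_space_def)

lemma Lp_spaceI:
  "p \<noteq> \<infinity> \<Longrightarrow> x \<in> borel_measurable M \<Longrightarrow> integrable M (\<lambda>\<omega>. norm (x \<omega>) powr enn2real p) \<Longrightarrow> x \<in> Lp_space M p"
  by (simp add: Lp_space_def)

lemma powr_add_le:
  fixes a b r :: real
  assumes "0 \<le> a" "0 \<le> b" "0 \<le> r"
  shows "(a + b) powr r \<le> 2 powr r * (a powr r + b powr r)"
proof -
  have "(a + b) powr r \<le> (2 * max a b) powr r" using assms by (intro powr_mono2) auto
  also have "\<dots> = 2 powr r * (max a b) powr r" by (simp add: powr_mult)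
  also have "\<dots> \<le> 2 powr r * (a powr r + b powr r)"
    by (intro mult_left_mono) (auto simp: max_def)
  finally show ?thesis .
qed

lemma subspace_Lp_space:
  "subspace (Lp_space M p :: ('a \<Rightarrow> 'b::{real_normed_vector, second_countable_topology}) set)"
proof (cases "p = \<infinity>")
  case True
  have sum: "h + k \<in> Lp_space M p" if hk: "h \<in> Lp_space M p" "k \<in> Lp_space M p" for h k :: "'a \<Rightarrow> 'b"
  proof -
    obtain C D where CD: "AE \<omega> in M. norm (h \<omega>) \<le> C" "AE \<omega> in M. norm (k \<omega>) \<le> D"
      using hk True by (auto simp: Lp_space_def)
    have "AE \<omega> in M. norm ((h + k) \<omega>) \<le> C + D"
      using CD by eventually_elim (auto intro: norm_triangle_mono)
    then show ?thesis using hk True by (auto simp: Lp_space_def plus_fun_def)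
  qed
  have scale: "c *\<^sub>R h \<in> Lp_space M p" if h: "h \<in> Lp_space M p" for c and h :: "'a \<Rightarrow> 'b"
  proof -
    obtain C where C: "AE \<omega> in M. norm (h \<omega>) \<le> C"
      using h True by (auto simp: Lp_space_def)
    have "AE \<omega> in M. norm ((c *\<^sub>R h) \<omega>) \<le> \<bar>c\<bar> * C"
      using C by eventually_elim (auto intro: mult_left_mono)
    then show ?thesis using h True by (auto simp: Lp_space_def scaleR_fun_def)
  qed
  show ?thesis unfolding subspace_def using sum scale True by (auto simp: Lp_space_def zero_fun_def)
next
  case False
  define r where "r = enn2real p"
  have r: "0 \<le> r" by (simp add: r_def)
  have sum: "h + k \<in> Lp_space M p" if hk: "h \<in> Lp_space M p" "k \<in> Lp_space M p" for h k :: "'a \<Rightarrow> 'b"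
  proof (rule Lp_spaceI[OF False])
    have [measurable]: "h \<in> borel_measurable M" "k \<in> borel_measurable M" using hk Lp_spaceD by blast+
    show "h + k \<in> borel_measurable M" unfolding plus_fun_def by measurable
    show "integrable M (\<lambda>\<omega>. norm ((h + k) \<omega>) powr enn2real p)"
      unfolding r_def[symmetric]
    proof (rule Bochner_Integration.integrable_bound)
      show "integrable M (\<lambda>\<omega>. 2 powr r * (norm (h \<omega>) powr r + norm (k \<omega>) powr r))"
        using Lp_spaceD(2)[OF hk(1) False] Lp_spaceD(2)[OF hk(2) False] by (simp add: r_def)
      show "(\<lambda>\<omega>. norm ((h + k) \<omega>) powr r) \<in> borel_measurable M" unfolding plus_fun_def by measurable
      show "AE \<omega> in M. norm (norm ((h + k) \<omega>) powr r) \<le> norm (2 powr r * (norm (h \<omega>) powr r + norm (k \<omega>) powr r))"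
      proof (rule AE_I2)
        fix \<omega>
        have "norm ((h + k) \<omega>) powr r \<le> (norm (h \<omega>) + norm (k \<omega>)) powr r"
          by (rule powr_mono2[OF r]) (auto intro: norm_triangle_ineq)
        also have "\<dots> \<le> 2 powr r * (norm (h \<omega>) powr r + norm (k \<omega>) powr r)"
          by (rule powr_add_le) (use r in auto)
        finally show "norm (norm ((h + k) \<omega>) powr r) \<le> norm (2 powr r * (norm (h \<omega>) powr r + norm (k \<omega>) powr r))"
          by simp
      qed
    qed
  qed
  have scale: "c *\<^sub>R h \<in> Lp_space M p" if "h \<in> Lp_space M p" for c and h :: "'a \<Rightarrow> 'b"
    using Lp_spaceD[OF that] False by (intro Lp_spaceI) (auto simp: powr_mult scaleR_fun_def)
  show ?thesis unfolding subspace_def using sum scale False by (auto simp: Lp_space_def zero_fun_def)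
qed

lemma Lp_space_dominated:
  fixes y :: "'a \<Rightarrow> real"
  assumes y: "y \<in> Lp_space M p" and p: "p \<noteq> \<infinity>" and x: "x \<in> borel_measurable M"
    and le: "AE \<omega> in M. norm (x \<omega>) \<le> norm (y \<omega>)"
  shows "x \<in> Lp_space M p"
proof (rule Lp_spaceI[OF p x])
  show "integrable M (\<lambda>\<omega>. norm (x \<omega>) powr enn2real p)"
  proof (rule Bochner_Integration.integrable_bound[OF Lp_spaceD(2)[OF y p]])
    show "AE \<omega> in M. norm (norm (x \<omega>) powr enn2real p) \<le> norm (norm (y \<omega>) powr enn2real p)"
      using le by eventually_elim (auto intro: powr_mono2)
    show "(\<lambda>\<omega>. norm (x \<omega>) powr enn2real p) \<in> borel_measurable M" using x by measurable
  qed
qed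

lemma (in finite_measure) Lp_space_bounded:
  assumes x: "x \<in> borel_measurable M" and r: "\<And>\<omega>. norm (x \<omega>) \<le> r"
  shows "x \<in> Lp_space M p"
proof (cases "p = \<infinity>")
  case True
  then show ?thesis using assms by (auto simp: Lp_space_def)
next
  case False
  show ?thesis
  proof (rule Lp_spaceI[OF False x])
    show "integrable M (\<lambda>\<omega>. norm (x \<omega>) powr enn2real p)"
      by (rule integrable_const_bound[where B="r powr enn2real p"])
        (use x r in \<open>auto intro!: AE_I2 powr_mono2\<close>)
  qed
qed

lemma (in prob_space) esssup_norm_nonneg: "x \<in> borel_measurable M \<Longrightarrow> 0 \<le> esssup M (\<lambda>\<omega>. ereal (norm (x \<omega>)))"
proof -
  assume x: "x \<in> borel_measurable M"
  have "0 = esssup M (\<lambda>_. 0::ereal)" by (rule esssup_const[symmetric]) (simp add: emeasure_space_1)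
  also have "\<dots> \<le> esssup M (\<lambda>\<omega>. ereal (norm (x \<omega>)))" by (rule esssup_mono) auto
  finally show ?thesis .
qed

lemma (in prob_space) Lp_norm_ge_0: "x \<in> borel_measurable M \<Longrightarrow> 0 \<le> Lp_norm M p x"
  by (cases "p = \<infinity>") (auto simp: Lp_norm_def real_of_ereal_pos esssup_norm_nonneg)

lemma (in prob_space) Lp_norm_scale:
  assumes "0 \<le> c" "1 \<le> p"
  shows "Lp_norm M p (\<lambda>\<omega>. c *\<^sub>R x \<omega>) = c * Lp_norm M p x"
proof (cases "p = \<infinity>")
  case True
  show ?thesis
  proof (cases "c = 0")
    case True
    have "esssup M (\<lambda>_. 0::ereal) = 0" by (rule esssup_const) (simp add: emeasure_space_1)
    then show ?thesis using True \<open>p = \<infinity>\<close> by (simp add: Lp_norm_def zero_ereal_def)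
  next
    case False
    then have "esssup M (\<lambda>\<omega>. ereal c * ereal (norm (x \<omega>))) = ereal c * esssup M (\<lambda>\<omega>. ereal (norm (x \<omega>)))"
      using assms by (intro esssup_cmult) auto
    then show ?thesis using True assms by (simp add: Lp_norm_def)
  qed
next
  case False
  have r: "1 \<le> enn2real p" using assms(2) False by (cases p) auto
  have "(\<integral>\<omega>. norm (c *\<^sub>R x \<omega>) powr enn2real p \<partial>M) = c powr enn2real p * (\<integral>\<omega>. norm (x \<omega>) powr enn2real p \<partial>M)"
    using assms(1) by (simp add: powr_mult)
  then show ?thesis using False assms(1) r by (simp add: Lp_norm_def powr_mult powr_powr)
qed

lemma (in prob_space) Lp_norm_le_bound:
  assumes p: "1 \<le> p" and x: "x \<in> borel_measurable M" and r: "\<And>\<omega>. norm (x \<omega>) \<le> r"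
  shows "Lp_norm M p x \<le> r"
proof -
  have r0: "0 \<le> r" using r[of undefined] norm_ge_zero order_trans by blast
  show ?thesis
  proof (cases "p = \<infinity>")
    case True
    have "esssup M (\<lambda>\<omega>. ereal (norm (x \<omega>))) \<le> ereal r"
      using x r by (intro esssup_I) auto
    then show ?thesis using True r0 esssup_norm_nonneg[OF x]
      by (cases "esssup M (\<lambda>\<omega>. ereal (norm (x \<omega>)))") (auto simp: Lp_norm_def)
  next
    case False
    define s where "s = enn2real p"
    have s: "1 \<le> s" using p False by (cases p) (auto simp: s_def)
    have "(\<integral>\<omega>. norm (x \<omega>) powr s \<partial>M) \<le> (\<integral>\<omega>. r powr s \<partial>M)"
      using Lp_spaceD(2)[OF Lp_space_bounded[OF x r] False] r s
      by (intro integral_mono) (auto simp: s_def intro: powr_mono2)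
    also have "\<dots> = r powr s" by (simp add: prob_space)
    finally have "(\<integral>\<omega>. norm (x \<omega>) powr s \<partial>M) powr (1 / s) \<le> (r powr s) powr (1 / s)"
      using s by (intro powr_mono2) (auto intro: integral_nonneg_AE)
    also have "\<dots> = r" using r0 s by (simp add: powr_powr)
    finally show ?thesis using False by (simp add: Lp_norm_def s_def)
  qed
qed

lemma conjugate_exponent_cases:
  fixes p q :: ennreal
  assumes "1 \<le> p" "p < \<infinity>" "1 / p + 1 / q = 1"
  obtains (one) "enn2real p = 1" "q = \<infinity>"
  | (real) "1 < enn2real p" "1 < enn2real q" "q \<noteq> \<infinity>" "1 / enn2real p + 1 / enn2real q = 1"
proof -
  define r where "r = enn2real p"
  have p: "p = ennreal r" and r: "1 \<le> r" using assms(1,2) by (cases p; auto simp: r_def)+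
  have ip: "1 / p = ennreal (1 / r)" unfolding p using divide_ennreal[of 1 r] r by simp
  show thesis
  proof (cases q)
    case (real s)
    have "s \<noteq> 0"
    proof
      assume "s = 0"
      then have "1 / q = \<infinity>" using real by (simp add: divide_ennreal_def)
      then show False using assms(3) by simp
    qed
    then have s: "0 < s" using real by simp
    have "1 / q = ennreal (1 / s)" using divide_ennreal[of 1 s] s real by simp
    then have "ennreal (1 / r + 1 / s) = 1" using assms(3) r s by (simp add: ip flip: ennreal_plus)
    then have e: "1 / r + 1 / s = 1" by (simp only: ennreal_eq_1)
    have "0 < 1 / r" "0 < 1 / s" using r s by auto
    then have "1 / r < 1" "1 / s < 1" using e by linarith+
    then have "1 < r" "1 < s" using r s by (simp_all add: divide_less_eq)
    then show thesis using e real s by (intro that(2)) (auto simp: r_def)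
  next
    case top
    then have "ennreal (1 / r) = 1" using assms(3) ip by simp
    then have "r = 1" using r by (simp add: ennreal_eq_1)
    then show thesis using top by (intro that(1)) (auto simp: r_def)
  qed
qed

text \<open>
  One form for both cases of the exponents: Young's inequality for \<open>p > 1\<close>, the essential
  bound of \<open>\<zeta>\<close> for \<open>p = 1\<close>.
\<close>
lemma conjugate_product_bound:
  fixes \<zeta> :: "'a \<Rightarrow> real"
  assumes pq: "1 \<le> p" "p < \<infinity>" "1 / p + 1 / q = 1" and \<zeta>: "\<zeta> \<in> Lp_space M q"
  obtains k c where "integrable M k" "0 \<le> c" "AE \<omega> in M. \<forall>v. \<bar>\<zeta> \<omega> * v\<bar> \<le> k \<omega> + c * \<bar>v\<bar> powr enn2real p"
  using pq
proof (cases rule: conjugate_exponent_cases)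
  case one
  then obtain C where C: "AE \<omega> in M. \<bar>\<zeta> \<omega>\<bar> \<le> C" using \<zeta> by (auto simp: Lp_space_def)
  have "AE \<omega> in M. \<forall>v. \<bar>\<zeta> \<omega> * v\<bar> \<le> 0 + \<bar>C\<bar> * \<bar>v\<bar> powr enn2real p"
    using C by eventually_elim (auto simp: one abs_mult intro!: mult_right_mono)
  then show thesis by (intro that[of "\<lambda>_. 0" "\<bar>C\<bar>"]) auto
next
  case real
  have "\<bar>a * v\<bar> \<le> \<bar>a\<bar> powr enn2real q + 1 * \<bar>v\<bar> powr enn2real p" for a v :: real
  proof -
    have "\<bar>a\<bar> * \<bar>v\<bar> \<le> \<bar>a\<bar> powr enn2real q / enn2real q + \<bar>v\<bar> powr enn2real p / enn2real p"
      by (rule Youngs_inequality) (use real in \<open>auto simp: add.commute\<close>)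
    also have "\<dots> \<le> \<bar>a\<bar> powr enn2real q + \<bar>v\<bar> powr enn2real p"
      using real by (intro add_mono) (auto simp: divide_le_eq mult_le_cancel_left1)
    finally show ?thesis by (simp add: abs_mult)
  qed
  then show thesis
    using Lp_spaceD(2)[OF \<zeta> real(3)]
    by (intro that[of "\<lambda>\<omega>. \<bar>\<zeta> \<omega>\<bar> powr enn2real q" 1]) auto
qed

lemma conjugate_product_integrable:
  fixes \<zeta> V :: "'a \<Rightarrow> real"
  assumes pq: "1 \<le> p" "p < \<infinity>" "1 / p + 1 / q = 1" and \<zeta>: "\<zeta> \<in> Lp_space M q" and V: "V \<in> Lp_space M p"
  shows "integrable M (\<lambda>\<omega>. \<zeta> \<omega> * V \<omega>)"
proof -
  obtain k c where k: "integrable M k" "0 \<le> c" "AE \<omega> in M. \<forall>v. \<bar>\<zeta> \<omega> * v\<bar> \<le> k \<omega> + c * \<bar>v\<bar> powr enn2real p"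
    using conjugate_product_bound[OF pq \<zeta>] by blast
  show ?thesis
  proof (rule Bochner_Integration.integrable_bound)
    show "integrable M (\<lambda>\<omega>. k \<omega> + c * \<bar>V \<omega>\<bar> powr enn2real p)"
      using k(1) Lp_spaceD(2)[OF V] pq(2) by simp
    show "(\<lambda>\<omega>. \<zeta> \<omega> * V \<omega>) \<in> borel_measurable M"
      using Lp_spaceD(1)[OF \<zeta>] Lp_spaceD(1)[OF V] by measurable
    show "AE \<omega> in M. norm (\<zeta> \<omega> * V \<omega>) \<le> norm (k \<omega> + c * \<bar>V \<omega>\<bar> powr enn2real p)"
      using k(3)
    proof eventually_elim
      case (elim \<omega>)
      have "\<bar>\<zeta> \<omega> * V \<omega>\<bar> \<le> k \<omega> + c * \<bar>V \<omega>\<bar> powr enn2real p" using elim by blast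
      then show ?case by simp
    qed
  qed
qed

lemma conjugate_product_unit_ball_bound:
  fixes \<zeta> :: "'a \<Rightarrow> real"
  assumes pq: "1 \<le> p" "p < \<infinity>" "1 / p + 1 / q = 1" and \<zeta>: "\<zeta> \<in> Lp_space M q"
  obtains B where "0 \<le> B" "\<And>V. V \<in> Lp_space M p \<Longrightarrow> Lp_norm M p V < 1 \<Longrightarrow> (\<integral>\<omega>. \<zeta> \<omega> * V \<omega> \<partial>M) \<le> B"
proof -
  obtain k c where k: "integrable M k" "0 \<le> c" "AE \<omega> in M. \<forall>v. \<bar>\<zeta> \<omega> * v\<bar> \<le> k \<omega> + c * \<bar>v\<bar> powr enn2real p"
    using conjugate_product_bound[OF pq \<zeta>] by blast
  have r: "1 \<le> enn2real p" using pq by (cases p) auto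
  have "(\<integral>\<omega>. \<zeta> \<omega> * V \<omega> \<partial>M) \<le> \<bar>(\<integral>\<omega>. k \<omega> \<partial>M) + c\<bar>" if V: "V \<in> Lp_space M p" "Lp_norm M p V < 1" for V
  proof -
    have i: "integrable M (\<lambda>\<omega>. \<bar>V \<omega>\<bar> powr enn2real p)" using Lp_spaceD(2)[OF V(1)] pq(2) by simp
    have "(\<integral>\<omega>. \<bar>V \<omega>\<bar> powr enn2real p \<partial>M) \<le> 1"
    proof (rule ccontr)
      assume "\<not> ?thesis"
      then have "1 \<le> (\<integral>\<omega>. \<bar>V \<omega>\<bar> powr enn2real p \<partial>M) powr (1 / enn2real p)"
        using r by (intro ge_one_powr_ge_zero) auto
      moreover have "p \<noteq> \<infinity>" using pq(2) by simp
      ultimately show False using V(2) by (simp add: Lp_norm_def)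
    qed
    then have c: "c * (\<integral>\<omega>. \<bar>V \<omega>\<bar> powr enn2real p \<partial>M) \<le> c" using k(2) by (simp add: mult_left_le)
    have "(\<integral>\<omega>. \<zeta> \<omega> * V \<omega> \<partial>M) \<le> (\<integral>\<omega>. k \<omega> + c * \<bar>V \<omega>\<bar> powr enn2real p \<partial>M)"
    proof (rule integral_mono_AE)
      show "integrable M (\<lambda>\<omega>. \<zeta> \<omega> * V \<omega>)" by (rule conjugate_product_integrable[OF pq \<zeta> V(1)])
      show "integrable M (\<lambda>\<omega>. k \<omega> + c * \<bar>V \<omega>\<bar> powr enn2real p)" using k(1) i by simp
      show "AE \<omega> in M. \<zeta> \<omega> * V \<omega> \<le> k \<omega> + c * \<bar>V \<omega>\<bar> powr enn2real p"
        using k(3) by eventually_elim (auto intro: order_trans[OF abs_ge_self])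
    qed
    also have "\<dots> = (\<integral>\<omega>. k \<omega> \<partial>M) + c * (\<integral>\<omega>. \<bar>V \<omega>\<bar> powr enn2real p \<partial>M)" using k(1) i by simp
    finally show ?thesis using c by simp
  qed
  then show thesis by (intro that[of "\<bar>(\<integral>\<omega>. k \<omega> \<partial>M) + c\<bar>"]) auto
qed

section \<open>Positive functionals on Lebesgue spaces\<close>

locale positive_Lp_functional = prob_space M for M :: "'a measure" +
  fixes p :: ennreal and z :: "('a \<Rightarrow> real) \<Rightarrow> real"
  assumes p_ge_1: "1 \<le> p" and p_finite: "p < \<infinity>"
    and z_linear: "linear z"
    and z_nonpos: "V \<in> Lp_space M p \<Longrightarrow> AE \<omega> in M. V \<omega> \<le> 0 \<Longrightarrow> z V \<le> 0"
begin

abbreviation "r \<equiv> enn2real p"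

lemma r_ge_1: "1 \<le> r"
  using p_ge_1 p_finite by (cases p) auto

lemma p_neq_infinity: "p \<noteq> \<infinity>"
  using p_finite by simp

lemma z_mono:
  assumes "V \<in> Lp_space M p" "W \<in> Lp_space M p" "AE \<omega> in M. V \<omega> \<le> W \<omega>"
  shows "z V \<le> z W"
proof -
  have "z (V - W) \<le> 0"
    by (rule z_nonpos[OF subspace_diff[OF subspace_Lp_space assms(1,2)]]) (use assms(3) in simp)
  then show ?thesis by (simp add: linear_diff[OF z_linear])
qed

text \<open>
  If \<open>z\<close> were unbounded, there would be \<open>V\<^sub>k\<close> in the unit ball with \<open>z V\<^sub>k > 4\<^sup>k\<close>.  But the function
  \<open>W = (\<Sum>\<^sub>k (2\<^sup>-\<^sup>k \<bar>V\<^sub>k\<bar>)\<^sup>r)\<^bsup>1/r\<^esup>\<close> lies in \<open>L\<^sub>p\<close> and dominates every \<open>2\<^sup>-\<^sup>k V\<^sub>k\<close>, so that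
  \<open>z W > 2\<^sup>k\<close> for all \<open>k\<close>.
\<close>
lemma z_bounded:
  obtains C where "0 \<le> C" "\<And>V. V \<in> Lp_space M p \<Longrightarrow> (\<integral>\<omega>. \<bar>V \<omega>\<bar> powr r \<partial>M) \<le> 1 \<Longrightarrow> z V \<le> C"
proof (rule ccontr)
  assume neg: "\<not> thesis"
  have "\<exists>V. V \<in> Lp_space M p \<and> (\<integral>\<omega>. \<bar>V \<omega>\<bar> powr r \<partial>M) \<le> 1 \<and> 4 ^ k < z V" for k :: nat
  proof (rule ccontr)
    assume "\<not> ?thesis"
    then have "z V \<le> 4 ^ k" if "V \<in> Lp_space M p" "(\<integral>\<omega>. \<bar>V \<omega>\<bar> powr r \<partial>M) \<le> 1" for V
      using that by (meson not_le)
    then show False using neg that[of "4 ^ k"] by simp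
  qed
  then obtain V where V: "\<And>k. V k \<in> Lp_space M p" "\<And>k. (\<integral>\<omega>. \<bar>V k \<omega>\<bar> powr r \<partial>M) \<le> 1" "\<And>k. 4 ^ k < z (V k)"
    by metis
  have [measurable]: "V k \<in> borel_measurable M" for k using Lp_spaceD(1)[OF V(1)] .
  have Vi: "integrable M (\<lambda>\<omega>. \<bar>V k \<omega>\<bar> powr r)" for k using Lp_spaceD(2)[OF V(1) p_neq_infinity] by simp
  define c where "c k = ((1 / 2) ^ k) powr r" for k :: nat
  have c: "0 \<le> c k" "c k \<le> (1 / 2) ^ k" for k
    using powr_mono'[of 1 r "(1 / 2) ^ k"] r_ge_1 by (auto simp: c_def power_le_one)
  define T where "T \<omega> = (\<Sum>k. ennreal (c k * \<bar>V k \<omega>\<bar> powr r))" for \<omega>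
  have [measurable]: "T \<in> borel_measurable M" unfolding T_def by measurable
  have "(\<integral>\<^sup>+\<omega>. T \<omega> \<partial>M) = (\<Sum>k. \<integral>\<^sup>+\<omega>. ennreal (c k * \<bar>V k \<omega>\<bar> powr r) \<partial>M)"
    unfolding T_def by (rule nn_integral_suminf) measurable
  also have "\<dots> \<le> (\<Sum>k. ennreal ((1 / 2) ^ k))"
  proof (rule suminf_le)
    fix k
    have "(\<integral>\<^sup>+\<omega>. ennreal (c k * \<bar>V k \<omega>\<bar> powr r) \<partial>M) = ennreal (\<integral>\<omega>. c k * \<bar>V k \<omega>\<bar> powr r \<partial>M)"
      by (rule nn_integral_eq_integral) (use Vi c in auto)
    also have "(\<integral>\<omega>. c k * \<bar>V k \<omega>\<bar> powr r \<partial>M) \<le> c k * 1" using V(2) c(1) by (simp add: mult_left_le)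
    also have "\<dots> \<le> (1 / 2) ^ k" using c(2) by simp
    finally show "(\<integral>\<^sup>+\<omega>. ennreal (c k * \<bar>V k \<omega>\<bar> powr r) \<partial>M) \<le> ennreal ((1 / 2) ^ k)"
      by (simp add: ennreal_leI)
  qed auto
  also have "\<dots> < \<infinity>"
  proof -
    have "summable (\<lambda>k. (1 / 2 :: real) ^ k)" by (rule summable_geometric) simp
    then have "(\<Sum>k. ennreal ((1 / 2) ^ k)) \<noteq> top" by (rule ennreal_suminf_neq_top) simp
    then show ?thesis by (simp only: infinity_ennreal_def less_top)
  qed
  finally have T_int: "(\<integral>\<^sup>+\<omega>. T \<omega> \<partial>M) < \<infinity>" .
  then have "AE \<omega> in M. T \<omega> \<noteq> \<infinity>" by (intro nn_integral_PInf_AE) auto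
  then have T_fin: "AE \<omega> in M. ennreal (enn2real (T \<omega>)) = T \<omega>" by eventually_elim (simp add: less_top)
  define W where "W \<omega> = enn2real (T \<omega>) powr (1 / r)" for \<omega>
  have W: "W \<in> Lp_space M p"
  proof (rule Lp_spaceI[OF p_neq_infinity])
    show "W \<in> borel_measurable M" unfolding W_def by measurable
    have "norm (W \<omega>) powr r = enn2real (T \<omega>)" for \<omega> using r_ge_1 by (simp add: W_def powr_powr)
    moreover have "integrable M (\<lambda>\<omega>. enn2real (T \<omega>))"
    proof (rule integrableI_nonneg)
      have "(\<integral>\<^sup>+\<omega>. ennreal (enn2real (T \<omega>)) \<partial>M) = (\<integral>\<^sup>+\<omega>. T \<omega> \<partial>M)"
        using T_fin by (rule nn_integral_cong_AE)
      then show "(\<integral>\<^sup>+\<omega>. ennreal (enn2real (T \<omega>)) \<partial>M) < \<infinity>" using T_int by simp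
    qed auto
    ultimately show "integrable M (\<lambda>\<omega>. norm (W \<omega>) powr r)" by simp
  qed
  have "2 ^ k < z W" for k :: nat
  proof -
    have sc: "(1 / 2) ^ k *\<^sub>R V k \<in> Lp_space M p" by (rule subspace_scale[OF subspace_Lp_space V(1)])
    have "AE \<omega> in M. ((1 / 2) ^ k *\<^sub>R V k) \<omega> \<le> W \<omega>"
      using T_fin
    proof eventually_elim
      case (elim \<omega>)
      have "ennreal (c k * \<bar>V k \<omega>\<bar> powr r) = (\<Sum>i\<in>{k}. ennreal (c i * \<bar>V i \<omega>\<bar> powr r))" by simp
      also have "\<dots> \<le> T \<omega>" unfolding T_def by (rule sum_le_suminf) auto
      finally have "ennreal (c k * \<bar>V k \<omega>\<bar> powr r) \<le> ennreal (enn2real (T \<omega>))" using elim by simp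
      then have le: "c k * \<bar>V k \<omega>\<bar> powr r \<le> enn2real (T \<omega>)" by (simp add: ennreal_le_iff)
      have "(1 / 2) ^ k * V k \<omega> \<le> (1 / 2) ^ k * \<bar>V k \<omega>\<bar>" by (intro mult_left_mono) auto
      also have "\<dots> = (c k * \<bar>V k \<omega>\<bar> powr r) powr (1 / r)"
        using r_ge_1 by (simp add: c_def powr_mult powr_powr)
      also have "\<dots> \<le> W \<omega>"
        unfolding W_def by (rule powr_mono2[OF _ _ le]) (use r_ge_1 c in auto)
      finally show ?case by simp
    qed
    then have "z ((1 / 2) ^ k *\<^sub>R V k) \<le> z W" by (rule z_mono[OF sc W])
    then have "(1 / 2) ^ k * z (V k) \<le> z W" by (simp add: linear_scale[OF z_linear])
    moreover have "(1 / 2) ^ k * 4 ^ k < (1 / 2) ^ k * z (V k)" using V(3) by (intro mult_strict_left_mono) auto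
    moreover have "(1 / 2) ^ k * 4 ^ k = (2 ^ k :: real)" by (simp flip: power_mult_distrib)
    ultimately show ?thesis by linarith
  qed
  moreover obtain k :: nat where "z W < 2 ^ k" using real_arch_pow[of 2 "z W"] by auto
  ultimately show False using less_asym by blast
qed

lemma z_power_bounded:
  obtains C where "0 \<le> C"
    "\<And>V a. V \<in> Lp_space M p \<Longrightarrow> 0 < a \<Longrightarrow> (\<integral>\<omega>. \<bar>V \<omega>\<bar> powr r \<partial>M) \<le> a \<Longrightarrow> z V \<le> C * a powr (1 / r)"
proof -
  obtain C where C: "0 \<le> C" "\<And>V. V \<in> Lp_space M p \<Longrightarrow> (\<integral>\<omega>. \<bar>V \<omega>\<bar> powr r \<partial>M) \<le> 1 \<Longrightarrow> z V \<le> C"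
    using z_bounded by blast
  have "z V \<le> C * a powr (1 / r)" if V: "V \<in> Lp_space M p" and a: "0 < a" "(\<integral>\<omega>. \<bar>V \<omega>\<bar> powr r \<partial>M) \<le> a" for V a
  proof -
    define b where "b = inverse (a powr (1 / r))"
    have b: "0 < b" using a by (simp add: b_def)
    have "b powr r = inverse a" using a r_ge_1 by (simp add: b_def inverse_powr powr_powr)
    then have "(\<integral>\<omega>. \<bar>(b *\<^sub>R V) \<omega>\<bar> powr r \<partial>M) = inverse a * (\<integral>\<omega>. \<bar>V \<omega>\<bar> powr r \<partial>M)"
      using b by (simp add: abs_mult powr_mult)
    also have "\<dots> \<le> 1" using a by (simp add: field_simps)
    finally have "z (b *\<^sub>R V) \<le> C" by (rule C(2)[OF subspace_scale[OF subspace_Lp_space V]])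
    then have "b * z V \<le> C" by (simp add: linear_scale[OF z_linear])
    then show ?thesis using a by (simp add: b_def field_simps)
  qed
  with C(1) show thesis by (rule that)
qed

lemma z_LIMSEQ_0:
  assumes V: "\<And>n. V n \<in> Lp_space M p" and lim: "(\<lambda>n. \<integral>\<omega>. \<bar>V n \<omega>\<bar> powr r \<partial>M) \<longlonglongrightarrow> 0"
  shows "(\<lambda>n. z (V n)) \<longlonglongrightarrow> 0"
proof -
  obtain C where C: "0 \<le> C"
    "\<And>V a. V \<in> Lp_space M p \<Longrightarrow> 0 < a \<Longrightarrow> (\<integral>\<omega>. \<bar>V \<omega>\<bar> powr r \<partial>M) \<le> a \<Longrightarrow> z V \<le> C * a powr (1 / r)"
    using z_power_bounded by blast
  define a where "a n = (\<integral>\<omega>. \<bar>V n \<omega>\<bar> powr r \<partial>M) + inverse (real (Suc n))" for n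
  have pos: "0 < a n" for n unfolding a_def by (intro add_nonneg_pos integral_nonneg_AE) auto
  have "a \<longlonglongrightarrow> 0 + 0" unfolding a_def by (intro tendsto_add lim LIMSEQ_inverse_real_of_nat)
  then have "(\<lambda>n. a n powr (1 / r)) \<longlonglongrightarrow> 0"
    by (intro tendsto_zero_powrI[OF _ tendsto_const]) (use pos r_ge_1 in \<open>auto intro!: always_eventually less_imp_le\<close>)
  then have C0: "(\<lambda>n. C * a n powr (1 / r)) \<longlonglongrightarrow> 0" by (rule tendsto_mult_right_zero)
  have "\<bar>z (V n)\<bar> \<le> C * a n powr (1 / r)" for n
  proof -
    have "z (V n) \<le> C * a n powr (1 / r)" by (rule C(2)[OF V pos]) (simp add: a_def)
    moreover have "z (- V n) \<le> C * a n powr (1 / r)"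
      by (rule C(2)[OF subspace_neg[OF subspace_Lp_space V] pos]) (simp add: a_def)
    ultimately show ?thesis by (simp add: linear_neg[OF z_linear] abs_le_iff)
  qed
  then show ?thesis by (intro Lim_null_comparison[OF always_eventually C0]) simp
qed

lemma indicator_in_Lp: "A \<in> sets M \<Longrightarrow> (indicator A :: 'a \<Rightarrow> real) \<in> Lp_space M p"
  by (rule Lp_space_bounded[where r=1]) (auto simp: indicator_def)

lemma indicator_powr: "\<bar>indicator A \<omega> :: real\<bar> powr r = indicator A \<omega>"
  by (auto simp: indicator_def)

text \<open>
  By \<open>z_LIMSEQ_0\<close> the set function \<open>A \<mapsto> z 1\<^sub>A\<close> is continuous at the empty set.
\<close>
lemma density_exists:
  obtains \<zeta> where "\<zeta> \<in> borel_measurable M" "\<And>\<omega>. 0 \<le> \<zeta> \<omega>" "integrable M \<zeta>"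
    "\<And>A. A \<in> sets M \<Longrightarrow> z (indicator A) = (\<integral>\<omega>. indicator A \<omega> * \<zeta> \<omega> \<partial>M)"
proof (rule density_of_set_function[of M "\<lambda>A. z (indicator A)"])
  show "0 \<le> z (indicator A)" if "A \<in> sets M" for A
    using z_mono[OF subspace_0[OF subspace_Lp_space] indicator_in_Lp[OF that]] by (simp add: linear_0[OF z_linear])
  show "z (indicator (A \<union> B)) = z (indicator A) + z (indicator B)" if "A \<inter> B = {}" for A B
  proof -
    have "indicator (A \<union> B) = (indicator A + indicator B :: 'a \<Rightarrow> real)"
      using that by (auto simp: indicator_def fun_eq_iff)
    then show ?thesis by (simp add: linear_add[OF z_linear])
  qed
  show "(\<lambda>i. z (indicator (A i))) \<longlonglongrightarrow> 0" if A: "range A \<subseteq> sets M" "decseq A" "(\<Inter>i. A i) = {}" for A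
  proof (rule z_LIMSEQ_0)
    show "(indicator (A n) :: 'a \<Rightarrow> real) \<in> Lp_space M p" for n using A(1) by (intro indicator_in_Lp) auto
    have "(\<lambda>i. measure M (A i)) \<longlonglongrightarrow> measure M (\<Inter>i. A i)" by (rule finite_Lim_measure_decseq[OF A(1,2)])
    moreover have "(\<integral>\<omega>. \<bar>indicator (A n) \<omega> :: real\<bar> powr r \<partial>M) = measure M (A n)" for n
    proof -
      have "A n \<in> sets M" using A(1) by auto
      then show ?thesis unfolding indicator_powr by simp
    qed
    ultimately show "(\<lambda>n. \<integral>\<omega>. \<bar>indicator (A n) \<omega> :: real\<bar> powr r \<partial>M) \<longlonglongrightarrow> 0" using A(3) by simp
  qed
  show "z (indicator A) = 0" if A: "A \<in> null_sets M" for A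
  proof -
    have A': "A \<in> sets M" using A by auto
    have "AE \<omega> in M. indicator A \<omega> = (0::real)" using AE_not_in[OF A] by eventually_elim simp
    then have "AE \<omega> in M. indicator A \<omega> \<le> (0 :: 'a \<Rightarrow> real) \<omega>" "AE \<omega> in M. (0 :: 'a \<Rightarrow> real) \<omega> \<le> indicator A \<omega>"
      by (auto elim: eventually_mono)
    then have "z (indicator A) \<le> z 0" "z 0 \<le> z (indicator A)"
      using z_mono indicator_in_Lp[OF A'] subspace_0[OF subspace_Lp_space] by blast+
    then show ?thesis by (simp add: linear_0[OF z_linear])
  qed
qed (use finite_measure_axioms that in auto)

text \<open>
  Both sides are linear and pass to monotone limits, the left one by \<open>z_LIMSEQ_0\<close>.
\<close>
lemma represents_nonneg:
  assumes \<zeta>: "\<zeta> \<in> borel_measurable M" "\<And>\<omega>. 0 \<le> \<zeta> \<omega>" "integrable M \<zeta>"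
    "\<And>A. A \<in> sets M \<Longrightarrow> z (indicator A) = (\<integral>\<omega>. indicator A \<omega> * \<zeta> \<omega> \<partial>M)"
    and V: "V \<in> Lp_space M p" "\<And>\<omega>. 0 \<le> V \<omega>"
  shows "integrable M (\<lambda>\<omega>. \<zeta> \<omega> * V \<omega>) \<and> z V = (\<integral>\<omega>. \<zeta> \<omega> * V \<omega> \<partial>M)"
proof -
  note \<zeta>(1) [measurable]
  have "V \<in> Lp_space M p \<longrightarrow> integrable M (\<lambda>\<omega>. \<zeta> \<omega> * V \<omega>) \<and> z V = (\<integral>\<omega>. \<zeta> \<omega> * V \<omega> \<partial>M)"
    using Lp_spaceD(1)[OF V(1)] V(2)
  proof (induction rule: borel_measurable_induct_real)
    case (set A)
    then show ?case using \<zeta>(4)[OF set] integrable_mult_indicator[OF set \<zeta>(3)] by (simp add: mult.commute)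
  next
    case (mult u c)
    show ?case
    proof (cases "c = 0")
      case True
      then show ?thesis using linear_0[OF z_linear] by (simp add: zero_fun_def)
    next
      case False
      have eq: "(\<lambda>\<omega>. c * u \<omega>) = c *\<^sub>R u" by (simp add: fun_eq_iff)
      have "u \<in> Lp_space M p" if "c *\<^sub>R u \<in> Lp_space M p"
        using subspace_scale[OF subspace_Lp_space that, of "1 / c"] False by simp
      then show ?thesis using mult.IH unfolding eq by (auto simp: linear_scale[OF z_linear] mult.left_commute)
    qed
  next
    case (add u v)
    have eq: "(\<lambda>\<omega>. v \<omega> + u \<omega>) = v + u" by (simp add: fun_eq_iff)
    show ?case
    proof
      assume uv: "(\<lambda>\<omega>. v \<omega> + u \<omega>) \<in> Lp_space M p"
      have "u \<in> Lp_space M p" "v \<in> Lp_space M p"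
        by (rule Lp_space_dominated[OF uv p_neq_infinity]; use add in auto)+
      then show "integrable M (\<lambda>\<omega>. \<zeta> \<omega> * (v \<omega> + u \<omega>)) \<and> z (\<lambda>\<omega>. v \<omega> + u \<omega>) = (\<integral>\<omega>. \<zeta> \<omega> * (v \<omega> + u \<omega>) \<partial>M)"
        using add unfolding eq by (simp add: linear_add[OF z_linear] distrib_left)
    qed
  next
    case (seq U)
    show ?case
    proof
      assume V: "V \<in> Lp_space M p"
      note [measurable] = Lp_spaceD(1)[OF V] seq(1)
      have U_le: "U i \<omega> \<le> V \<omega>" if "\<omega> \<in> space M" for i \<omega>
        using incseq_le[OF _ seq(4)[OF that], of i] seq(3) by (auto simp: incseq_def le_fun_def)
      have U: "U i \<in> Lp_space M p" for i
        by (rule Lp_space_dominated[OF V p_neq_infinity seq(1)]) (use seq(2) order_trans[OF U_le abs_ge_self] in \<open>auto intro!: AE_I2\<close>)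
      have diff: "V - U i \<in> Lp_space M p" for i by (rule subspace_diff[OF subspace_Lp_space V U])
      have "(\<lambda>i. \<integral>\<omega>. \<bar>(V - U i) \<omega>\<bar> powr r \<partial>M) \<longlonglongrightarrow> (\<integral>\<omega>. 0 \<partial>M)"
      proof (rule integral_dominated_convergence)
        show "integrable M (\<lambda>\<omega>. \<bar>V \<omega>\<bar> powr r)" using Lp_spaceD(2)[OF V p_neq_infinity] by simp
        show "(\<lambda>\<omega>. \<bar>(V - U i) \<omega>\<bar> powr r) \<in> borel_measurable M" for i by (simp, measurable)
        show "AE \<omega> in M. (\<lambda>i. \<bar>(V - U i) \<omega>\<bar> powr r) \<longlonglongrightarrow> 0"
        proof (rule AE_I2)
          fix \<omega> assume "\<omega> \<in> space M"
          then have "(\<lambda>i. \<bar>V \<omega> - U i \<omega>\<bar>) \<longlonglongrightarrow> \<bar>V \<omega> - V \<omega>\<bar>" by (intro tendsto_intros seq(4))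
          then have "(\<lambda>i. \<bar>V \<omega> - U i \<omega>\<bar>) \<longlonglongrightarrow> 0" by simp
          then have "(\<lambda>i. \<bar>V \<omega> - U i \<omega>\<bar> powr r) \<longlonglongrightarrow> 0"
            by (rule tendsto_zero_powrI[OF _ tendsto_const]) (use r_ge_1 in auto)
          then show "(\<lambda>i. \<bar>(V - U i) \<omega>\<bar> powr r) \<longlonglongrightarrow> 0" by simp
        qed
        show "AE \<omega> in M. norm (\<bar>(V - U i) \<omega>\<bar> powr r) \<le> \<bar>V \<omega>\<bar> powr r" for i
        proof (rule AE_I2)
          fix \<omega> assume "\<omega> \<in> space M"
          then have "\<bar>V \<omega> - U i \<omega>\<bar> \<le> \<bar>V \<omega>\<bar>" using seq(2)[of i \<omega>] U_le[of \<omega> i] by linarith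
          then show "norm (\<bar>(V - U i) \<omega>\<bar> powr r) \<le> \<bar>V \<omega>\<bar> powr r"
            using r_ge_1 by (auto intro: powr_mono2)
        qed
      qed simp
      then have "(\<lambda>i. z (V - U i)) \<longlonglongrightarrow> 0" by (intro z_LIMSEQ_0 diff) simp
      from tendsto_diff[OF tendsto_const[of "z V"] this]
      have zU: "(\<lambda>i. z (U i)) \<longlonglongrightarrow> z V" by (simp add: linear_diff[OF z_linear])
      have IH: "integrable M (\<lambda>\<omega>. \<zeta> \<omega> * U i \<omega>)" "z (U i) = (\<integral>\<omega>. \<zeta> \<omega> * U i \<omega> \<partial>M)" for i
        using seq(5) U by auto
      have lim: "AE \<omega> in M. (\<lambda>i. \<zeta> \<omega> * U i \<omega>) \<longlonglongrightarrow> \<zeta> \<omega> * V \<omega>"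
        by (intro AE_I2 tendsto_intros seq(4))
      have mono: "AE \<omega> in M. mono (\<lambda>i. \<zeta> \<omega> * U i \<omega>)"
        using seq(3) \<zeta>(2) by (intro AE_I2 monoI mult_left_mono) (auto simp: incseq_def le_fun_def)
      have x: "(\<lambda>i. \<integral>\<omega>. \<zeta> \<omega> * U i \<omega> \<partial>M) \<longlonglongrightarrow> z V" using zU by (simp add: IH(2))
      have m: "(\<lambda>\<omega>. \<zeta> \<omega> * V \<omega>) \<in> borel_measurable M" by measurable
      show "integrable M (\<lambda>\<omega>. \<zeta> \<omega> * V \<omega>) \<and> z V = (\<integral>\<omega>. \<zeta> \<omega> * V \<omega> \<partial>M)"
        using integrable_monotone_convergence[OF IH(1) mono lim x m]
          integral_monotone_convergence[OF IH(1) mono lim x m] by simp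
    qed
  qed
  then show ?thesis using V(1) by simp
qed

text \<open>
  The density \<open>\<zeta>\<close> of \<open>A \<mapsto> z 1\<^sub>A\<close> represents \<open>z\<close> by monotone approximation.  That \<open>\<zeta>\<close> is in \<open>L\<^sub>q\<close> follows from
  the boundedness of \<open>z\<close>, say by the constant \<open>C\<close>.  For \<open>p = 1\<close>, testing with the indicator of
  \<open>{\<zeta> > C}\<close> shows that this set is null.  For \<open>p > 1\<close>, testing with the power \<open>q - 1\<close> of the truncation
  \<open>min \<zeta> n\<close> gives \<open>I \<le> C I\<^bsup>1/p\<^esup>\<close> for the integral \<open>I\<close> of its \<open>q\<close>-th power, so \<open>I \<le> C\<^sup>q\<close> for all \<open>n\<close>.
\<close>
lemma representation_by_conjugate_space:
  assumes pq: "1 / p + 1 / q = 1"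
  obtains \<zeta> where "\<zeta> \<in> Lp_space M q" "\<And>\<omega>. 0 \<le> \<zeta> \<omega>"
    "\<And>V. V \<in> Lp_space M p \<Longrightarrow> z V = (\<integral>\<omega>. \<zeta> \<omega> * V \<omega> \<partial>M)"
proof -
  obtain \<zeta> where \<zeta>: "\<zeta> \<in> borel_measurable M" "\<And>\<omega>. 0 \<le> \<zeta> \<omega>" "integrable M \<zeta>"
    "\<And>A. A \<in> sets M \<Longrightarrow> z (indicator A) = (\<integral>\<omega>. indicator A \<omega> * \<zeta> \<omega> \<partial>M)"
    using density_exists by blast
  note \<zeta>(1) [measurable]
  have rep: "integrable M (\<lambda>\<omega>. \<zeta> \<omega> * V \<omega>) \<and> z V = (\<integral>\<omega>. \<zeta> \<omega> * V \<omega> \<partial>M)"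
    if "V \<in> Lp_space M p" "\<And>\<omega>. 0 \<le> V \<omega>" for V
    by (rule represents_nonneg[OF \<zeta>(1-3) _ that]) (rule \<zeta>(4))
  obtain C where C: "0 \<le> C"
    "\<And>V a. V \<in> Lp_space M p \<Longrightarrow> 0 < a \<Longrightarrow> (\<integral>\<omega>. \<bar>V \<omega>\<bar> powr r \<partial>M) \<le> a \<Longrightarrow> z V \<le> C * a powr (1 / r)"
    using z_power_bounded by blast
  have "\<zeta> \<in> Lp_space M q"
    using p_ge_1 p_finite pq
  proof (cases rule: conjugate_exponent_cases)
    case one
    define A where "A = {\<omega> \<in> space M. C < \<zeta> \<omega>}"
    have A: "A \<in> sets M" unfolding A_def by measurable
    have "emeasure M A = 0"
    proof (rule ccontr)
      assume "emeasure M A \<noteq> 0"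
      then have pos: "0 < measure M A" by (simp add: emeasure_eq_measure zero_less_measure_iff)
      have i: "integrable M (\<lambda>\<omega>. indicator A \<omega> * \<zeta> \<omega>)" "integrable M (\<lambda>\<omega>. indicator A \<omega> * C)"
        using integrable_mult_indicator[OF A \<zeta>(3)] integrable_mult_indicator[OF A, of "\<lambda>_. C"] by simp_all
      have "(\<integral>\<omega>. indicator A \<omega> * \<zeta> \<omega> \<partial>M) \<le> C * measure M A"
        using C(2)[OF indicator_in_Lp[OF A] pos] A one(1) pos by (simp add: \<zeta>(4)[OF A])
      then have "(\<integral>\<omega>. indicator A \<omega> * \<zeta> \<omega> - indicator A \<omega> * C \<partial>M) \<le> 0"
        using i A by (simp add: mult.commute)
      moreover have nn: "0 \<le> indicator A \<omega> * \<zeta> \<omega> - indicator A \<omega> * C" for \<omega> by (auto simp: A_def indicator_def)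
      ultimately have "(\<integral>\<omega>. indicator A \<omega> * \<zeta> \<omega> - indicator A \<omega> * C \<partial>M) = 0"
        by (intro antisym integral_nonneg_AE AE_I2) auto
      then have "AE \<omega> in M. indicator A \<omega> * \<zeta> \<omega> - indicator A \<omega> * C = 0"
        using nn i by (subst (asm) integral_nonneg_eq_0_iff_AE) auto
      then have "AE \<omega> in M. \<omega> \<notin> A" by eventually_elim (auto simp: A_def indicator_def split: if_splits)
      then have "A \<in> null_sets M" using AE_iff_null_sets[OF A] by simp
      with \<open>emeasure M A \<noteq> 0\<close> show False by (simp add: null_sets_def)
    qed
    then have "A \<in> null_sets M" using A by (simp add: null_sets_def)
    then have "AE \<omega> in M. \<omega> \<notin> A" by (rule AE_not_in)
    then have "AE \<omega> in M. norm (\<zeta> \<omega>) \<le> C" using AE_space by eventually_elim (auto simp: A_def \<zeta>(2))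
    then show ?thesis using one(2) \<zeta>(1) by (auto simp: Lp_space_def)
  next
    case real
    define s where "s = enn2real q"
    have s: "1 < s" "1 - 1 / r = 1 / s" "(s - 1) * r = s"
      using real by (auto simp: s_def field_simps)
    define \<zeta>n where "\<zeta>n n \<omega> = min (\<zeta> \<omega>) (real n)" for n \<omega>
    have \<zeta>n [measurable]: "\<zeta>n n \<in> borel_measurable M" for n unfolding \<zeta>n_def by measurable
    have \<zeta>n_bd: "0 \<le> \<zeta>n n \<omega>" "\<zeta>n n \<omega> \<le> real n" "\<zeta>n n \<omega> \<le> \<zeta> \<omega>" for n \<omega> using \<zeta>(2) by (auto simp: \<zeta>n_def)
    have pw_int: "integrable M (\<lambda>\<omega>. \<zeta>n n \<omega> powr s)" for n
      by (rule integrable_const_bound[where B="real n powr s"]) (use \<zeta>n_bd s in \<open>auto intro!: AE_I2 powr_mono2\<close>)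
    define I where "I n = (\<integral>\<omega>. \<zeta>n n \<omega> powr s \<partial>M)" for n
    have I_nonneg: "0 \<le> I n" for n unfolding I_def by (intro integral_nonneg_AE) auto
    have I_le: "I n \<le> C powr s" for n
    proof (cases "I n = 0")
      case False
      then have pos: "0 < I n" using I_nonneg[of n] by simp
      define V where "V \<omega> = \<zeta>n n \<omega> powr (s - 1)" for \<omega>
      have [measurable]: "V \<in> borel_measurable M" unfolding V_def by measurable
      have V: "V \<in> Lp_space M p"
        by (rule Lp_space_bounded[where r="real n powr (s - 1)"])
          (measurable, use \<zeta>n_bd s in \<open>auto simp: V_def intro!: powr_mono2\<close>)
      have Vr: "\<bar>V \<omega>\<bar> powr r = \<zeta>n n \<omega> powr s" for \<omega> by (simp add: V_def powr_powr s(3))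
      have V0: "0 \<le> V \<omega>" for \<omega> by (simp add: V_def)
      have "I n \<le> (\<integral>\<omega>. \<zeta> \<omega> * V \<omega> \<partial>M)"
        unfolding I_def
      proof (rule integral_mono[OF pw_int])
        show "integrable M (\<lambda>\<omega>. \<zeta> \<omega> * V \<omega>)" using rep[OF V V0] by simp
        fix \<omega>
        have "\<zeta>n n \<omega> powr s = \<zeta>n n \<omega> * \<zeta>n n \<omega> powr (s - 1)"
          using \<zeta>n_bd(1)[of n \<omega>] powr_add[of "\<zeta>n n \<omega>" 1 "s - 1"] by (cases "\<zeta>n n \<omega> = 0") auto
        also have "\<dots> \<le> \<zeta> \<omega> * V \<omega>" unfolding V_def by (intro mult_right_mono \<zeta>n_bd) auto
        finally show "\<zeta>n n \<omega> powr s \<le> \<zeta> \<omega> * V \<omega>" .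
      qed
      also have "\<dots> = z V" using rep[OF V V0] by simp
      also have "\<dots> \<le> C * I n powr (1 / r)" by (rule C(2)[OF V pos]) (simp add: Vr I_def)
      finally have "I n * I n powr (- (1 / r)) \<le> C * I n powr (1 / r) * I n powr (- (1 / r))"
        by (intro mult_right_mono) auto
      moreover have "I n * I n powr (- (1 / r)) = I n powr (1 / s)"
        using pos powr_add[of "I n" 1 "- (1 / r)"] s(2) by simp
      moreover have "I n powr (1 / r) * I n powr (- (1 / r)) = 1"
        using pos by (simp flip: powr_add)
      ultimately have "I n powr (1 / s) \<le> C" by (simp add: mult.assoc)
      then have "(I n powr (1 / s)) powr s \<le> C powr s" using s by (intro powr_mono2) auto
      then show ?thesis using pos s by (simp add: powr_powr)
    qed simp
    have inc: "incseq I"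
      unfolding incseq_def I_def using s \<zeta>n_bd
      by (intro allI impI integral_mono pw_int powr_mono2) (auto simp: \<zeta>n_def)
    obtain L where L: "I \<longlonglongrightarrow> L" by (rule incseq_convergent[OF inc]) (use I_le in blast)
    have "integrable M (\<lambda>\<omega>. \<zeta> \<omega> powr s)"
    proof (rule integrable_monotone_convergence[OF pw_int])
      show "AE \<omega> in M. mono (\<lambda>n. \<zeta>n n \<omega> powr s)"
        using s \<zeta>n_bd by (intro AE_I2 monoI powr_mono2) (auto simp: \<zeta>n_def)
      show "AE \<omega> in M. (\<lambda>n. \<zeta>n n \<omega> powr s) \<longlonglongrightarrow> \<zeta> \<omega> powr s"
      proof (rule AE_I2)
        fix \<omega>
        obtain n0 where "\<zeta> \<omega> \<le> real n0" using real_arch_simple by blast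
        then have "\<zeta>n n \<omega> powr s = \<zeta> \<omega> powr s" if "n \<ge> n0" for n
          using that by (simp add: \<zeta>n_def min_absorb1)
        then have "\<forall>\<^sub>F n in sequentially. \<zeta>n n \<omega> powr s = \<zeta> \<omega> powr s"
          by (auto simp: eventually_sequentially)
        then show "(\<lambda>n. \<zeta>n n \<omega> powr s) \<longlonglongrightarrow> \<zeta> \<omega> powr s" by (rule tendsto_eventually)
      qed
      show "(\<lambda>n. \<integral>\<omega>. \<zeta>n n \<omega> powr s \<partial>M) \<longlonglongrightarrow> L" using L unfolding I_def[abs_def] .
    qed measurable
    then show ?thesis using \<zeta>(1,2) real(3) by (intro Lp_spaceI) (simp_all add: s_def)
  qed
  moreover have "z V = (\<integral>\<omega>. \<zeta> \<omega> * V \<omega> \<partial>M)" if V: "V \<in> Lp_space M p" for V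
  proof -
    note [measurable] = Lp_spaceD(1)[OF V]
    define P where "P \<omega> = max (V \<omega>) 0" for \<omega>
    define Q where "Q \<omega> = max (- V \<omega>) 0" for \<omega>
    have "P \<in> borel_measurable M" "Q \<in> borel_measurable M" unfolding P_def Q_def by measurable
    then have PQ: "P \<in> Lp_space M p" "Q \<in> Lp_space M p"
      using Lp_space_dominated[OF V p_neq_infinity, of P] Lp_space_dominated[OF V p_neq_infinity, of Q]
      by (simp_all add: P_def Q_def)
    have nn: "0 \<le> P \<omega>" "0 \<le> Q \<omega>" for \<omega> by (auto simp: P_def Q_def)
    have VPQ: "V = P - Q" by (auto simp: P_def Q_def fun_eq_iff)
    have "z V = z P - z Q" unfolding VPQ by (rule linear_diff[OF z_linear])
    also have "\<dots> = (\<integral>\<omega>. \<zeta> \<omega> * V \<omega> \<partial>M)"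
      using rep[OF PQ(1) nn(1)] rep[OF PQ(2) nn(2)] by (simp add: VPQ right_diff_distrib)
    finally show ?thesis .
  qed
  ultimately show thesis using \<zeta>(2) by (intro that)
qed

end

section \<open>The composite functional\<close>

text \<open>
  Subtracting from \<open>Z\<close> the indicator of \<open>{\<zeta> < 0}\<close> does not increase \<open>\<rho>\<close>.
\<close>
lemma (in prob_space) Lq_subgradient_nonneg:
  assumes \<zeta>: "\<zeta> \<in> Lq_subdiff M p q \<rho> Z" and Z: "Z \<in> Lp_space M p"
    and mono: "Lp_nondecreasing M p \<rho>"
    and pq: "1 \<le> p" "p < \<infinity>" "1 / p + 1 / q = 1"
  shows "AE \<omega> in M. 0 \<le> \<zeta> \<omega>"
proof -
  have \<zeta>_Lq: "\<zeta> \<in> Lp_space M q" using \<zeta> by (simp add: Lq_subdiff_def)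
  note [measurable] = Lp_spaceD(1)[OF \<zeta>_Lq]
  define I where "I \<omega> = (if \<zeta> \<omega> < 0 then 1 else 0 :: real)" for \<omega>
  have [measurable]: "I \<in> borel_measurable M" unfolding I_def by measurable
  have I_Lp: "I \<in> Lp_space M p"
    by (rule Lp_space_bounded[where r=1]) (auto simp: I_def)
  have V: "Z - I \<in> Lp_space M p" by (rule subspace_diff[OF subspace_Lp_space Z I_Lp])
  have "\<rho> Z + (\<integral>\<omega>. \<zeta> \<omega> * ((Z - I) \<omega> - Z \<omega>) \<partial>M) \<le> \<rho> (Z - I)"
    using \<zeta> V by (simp add: Lq_subdiff_def del: minus_apply)
  also have "\<rho> (Z - I) \<le> \<rho> Z"
    using mono V Z by (auto simp: Lp_nondecreasing_def I_def)
  finally have "(\<integral>\<omega>. - (\<zeta> \<omega> * I \<omega>) \<partial>M) \<le> 0" by simp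
  moreover have nn: "0 \<le> - (\<zeta> \<omega> * I \<omega>)" for \<omega> by (auto simp: I_def)
  ultimately have "(\<integral>\<omega>. - (\<zeta> \<omega> * I \<omega>) \<partial>M) = 0"
    by (intro antisym integral_nonneg_AE AE_I2) auto
  then have "AE \<omega> in M. - (\<zeta> \<omega> * I \<omega>) = 0"
    using nn conjugate_product_integrable[OF pq \<zeta>_Lq I_Lp]
    by (subst (asm) integral_nonneg_eq_0_iff_AE) auto
  then show ?thesis by eventually_elim (auto simp: I_def split: if_splits)
qed

text \<open>
  The setting of the theorem, for an integrand that is convex and continuous for every \<open>\<omega>\<close>
  instead of almost every one.  An integrand as in the theorem agrees almost surely with such a
  one, by \<open>convex_integrand_everywhere\<close>.
\<close>
locale composite_functional = prob_space M for M :: "'a measure" +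
  fixes G :: "'a measure" and p p' q :: ennreal
    and f :: "'y::{banach, second_countable_topology} \<Rightarrow> 'a \<Rightarrow> real"
    and F :: "('a \<Rightarrow> 'y) \<Rightarrow> ('a \<Rightarrow> real)"
    and \<rho> :: "('a \<Rightarrow> real) \<Rightarrow> real"
    and x :: "'a \<Rightarrow> 'y"
  assumes subalgebra: "subalgebra M G"
    and p_ge_1: "1 \<le> p" and p_finite: "p < \<infinity>" and p_le: "p \<le> p'" and pq: "1 / p + 1 / q = 1"
    and f_convex: "\<And>\<omega>. convex_on UNIV (\<lambda>y. f y \<omega>)"
    and f_continuous: "\<And>\<omega>. continuous_on UNIV (\<lambda>y. f y \<omega>)"
    and f_measurable [measurable]: "\<And>y. f y \<in> borel_measurable M"
    and F_Lp: "\<And>h. h \<in> Lp_space (restr_to_subalg M G) p' \<Longrightarrow> F h \<in> Lp_space M p"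
    and F_eq: "\<And>h. h \<in> Lp_space (restr_to_subalg M G) p' \<Longrightarrow> AE \<omega> in M. F h \<omega> = f (h \<omega>) \<omega>"
    and x: "x \<in> Lp_space (restr_to_subalg M G) p'"
    and F_continuous: "Lp_continuous_at (restr_to_subalg M G) p' M p F x"
    and \<rho>_convex: "Lp_convex M p \<rho>"
    and \<rho>_mono: "Lp_nondecreasing M p \<rho>"
begin

abbreviation "N \<equiv> restr_to_subalg M G"
abbreviation X :: "('a \<Rightarrow> 'y) set" where "X \<equiv> Lp_space N p'"

sublocale N: prob_space N
  by (rule prob_space_restr_to_subalg[OF subalgebra prob_space_axioms])

lemma \<rho>_le: "Z \<in> Lp_space M p \<Longrightarrow> V \<in> Lp_space M p \<Longrightarrow> AE \<omega> in M. Z \<omega> \<le> V \<omega> \<Longrightarrow> \<rho> Z \<le> \<rho> V"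
  using \<rho>_mono by (simp add: Lp_nondecreasing_def)

lemma \<rho>_combination_le:
  "Z \<in> Lp_space M p \<Longrightarrow> V \<in> Lp_space M p \<Longrightarrow> 0 \<le> t \<Longrightarrow> t \<le> 1 \<Longrightarrow>
    \<rho> (\<lambda>\<omega>. (1 - t) * Z \<omega> + t * V \<omega>) \<le> (1 - t) * \<rho> Z + t * \<rho> V"
  using \<rho>_convex by (simp add: Lp_convex_def)

lemmas pq_all = p_ge_1 p_finite pq

lemma p'_ge_1: "1 \<le> p'"
  using p_ge_1 p_le by (rule order_trans)

lemma X_measurable_G: "h \<in> X \<Longrightarrow> h \<in> borel_measurable G"
  by (rule measurable_in_subalg'[OF subalgebra Lp_spaceD(1)])

lemma X_measurable: "h \<in> X \<Longrightarrow> h \<in> borel_measurable M"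
  by (rule measurable_from_subalg[OF subalgebra X_measurable_G])

lemma X_bounded: "h \<in> borel_measurable G \<Longrightarrow> (\<And>\<omega>. norm (h \<omega>) \<le> r) \<Longrightarrow> h \<in> X"
  by (rule N.Lp_space_bounded[OF measurable_in_subalg[OF subalgebra]])

lemma const_X: "(\<lambda>_. y) \<in> X"
  by (rule X_bounded[where r="norm y"]) auto

lemmas X_add = subspace_add[OF subspace_Lp_space, of _ N p']
lemmas X_diff = subspace_diff[OF subspace_Lp_space, of _ N p']
lemmas X_scale = subspace_scale[OF subspace_Lp_space, of _ N p']

lemma Lp_increment: "h \<in> X \<Longrightarrow> (\<lambda>\<omega>. F (x + h) \<omega> - F x \<omega>) \<in> Lp_space M p"
  using subspace_diff[OF subspace_Lp_space F_Lp[OF X_add[OF x]] F_Lp[OF x], of h] by (simp add: fun_diff_def)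

lemma Lp_decrement: "h \<in> X \<Longrightarrow> (\<lambda>\<omega>. F x \<omega> - F (x - h) \<omega>) \<in> Lp_space M p"
  using subspace_diff[OF subspace_Lp_space F_Lp[OF x] F_Lp[OF X_diff[OF x]], of h] by (simp add: fun_diff_def)

lemma F_increment_eq: "h \<in> X \<Longrightarrow> AE \<omega> in M. F (x + h) \<omega> - F x \<omega> = f (x \<omega> + h \<omega>) \<omega> - f (x \<omega>) \<omega>"
  using F_eq[OF X_add[OF x], of h] F_eq[OF x] by (auto elim: eventually_elim2)

lemma F_decrement_eq: "h \<in> X \<Longrightarrow> AE \<omega> in M. F x \<omega> - F (x - h) \<omega> = f (x \<omega>) \<omega> - f (x \<omega> - h \<omega>) \<omega>"
  using F_eq[OF X_diff[OF x], of h] F_eq[OF x] by (auto elim: eventually_elim2)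

section \<open>Conditional expectations as subgradients\<close>

context
  fixes \<zeta> :: "'a \<Rightarrow> real" and s :: "'a \<Rightarrow> 'y \<Rightarrow>\<^sub>L real"
  assumes \<zeta>: "\<zeta> \<in> Lq_subdiff M p q \<rho> (F x)"
    and s: "measurable_selector M (\<lambda>\<omega>. subdiff (\<lambda>y. f y \<omega>) (x \<omega>)) s"
begin

lemma \<zeta>_Lq: "\<zeta> \<in> Lp_space M q"
  using \<zeta> by (simp add: Lq_subdiff_def)

lemma \<zeta>_nonneg: "AE \<omega> in M. 0 \<le> \<zeta> \<omega>"
  by (rule Lq_subgradient_nonneg[OF \<zeta> F_Lp[OF x] \<rho>_mono pq_all])

lemma s_measurable: "weakstar_measurable M s"
  using s by (simp add: measurable_selector_def)

text \<open>
  A dual-valued \<open>s\<close> with subgradient values is controlled by increments of \<open>F\<close>, which are in \<open>L\<^sub>p\<close>;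
  this replaces bounds on the norm of \<open>s\<close>.
\<close>
lemma s_between:
  assumes h: "h \<in> X"
  shows "AE \<omega> in M. F x \<omega> - F (x - h) \<omega> \<le> blinfun_apply (s \<omega>) (h \<omega>)"
    and "AE \<omega> in M. blinfun_apply (s \<omega>) (h \<omega>) \<le> F (x + h) \<omega> - F x \<omega>"
proof -
  have "AE \<omega> in M. s \<omega> \<in> subdiff (\<lambda>y. f y \<omega>) (x \<omega>)" using s by (simp add: measurable_selector_def)
  then have sub: "AE \<omega> in M. \<forall>y. f (x \<omega>) \<omega> + blinfun_apply (s \<omega>) (y - x \<omega>) \<le> f y \<omega>"
    by (simp add: subdiff_def)
  show "AE \<omega> in M. F x \<omega> - F (x - h) \<omega> \<le> blinfun_apply (s \<omega>) (h \<omega>)"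
    using sub F_decrement_eq[OF h]
  proof eventually_elim
    case (elim \<omega>)
    show ?case using elim(1)[rule_format, of "x \<omega> - h \<omega>"] elim(2) by (simp add: blinfun.minus_right)
  qed
  show "AE \<omega> in M. blinfun_apply (s \<omega>) (h \<omega>) \<le> F (x + h) \<omega> - F x \<omega>"
    using sub F_increment_eq[OF h]
  proof eventually_elim
    case (elim \<omega>)
    show ?case using elim(1)[rule_format, of "x \<omega> + h \<omega>"] elim(2) by simp
  qed
qed

lemma pairing_integrable:
  assumes h: "h \<in> X"
  shows "integrable M (\<lambda>\<omega>. \<zeta> \<omega> * blinfun_apply (s \<omega>) (h \<omega>))"
proof (rule integrable_between)
  show "integrable M (\<lambda>\<omega>. \<zeta> \<omega> * (F x \<omega> - F (x - h) \<omega>))"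
    by (rule conjugate_product_integrable[OF pq_all \<zeta>_Lq Lp_decrement[OF h]])
  show "integrable M (\<lambda>\<omega>. \<zeta> \<omega> * (F (x + h) \<omega> - F x \<omega>))"
    by (rule conjugate_product_integrable[OF pq_all \<zeta>_Lq Lp_increment[OF h]])
  show "(\<lambda>\<omega>. \<zeta> \<omega> * blinfun_apply (s \<omega>) (h \<omega>)) \<in> borel_measurable M"
    by (intro borel_measurable_times Lp_spaceD(1)[OF \<zeta>_Lq] weakstar_measurable_apply[OF s_measurable X_measurable[OF h]])
  show "AE \<omega> in M. \<zeta> \<omega> * (F x \<omega> - F (x - h) \<omega>) \<le> \<zeta> \<omega> * blinfun_apply (s \<omega>) (h \<omega>)"
    using \<zeta>_nonneg s_between(1)[OF h] by eventually_elim (rule mult_left_mono)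
  show "AE \<omega> in M. \<zeta> \<omega> * blinfun_apply (s \<omega>) (h \<omega>) \<le> \<zeta> \<omega> * (F (x + h) \<omega> - F x \<omega>)"
    using \<zeta>_nonneg s_between(2)[OF h] by eventually_elim (rule mult_left_mono)
qed

lemma pairing_le_increment:
  assumes h: "h \<in> X"
  shows "(\<integral>\<omega>. \<zeta> \<omega> * blinfun_apply (s \<omega>) (h \<omega>) \<partial>M) \<le> (\<integral>\<omega>. \<zeta> \<omega> * (F (x + h) \<omega> - F x \<omega>) \<partial>M)"
proof (rule integral_mono_AE[OF pairing_integrable[OF h]])
  show "integrable M (\<lambda>\<omega>. \<zeta> \<omega> * (F (x + h) \<omega> - F x \<omega>))"
    by (rule conjugate_product_integrable[OF pq_all \<zeta>_Lq Lp_increment[OF h]])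
  show "AE \<omega> in M. \<zeta> \<omega> * blinfun_apply (s \<omega>) (h \<omega>) \<le> \<zeta> \<omega> * (F (x + h) \<omega> - F x \<omega>)"
    using \<zeta>_nonneg s_between(2)[OF h] by eventually_elim (rule mult_left_mono)
qed

text \<open>
  Near \<open>0\<close> the pairing is at most the integral of \<open>\<zeta> (F (x + h) - F x)\<close>, where continuity of \<open>F\<close> at \<open>x\<close>
  keeps \<open>F (x + h) - F x\<close> in the unit ball of \<open>L\<^sub>p\<close>; the general bound follows by homogeneity.
\<close>
lemma pairing_bounded:
  obtains C where "0 \<le> C"
    "\<And>h. h \<in> X \<Longrightarrow> (\<integral>\<omega>. \<zeta> \<omega> * blinfun_apply (s \<omega>) (h \<omega>) \<partial>M) \<le> C * Lp_norm N p' h"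
proof -
  obtain B where B: "0 \<le> B" "\<And>V. V \<in> Lp_space M p \<Longrightarrow> Lp_norm M p V < 1 \<Longrightarrow> (\<integral>\<omega>. \<zeta> \<omega> * V \<omega> \<partial>M) \<le> B"
    using conjugate_product_unit_ball_bound[OF pq_all \<zeta>_Lq] by blast
  obtain \<delta> where \<delta>: "0 < \<delta>" "\<And>h. h \<in> X \<Longrightarrow> Lp_norm N p' (\<lambda>\<omega>. h \<omega> - x \<omega>) < \<delta> \<Longrightarrow>
      Lp_norm M p (\<lambda>\<omega>. F h \<omega> - F x \<omega>) < 1"
    using F_continuous zero_less_one unfolding Lp_continuous_at_def by metis
  define I where "I h = (\<integral>\<omega>. \<zeta> \<omega> * blinfun_apply (s \<omega>) (h \<omega>) \<partial>M)" for h
  have near: "I h \<le> B" if h: "h \<in> X" "Lp_norm N p' h < \<delta>" for h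
  proof -
    have "Lp_norm M p (\<lambda>\<omega>. F (x + h) \<omega> - F x \<omega>) < 1"
      by (rule \<delta>(2)[OF X_add[OF x h(1)]]) (use h(2) in simp)
    then have "(\<integral>\<omega>. \<zeta> \<omega> * (F (x + h) \<omega> - F x \<omega>) \<partial>M) \<le> B"
      by (rule B(2)[OF Lp_increment[OF h(1)]])
    with pairing_le_increment[OF h(1)] show ?thesis by (simp add: I_def)
  qed
  have scale: "I (\<lambda>\<omega>. t *\<^sub>R h \<omega>) = t * I h" for t h
    by (simp add: I_def blinfun.scaleR_right mult.left_commute)
  have "I h \<le> 2 * B / \<delta> * Lp_norm N p' h" if h: "h \<in> X" for h
  proof -
    let ?n = "Lp_norm N p' h"
    have th: "(\<lambda>\<omega>. t *\<^sub>R h \<omega>) \<in> X" for t using X_scale[OF h, of t] by (simp add: scaleR_fun_def)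
    have n: "0 \<le> ?n" by (rule N.Lp_norm_ge_0[OF Lp_spaceD(1)[OF h]])
    have near': "t * I h \<le> B" if t: "0 \<le> t" "t * ?n < \<delta>" for t
      using near[OF th, of t] N.Lp_norm_scale[OF t(1) p'_ge_1, of h] t(2) by (simp add: scale)
    show ?thesis
    proof (cases "?n = 0")
      case True
\<comment> \<open>The pairing is bounded along all multiples of a null element, so it cannot be positive there.\<close>
      have "I h \<le> 0"
      proof (rule ccontr)
        assume "\<not> I h \<le> 0"
        then have "(B + 1) / I h * I h \<le> B"
          using B(1) \<delta>(1) True by (intro near') auto
        with \<open>\<not> I h \<le> 0\<close> show False by simp
      qed
      then show ?thesis using True by simp
    next
      case False
      with n have n: "0 < ?n" by simp
      have "\<delta> / (2 * ?n) * I h \<le> B"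
        using n \<delta>(1) by (intro near') auto
      then show ?thesis using n \<delta>(1) by (simp add: field_simps)
    qed
  qed
  then show thesis using B(1) \<delta>(1) by (intro that[of "2 * B / \<delta>"]) (auto simp: I_def)
qed

lemma Lp_functional_dual_cond_exp:
  assumes h: "h \<in> X"
  shows "Lp_functional N p' (dual_cond_exp M G (\<lambda>\<omega>. \<zeta> \<omega> *\<^sub>R s \<omega>)) h =
    (\<integral>\<omega>. \<zeta> \<omega> * blinfun_apply (s \<omega>) (h \<omega>) \<partial>M)"
proof -
  obtain C where C: "0 \<le> C"
    "\<And>h. h \<in> X \<Longrightarrow> (\<integral>\<omega>. \<zeta> \<omega> * blinfun_apply (s \<omega>) (h \<omega>) \<partial>M) \<le> C * Lp_norm N p' h"
    using pairing_bounded by blast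
  interpret u: weakly_bounded_dual_function M G "\<lambda>\<omega>. \<zeta> \<omega> *\<^sub>R s \<omega>" C
  proof
    show "subalgebra M G" by (rule subalgebra)
    show "weakstar_measurable M (\<lambda>\<omega>. \<zeta> \<omega> *\<^sub>R s \<omega>)"
      using s_measurable Lp_spaceD(1)[OF \<zeta>_Lq] by (auto simp: weakstar_measurable_def blinfun.scaleR_left intro: borel_measurable_times)
    fix h :: "'a \<Rightarrow> 'y" and r
    assume h: "h \<in> borel_measurable G" "\<And>\<omega>. norm (h \<omega>) \<le> r"
    have hX: "h \<in> X" using h by (rule X_bounded)
    show "integrable M (\<lambda>\<omega>. blinfun_apply (\<zeta> \<omega> *\<^sub>R s \<omega>) (h \<omega>))"
      using pairing_integrable[OF hX] by (simp add: blinfun.scaleR_left)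
    have "(\<integral>\<omega>. \<zeta> \<omega> * blinfun_apply (s \<omega>) (h \<omega>) \<partial>M) \<le> C * Lp_norm N p' h" by (rule C(2)[OF hX])
    also have "\<dots> \<le> C * r"
      by (intro mult_left_mono C N.Lp_norm_le_bound[OF p'_ge_1 Lp_spaceD(1)[OF hX] h(2)])
    finally show "(\<integral>\<omega>. blinfun_apply (\<zeta> \<omega> *\<^sub>R s \<omega>) (h \<omega>) \<partial>M) \<le> C * r"
      by (simp add: blinfun.scaleR_left)
  qed
  let ?e = "dual_cond_exp M G (\<lambda>\<omega>. \<zeta> \<omega> *\<^sub>R s \<omega>)"
  have hG: "h \<in> borel_measurable G" by (rule X_measurable_G[OF h])
  have "Lp_functional N p' ?e h = (\<integral>\<omega>. blinfun_apply (?e \<omega>) (h \<omega>) \<partial>N)"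
    using h by (simp add: Lp_functional_def)
  also have "\<dots> = (\<integral>\<omega>. blinfun_apply (?e \<omega>) (h \<omega>) \<partial>M)"
    by (rule integral_subalgebra2[OF subalgebra u.dce_measurable[OF u.dual_cond_exp_exists hG]])
  also have "\<dots> = (\<integral>\<omega>. blinfun_apply (\<zeta> \<omega> *\<^sub>R s \<omega>) (h \<omega>) \<partial>M)"
    by (rule u.dce_integral(2)[OF u.dual_cond_exp_exists hG])
      (use pairing_integrable[OF h] in \<open>simp add: blinfun.scaleR_left\<close>)
  finally show ?thesis by (simp add: blinfun.scaleR_left)
qed

lemma dual_cond_exp_in_subdiff:
  "Lp_functional N p' (dual_cond_exp M G (\<lambda>\<omega>. \<zeta> \<omega> *\<^sub>R s \<omega>)) \<in> Lp_subdiff N p' (\<rho> \<circ> F) x"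
proof -
  let ?L = "Lp_functional N p' (dual_cond_exp M G (\<lambda>\<omega>. \<zeta> \<omega> *\<^sub>R s \<omega>))"
  let ?I = "\<lambda>h. \<integral>\<omega>. \<zeta> \<omega> * blinfun_apply (s \<omega>) (h \<omega>) \<partial>M"
  have lin: "?L (\<lambda>\<omega>. a *\<^sub>R h \<omega> + b *\<^sub>R k \<omega>) = a * ?L h + b * ?L k" if hk: "h \<in> X" "k \<in> X" for h k a b
  proof -
    have "a *\<^sub>R h + b *\<^sub>R k \<in> X" by (intro X_add X_scale hk)
    then have mem: "(\<lambda>\<omega>. a *\<^sub>R h \<omega> + b *\<^sub>R k \<omega>) \<in> X" by (simp add: plus_fun_def scaleR_fun_def)
    have "?I (\<lambda>\<omega>. a *\<^sub>R h \<omega> + b *\<^sub>R k \<omega>) =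
        (\<integral>\<omega>. a * (\<zeta> \<omega> * blinfun_apply (s \<omega>) (h \<omega>)) + b * (\<zeta> \<omega> * blinfun_apply (s \<omega>) (k \<omega>)) \<partial>M)"
      by (simp add: blinfun.add_right blinfun.scaleR_right algebra_simps)
    also have "\<dots> = a * ?I h + b * ?I k"
      using pairing_integrable[OF hk(1)] pairing_integrable[OF hk(2)] by simp
    finally show ?thesis by (simp add: Lp_functional_dual_cond_exp mem hk)
  qed
  obtain C where C: "0 \<le> C" "\<And>h. h \<in> X \<Longrightarrow> ?I h \<le> C * Lp_norm N p' h"
    using pairing_bounded by blast
  have bound: "\<bar>?L h\<bar> \<le> C * Lp_norm N p' h" if h: "h \<in> X" for h
  proof -
    have "- h \<in> X" by (rule subspace_neg[OF subspace_Lp_space h])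
    then have mh: "(\<lambda>\<omega>. - h \<omega>) \<in> X" by (simp add: fun_Compl_def)
    have "Lp_norm N p' (\<lambda>\<omega>. - h \<omega>) = Lp_norm N p' h" by (simp add: Lp_norm_def)
    then show ?thesis
      using C(2)[OF h] C(2)[OF mh] by (simp add: Lp_functional_dual_cond_exp h abs_le_iff blinfun.minus_right)
  qed
  have sub: "(\<rho> \<circ> F) x + ?L (\<lambda>\<omega>. h \<omega> - x \<omega>) \<le> (\<rho> \<circ> F) h" if h: "h \<in> X" for h
  proof -
    have hx: "h - x \<in> X" by (rule X_diff[OF h x])
    have "?I (h - x) \<le> (\<integral>\<omega>. \<zeta> \<omega> * (F h \<omega> - F x \<omega>) \<partial>M)"
      using pairing_le_increment[OF hx] by simp
    moreover have "\<rho> (F x) + (\<integral>\<omega>. \<zeta> \<omega> * (F h \<omega> - F x \<omega>) \<partial>M) \<le> \<rho> (F h)"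
      using \<zeta> F_Lp[OF h] by (simp add: Lq_subdiff_def)
    ultimately show ?thesis
      using Lp_functional_dual_cond_exp[OF hx] by (simp add: fun_diff_def)
  qed
  have "?L \<in> extensional X" by (simp add: Lp_functional_def)
  then show ?thesis unfolding Lp_subdiff_def Lp_dual_def using lin bound sub by blast
qed

end

section \<open>Representation of subgradients\<close>

text \<open>
  The multiplier is the linear functional that \<open>convex_sandwich\<close> places below
  \<open>\<rho> (V + F (x + h)) - \<rho> (F x) - l h\<close>.  The subspace \<open>L\<close> is a parameter, so that \<open>L = {0}\<close> yields a
  subgradient of \<open>\<rho>\<close>.
\<close>
lemma multiplier_exists:
  assumes L: "subspace L" "L \<subseteq> X"
    and lin: "\<And>h k a b. h \<in> L \<Longrightarrow> k \<in> L \<Longrightarrow> l (a *\<^sub>R h + b *\<^sub>R k) = a * l h + b * l k"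
    and sub: "\<And>h. h \<in> L \<Longrightarrow> \<rho> (F x) + l h \<le> \<rho> (F (x + h))"
  obtains \<zeta> where "\<zeta> \<in> Lq_subdiff M p q \<rho> (F x)" "\<And>\<omega>. 0 \<le> \<zeta> \<omega>"
    "\<And>h. h \<in> L \<Longrightarrow> l h \<le> (\<integral>\<omega>. \<zeta> \<omega> * (F (x + h) \<omega> - F x \<omega>) \<partial>M)"
proof -
  have l0: "l 0 = 0" using lin[of 0 0 0 0] subspace_0[OF L(1)] by simp
  have LX: "h \<in> X" if "h \<in> L" for h using that L(2) by blast
  obtain z where z: "linear z"
    "\<And>V h. V \<in> Lp_space M p \<Longrightarrow> h \<in> L \<Longrightarrow> z V \<le> \<rho> (V + F (x + h)) - \<rho> (F x) - l h"
  proof (rule convex_sandwich[OF subspace_Lp_space L(1), of M p "\<lambda>V h. \<rho> (V + F (x + h)) - \<rho> (F x) - l h"])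
    fix V V' :: "'a \<Rightarrow> real" and h h' and t :: real
    assume V: "V \<in> Lp_space M p" "V' \<in> Lp_space M p" and h: "h \<in> L" "h' \<in> L" and t: "0 < t" "t < 1"
    define k where "k = (1 - t) *\<^sub>R h + t *\<^sub>R h'"
    have k: "k \<in> L" unfolding k_def using h by (intro subspace_add[OF L(1)] subspace_scale[OF L(1)])
    have xh: "x + h \<in> X" "x + h' \<in> X" "x + k \<in> X" using h k by (auto intro: X_add[OF x LX])
    define Z where "Z = V + F (x + h)"
    define Z' where "Z' = V' + F (x + h')"
    have Z: "Z \<in> Lp_space M p" "Z' \<in> Lp_space M p"
      unfolding Z_def Z'_def by (intro subspace_add[OF subspace_Lp_space] V F_Lp xh)+
    have mix: "(\<lambda>\<omega>. (1 - t) * Z \<omega> + t * Z' \<omega>) \<in> Lp_space M p"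
      using subspace_add[OF subspace_Lp_space subspace_scale[OF subspace_Lp_space Z(1), of "1 - t"]
          subspace_scale[OF subspace_Lp_space Z(2), of t]] by (simp add: plus_fun_def scaleR_fun_def)
    have lhs: "(1 - t) *\<^sub>R V + t *\<^sub>R V' + F (x + k) \<in> Lp_space M p"
      by (intro subspace_add[OF subspace_Lp_space] subspace_scale[OF subspace_Lp_space] V F_Lp xh)
    have "AE \<omega> in M. F (x + k) \<omega> \<le> (1 - t) * F (x + h) \<omega> + t * F (x + h') \<omega>"
      using F_eq[OF xh(1)] F_eq[OF xh(2)] F_eq[OF xh(3)]
    proof eventually_elim
      case (elim \<omega>)
      have "x \<omega> + k \<omega> = (1 - t) *\<^sub>R (x \<omega> + h \<omega>) + t *\<^sub>R (x \<omega> + h' \<omega>)"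
        by (simp add: k_def algebra_simps)
      then show ?case
        using convex_combD[OF f_convex[of \<omega>], of t "x \<omega> + h \<omega>" "x \<omega> + h' \<omega>"] t elim by simp
    qed
    then have "AE \<omega> in M. ((1 - t) *\<^sub>R V + t *\<^sub>R V' + F (x + k)) \<omega> \<le> (1 - t) * Z \<omega> + t * Z' \<omega>"
      by eventually_elim (simp add: Z_def Z'_def algebra_simps)
    then have "\<rho> ((1 - t) *\<^sub>R V + t *\<^sub>R V' + F (x + k)) \<le> \<rho> (\<lambda>\<omega>. (1 - t) * Z \<omega> + t * Z' \<omega>)"
      by (rule \<rho>_le[OF lhs mix])
    also have "\<dots> \<le> (1 - t) * \<rho> Z + t * \<rho> Z'"
      using t by (intro \<rho>_combination_le Z) auto
    finally show "\<rho> ((1 - t) *\<^sub>R V + t *\<^sub>R V' + F (x + ((1 - t) *\<^sub>R h + t *\<^sub>R h'))) - \<rho> (F x) - l ((1 - t) *\<^sub>R h + t *\<^sub>R h')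
        \<le> (1 - t) * (\<rho> (V + F (x + h)) - \<rho> (F x) - l h) + t * (\<rho> (V' + F (x + h')) - \<rho> (F x) - l h')"
      using lin[OF h, of "1 - t" t] by (simp add: k_def Z_def Z'_def algebra_simps)
  next
    show "0 \<le> \<rho> (0 + F (x + h)) - \<rho> (F x) - l h" if "h \<in> L" for h using sub[OF that] by simp
  qed blast
  have z0: "z V \<le> \<rho> (V + F x) - \<rho> (F x)" if "V \<in> Lp_space M p" for V
    using z(2)[OF that subspace_0[OF L(1)]] l0 by simp
  interpret z: positive_Lp_functional M p z
  proof
    fix V :: "'a \<Rightarrow> real" assume V: "V \<in> Lp_space M p" "AE \<omega> in M. V \<omega> \<le> 0"
    have "V + F x \<in> Lp_space M p" by (rule subspace_add[OF subspace_Lp_space V(1) F_Lp[OF x]])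
    moreover have "AE \<omega> in M. (V + F x) \<omega> \<le> F x \<omega>" using V(2) by eventually_elim simp
    ultimately have "\<rho> (V + F x) \<le> \<rho> (F x)"
      by (intro \<rho>_le F_Lp x)
    then show "z V \<le> 0" using z0[OF V(1)] by simp
  qed (rule p_ge_1 p_finite linear_add[OF z(1)] linear_scale[OF z(1)])+
  obtain \<zeta> where \<zeta>: "\<zeta> \<in> Lp_space M q" "\<And>\<omega>. 0 \<le> \<zeta> \<omega>"
    "\<And>V. V \<in> Lp_space M p \<Longrightarrow> z V = (\<integral>\<omega>. \<zeta> \<omega> * V \<omega> \<partial>M)"
    using z.representation_by_conjugate_space[OF pq] by blast
  show thesis
  proof (rule that[OF _ \<zeta>(2)])
    have "\<rho> (F x) + (\<integral>\<omega>. \<zeta> \<omega> * (V \<omega> - F x \<omega>) \<partial>M) \<le> \<rho> V" if V: "V \<in> Lp_space M p" for V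
    proof -
      have d: "V - F x \<in> Lp_space M p" by (rule subspace_diff[OF subspace_Lp_space V F_Lp[OF x]])
      show ?thesis using z0[OF d] \<zeta>(3)[OF d] by simp
    qed
    then show "\<zeta> \<in> Lq_subdiff M p q \<rho> (F x)" using \<zeta>(1) by (simp add: Lq_subdiff_def)
    show "l h \<le> (\<integral>\<omega>. \<zeta> \<omega> * (F (x + h) \<omega> - F x \<omega>) \<partial>M)" if h: "h \<in> L" for h
    proof -
      have xh: "x + h \<in> X" by (rule X_add[OF x LX[OF h]])
      have d: "F x - F (x + h) \<in> Lp_space M p" by (intro subspace_diff[OF subspace_Lp_space] F_Lp x xh)
      have "z (F x - F (x + h)) \<le> - l h" using z(2)[OF d h] by simp
      moreover have "z (F x - F (x + h)) = - z (F (x + h) - F x)" using linear_neg[OF z(1), of "F (x + h) - F x"] by simp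
      moreover have "z (F (x + h) - F x) = (\<integral>\<omega>. \<zeta> \<omega> * (F (x + h) \<omega> - F x \<omega>) \<partial>M)"
        using \<zeta>(3)[OF subspace_diff[OF subspace_Lp_space F_Lp[OF xh] F_Lp[OF x]]] by simp
      ultimately show ?thesis by simp
    qed
  qed
qed

definition slope :: "'y \<Rightarrow> 'a \<Rightarrow> real" where
  "slope y \<omega> = dir_deriv (\<lambda>z. f z \<omega>) (x \<omega>) y"

lemma f_apply_measurable [measurable]:
  "h \<in> borel_measurable M \<Longrightarrow> (\<lambda>\<omega>. f (h \<omega>) \<omega>) \<in> borel_measurable M"
  by (rule measurable_caratheodory[OF f_continuous f_measurable])

lemma slope_measurable [measurable]: "slope y \<in> borel_measurable M"
proof (rule borel_measurable_LIMSEQ_real)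
  note [measurable] = X_measurable[OF x]
  show "(\<lambda>n. (f (x \<omega> + inverse (real (Suc n)) *\<^sub>R y) \<omega> - f (x \<omega>) \<omega>) / inverse (real (Suc n))) \<longlonglongrightarrow> slope y \<omega>" for \<omega>
    unfolding slope_def by (rule dir_deriv_LIMSEQ[OF f_convex])
  show "(\<lambda>\<omega>. (f (x \<omega> + inverse (real (Suc n)) *\<^sub>R y) \<omega> - f (x \<omega>) \<omega>) / inverse (real (Suc n))) \<in> borel_measurable M" for n
    by measurable
qed

lemma slope_sublinear: "sublinear (\<lambda>y. slope y \<omega>)"
  using sublinear_dir_deriv[OF f_convex, of \<omega> "x \<omega>"] by (simp add: slope_def[abs_def])

lemma slope_bounded: "\<exists>K. \<forall>y. slope y \<omega> \<le> K * norm y"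
proof -
  have "isCont (\<lambda>y. f y \<omega>) (x \<omega>)" using f_continuous by (simp add: continuous_on_eq_continuous_at)
  from dir_deriv_bound[OF f_convex this] show ?thesis unfolding slope_def by metis
qed

lemma slope_apply_measurable: "h \<in> borel_measurable M \<Longrightarrow> (\<lambda>\<omega>. slope (h \<omega>) \<omega>) \<in> borel_measurable M"
proof (rule measurable_caratheodory[OF _ slope_measurable])
  show "continuous_on UNIV (\<lambda>y. slope y \<omega>)" for \<omega>
    using slope_bounded[of \<omega>] by (auto intro: sublinear_continuous[OF slope_sublinear])
qed

lemma slope_between:
  assumes h: "h \<in> X"
  shows "AE \<omega> in M. F x \<omega> - F (x - h) \<omega> \<le> slope (h \<omega>) \<omega>" "AE \<omega> in M. slope (h \<omega>) \<omega> \<le> F (x + h) \<omega> - F x \<omega>"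
proof -
  show "AE \<omega> in M. F x \<omega> - F (x - h) \<omega> \<le> slope (h \<omega>) \<omega>"
    using F_decrement_eq[OF h] by eventually_elim (simp add: slope_def dir_deriv_lower[OF f_convex])
  show "AE \<omega> in M. slope (h \<omega>) \<omega> \<le> F (x + h) \<omega> - F x \<omega>"
    using F_increment_eq[OF h] by eventually_elim (simp add: slope_def dir_deriv_upper[OF f_convex])
qed

context
  fixes w :: "'a \<Rightarrow> real"
  assumes w: "w \<in> Lp_space M q" and w_nonneg: "\<And>\<omega>. 0 \<le> w \<omega>"
begin

lemma weighted_slope_integrable:
  assumes h: "h \<in> X"
  shows "integrable M (\<lambda>\<omega>. w \<omega> * slope (h \<omega>) \<omega>)"
proof (rule integrable_between)
  show "integrable M (\<lambda>\<omega>. w \<omega> * (F x \<omega> - F (x - h) \<omega>))"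
    by (rule conjugate_product_integrable[OF pq_all w Lp_decrement[OF h]])
  show "integrable M (\<lambda>\<omega>. w \<omega> * (F (x + h) \<omega> - F x \<omega>))"
    by (rule conjugate_product_integrable[OF pq_all w Lp_increment[OF h]])
  show "(\<lambda>\<omega>. w \<omega> * slope (h \<omega>) \<omega>) \<in> borel_measurable M"
    by (intro borel_measurable_times Lp_spaceD(1)[OF w] slope_apply_measurable X_measurable h)
  show "AE \<omega> in M. w \<omega> * (F x \<omega> - F (x - h) \<omega>) \<le> w \<omega> * slope (h \<omega>) \<omega>"
    using slope_between(1)[OF h] by eventually_elim (intro mult_left_mono w_nonneg)
  show "AE \<omega> in M. w \<omega> * slope (h \<omega>) \<omega> \<le> w \<omega> * (F (x + h) \<omega> - F x \<omega>)"
    using slope_between(2)[OF h] by eventually_elim (intro mult_left_mono w_nonneg)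
qed

text \<open>
  The theorem of Strassen's type for the directional derivative with weight \<open>w\<close>; the functions
  in \<open>X\<close> belong to the domain of the integral functional by \<open>weighted_slope_integrable\<close>.
\<close>
lemma weighted_selection:
  assumes L: "subspace L" "L \<subseteq> X"
    and lin: "\<And>h k a b. h \<in> L \<Longrightarrow> k \<in> L \<Longrightarrow> l (a *\<^sub>R h + b *\<^sub>R k) = a * l h + b * l k"
    and le: "\<And>h. h \<in> L \<Longrightarrow> l h \<le> (\<integral>\<omega>. w \<omega> * slope (h \<omega>) \<omega> \<partial>M)"
  obtains v :: "'a \<Rightarrow> 'y \<Rightarrow>\<^sub>L real"
  where "weakstar_measurable M v" "AE \<omega> in M. \<forall>y. blinfun_apply (v \<omega>) y \<le> w \<omega> * slope y \<omega>"
    "\<And>h. h \<in> L \<Longrightarrow> l h = (\<integral>\<omega>. blinfun_apply (v \<omega>) (h \<omega>) \<partial>M)"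
proof -
  interpret g: sublinear_integrand M "\<lambda>y \<omega>. w \<omega> * slope y \<omega>"
  proof
    show "(\<lambda>\<omega>. w \<omega> * slope y \<omega>) \<in> borel_measurable M" for y
      by (intro borel_measurable_times Lp_spaceD(1)[OF w] slope_measurable)
    show "sublinear (\<lambda>y. w \<omega> * slope y \<omega>)" for \<omega>
      using slope_sublinear[of \<omega>] mult_left_mono[OF _ w_nonneg[of \<omega>]] unfolding sublinear_def
      by (auto simp: mult.left_commute simp flip: distrib_left)
    show "\<exists>K. \<forall>y. w \<omega> * slope y \<omega> \<le> K * norm y" for \<omega>
    proof -
      obtain K where "\<And>y. slope y \<omega> \<le> K * norm y" using slope_bounded by blast
      then have "w \<omega> * slope y \<omega> \<le> (w \<omega> * K) * norm y" for y
        using mult_left_mono[OF _ w_nonneg] by (fastforce simp: mult.assoc)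
      then show ?thesis by blast
    qed
    show "integrable M (\<lambda>\<omega>. w \<omega> * slope y \<omega>)" for y
      using weighted_slope_integrable[OF const_X] .
  qed
  have X_dom: "X \<subseteq> g.dom"
  proof
    fix h :: "'a \<Rightarrow> 'y" assume h: "h \<in> X"
    have "- h \<in> X" by (rule subspace_neg[OF subspace_Lp_space h])
    from weighted_slope_integrable[OF h] weighted_slope_integrable[OF this] X_measurable[OF h]
    show "h \<in> g.dom" by (simp add: g.dom_def)
  qed
  obtain z where z: "linear z" "\<And>h. h \<in> g.dom \<Longrightarrow> z h \<le> g.total h" "\<And>h. h \<in> L \<Longrightarrow> z h = l h"
  proof (rule g.linear_minorant_extending[OF L(1), where l=l])
    show "L \<subseteq> g.dom" using L(2) X_dom by blast
    show "l (a *\<^sub>R h + b *\<^sub>R k) = a * l h + b * l k" if "h \<in> L" "k \<in> L" for h k a b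
      using that by (rule lin)
    show "l h \<le> g.total h" if "h \<in> L" for h using le[OF that] by (simp add: g.total_def)
  qed blast
  obtain v :: "'a \<Rightarrow> 'y \<Rightarrow>\<^sub>L real"
    where v: "weakstar_measurable M v" "AE \<omega> in M. \<forall>y. blinfun_apply (v \<omega>) y \<le> w \<omega> * slope y \<omega>"
      "\<And>h. h \<in> g.dom \<Longrightarrow> integrable M (\<lambda>\<omega>. blinfun_apply (v \<omega>) (h \<omega>)) \<and> z h = (\<integral>\<omega>. blinfun_apply (v \<omega>) (h \<omega>) \<partial>M)"
  proof (rule g.selection_of_linear_minorant[OF z(1)])
    show "z h \<le> g.total h" if "h \<in> g.dom" for h using that by (rule z(2))
  qed blast
  show thesis
  proof (rule that[OF v(1,2)])
    show "l h = (\<integral>\<omega>. blinfun_apply (v \<omega>) (h \<omega>) \<partial>M)" if "h \<in> L" for h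
      using v(3)[of h] z(3)[OF that] that L(2) X_dom by auto
  qed
qed

text \<open>
  Apply the assumption to \<open>t h\<close> and divide by \<open>t\<close>.  By convexity the difference quotients lie between
  the increments of \<open>F\<close> in the directions \<open>- h\<close> and \<open>h\<close>, so they converge under the integral as \<open>t\<close> tends to \<open>0\<close>.
\<close>
lemma le_weighted_directional_derivative:
  assumes scale: "\<And>c. l (c *\<^sub>R h) = c * l h"
    and le: "\<And>k. k \<in> X \<Longrightarrow> l k \<le> (\<integral>\<omega>. w \<omega> * (F (x + k) \<omega> - F x \<omega>) \<partial>M)" and h: "h \<in> X"
  shows "l h \<le> (\<integral>\<omega>. w \<omega> * slope (h \<omega>) \<omega> \<partial>M)"
proof -
  define t where "t n = inverse (real (Suc n))" for n
  have t: "0 < t n" "t n \<le> 1" for n by (auto simp: t_def field_simps)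
  define Q where "Q n \<omega> = (f (x \<omega> + t n *\<^sub>R h \<omega>) \<omega> - f (x \<omega>) \<omega>) / t n" for n \<omega>
  note [measurable] = X_measurable[OF x] X_measurable[OF h] Lp_spaceD(1)[OF w]
  have "(\<lambda>n. \<integral>\<omega>. w \<omega> * Q n \<omega> \<partial>M) \<longlonglongrightarrow> (\<integral>\<omega>. w \<omega> * slope (h \<omega>) \<omega> \<partial>M)"
  proof (rule integral_dominated_convergence)
    show "integrable M (\<lambda>\<omega>. \<bar>w \<omega> * (F x \<omega> - F (x - h) \<omega>)\<bar> + \<bar>w \<omega> * (F (x + h) \<omega> - F x \<omega>)\<bar>)"
      by (intro Bochner_Integration.integrable_add integrable_abs conjugate_product_integrable[OF pq_all w] Lp_increment Lp_decrement h)
    show "(\<lambda>\<omega>. w \<omega> * Q n \<omega>) \<in> borel_measurable M" for n unfolding Q_def by measurable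
    show "(\<lambda>\<omega>. w \<omega> * slope (h \<omega>) \<omega>) \<in> borel_measurable M"
      using weighted_slope_integrable[OF h] by simp
    show "AE \<omega> in M. (\<lambda>n. w \<omega> * Q n \<omega>) \<longlonglongrightarrow> w \<omega> * slope (h \<omega>) \<omega>"
      unfolding Q_def t_def slope_def by (intro AE_I2 tendsto_mult tendsto_const dir_deriv_LIMSEQ[OF f_convex])
    show "AE \<omega> in M. norm (w \<omega> * Q n \<omega>) \<le> \<bar>w \<omega> * (F x \<omega> - F (x - h) \<omega>)\<bar> + \<bar>w \<omega> * (F (x + h) \<omega> - F x \<omega>)\<bar>" for n
      using F_increment_eq[OF h] F_decrement_eq[OF h]
    proof eventually_elim
      case (elim \<omega>)
      have "f (x \<omega>) \<omega> - f (x \<omega> - h \<omega>) \<omega> \<le> Q n \<omega>"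
        unfolding Q_def by (rule difference_quotient_lower[OF f_convex t(1)])
      moreover have "Q n \<omega> \<le> f (x \<omega> + h \<omega>) \<omega> - f (x \<omega>) \<omega>"
        using difference_quotient_mono[OF f_convex[of \<omega>] t(1)[of n] t(2)[of n], of "x \<omega>" "h \<omega>"] by (simp add: Q_def)
      ultimately have "w \<omega> * (F x \<omega> - F (x - h) \<omega>) \<le> w \<omega> * Q n \<omega>" "w \<omega> * Q n \<omega> \<le> w \<omega> * (F (x + h) \<omega> - F x \<omega>)"
        unfolding elim by (intro mult_left_mono w_nonneg; simp)+
      then show ?case unfolding real_norm_def by linarith
    qed
  qed
  moreover have "l h \<le> (\<integral>\<omega>. w \<omega> * Q n \<omega> \<partial>M)" for n
  proof -
    have th: "t n *\<^sub>R h \<in> X" by (rule X_scale[OF h])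
    have "(\<integral>\<omega>. w \<omega> * (F (x + t n *\<^sub>R h) \<omega> - F x \<omega>) \<partial>M) = (\<integral>\<omega>. t n * (w \<omega> * Q n \<omega>) \<partial>M)"
    proof (rule integral_cong_AE)
      show "(\<lambda>\<omega>. w \<omega> * (F (x + t n *\<^sub>R h) \<omega> - F x \<omega>)) \<in> borel_measurable M"
        using conjugate_product_integrable[OF pq_all w Lp_increment[OF th]] by simp
      show "(\<lambda>\<omega>. t n * (w \<omega> * Q n \<omega>)) \<in> borel_measurable M" unfolding Q_def by measurable
      show "AE \<omega> in M. w \<omega> * (F (x + t n *\<^sub>R h) \<omega> - F x \<omega>) = t n * (w \<omega> * Q n \<omega>)"
        using F_increment_eq[OF th] by eventually_elim (use t(1)[of n] in \<open>simp add: Q_def\<close>)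
    qed
    then have "t n * l h \<le> t n * (\<integral>\<omega>. w \<omega> * Q n \<omega> \<partial>M)"
      using le[OF th] scale[of "t n"] by simp
    then show ?thesis using t(1)[of n] by simp
  qed
  ultimately show ?thesis by (intro LIMSEQ_le_const) auto
qed

end

lemma measurable_selector_exists:
  obtains s where "measurable_selector M (\<lambda>\<omega>. subdiff (\<lambda>y. f y \<omega>) (x \<omega>)) s"
proof -
  have one: "(\<lambda>_. 1 :: real) \<in> Lp_space M q" by (rule Lp_space_bounded[where r=1]) auto
  obtain s :: "'a \<Rightarrow> 'y \<Rightarrow>\<^sub>L real"
    where s: "weakstar_measurable M s" "AE \<omega> in M. \<forall>y. blinfun_apply (s \<omega>) y \<le> 1 * slope y \<omega>"
  proof (rule weighted_selection[OF one _ subspace_single_0, where l="\<lambda>_. 0"])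
    show "{0} \<subseteq> X" using subspace_0[OF subspace_Lp_space, of N p'] by simp
    show "(0::real) \<le> (\<integral>\<omega>. 1 * slope (h \<omega>) \<omega> \<partial>M)" if "h \<in> {0}" for h
      using that sublinear_0[OF slope_sublinear] by simp
  qed auto
  have "AE \<omega> in M. s \<omega> \<in> subdiff (\<lambda>y. f y \<omega>) (x \<omega>)"
    using s(2) by eventually_elim (auto intro: subdiffI[OF f_convex] simp: slope_def)
  with s(1) show thesis by (intro that) (simp add: measurable_selector_def)
qed

lemma \<rho>_subgradient_exists:
  obtains \<zeta> where "\<zeta> \<in> Lq_subdiff M p q \<rho> (F x)"
proof (rule multiplier_exists[OF subspace_single_0, where l="\<lambda>_. 0"])
  show "{0} \<subseteq> X" using subspace_0[OF subspace_Lp_space, of N p'] by simp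
qed (use that in auto)

lemma subgradient_representation:
  assumes l: "l \<in> Lp_subdiff N p' (\<rho> \<circ> F) x"
  obtains \<zeta> s where "\<zeta> \<in> Lq_subdiff M p q \<rho> (F x)"
    "measurable_selector M (\<lambda>\<omega>. subdiff (\<lambda>y. f y \<omega>) (x \<omega>)) s"
    "l = Lp_functional N p' (dual_cond_exp M G (\<lambda>\<omega>. \<zeta> \<omega> *\<^sub>R s \<omega>))"
proof -
  have X: "subspace X" by (rule subspace_Lp_space)
  have lin: "l (a *\<^sub>R h + b *\<^sub>R k) = a * l h + b * l k" if "h \<in> X" "k \<in> X" for h k a b
    using l that by (simp add: Lp_subdiff_def Lp_dual_def plus_fun_def scaleR_fun_def)
  have sub: "\<rho> (F x) + l h \<le> \<rho> (F (x + h))" if h: "h \<in> X" for h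
  proof -
    have "\<forall>h\<in>X. \<rho> (F x) + l (\<lambda>\<omega>. h \<omega> - x \<omega>) \<le> \<rho> (F h)" using l by (simp add: Lp_subdiff_def)
    from bspec[OF this X_add[OF x h]] show ?thesis by simp
  qed
  obtain \<zeta> where \<zeta>: "\<zeta> \<in> Lq_subdiff M p q \<rho> (F x)" "\<And>\<omega>. 0 \<le> \<zeta> \<omega>"
    "\<And>h. h \<in> X \<Longrightarrow> l h \<le> (\<integral>\<omega>. \<zeta> \<omega> * (F (x + h) \<omega> - F x \<omega>) \<partial>M)"
  proof (rule multiplier_exists[OF X subset_refl, where l=l])
    show "l (a *\<^sub>R h + b *\<^sub>R k) = a * l h + b * l k" if "h \<in> X" "k \<in> X" for h k a b
      using that by (rule lin)
    show "\<rho> (F x) + l h \<le> \<rho> (F (x + h))" if "h \<in> X" for h using that by (rule sub)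
  qed blast
  have \<zeta>_Lq: "\<zeta> \<in> Lp_space M q" using \<zeta>(1) by (simp add: Lq_subdiff_def)
  note [measurable] = Lp_spaceD(1)[OF \<zeta>_Lq]
  have scale: "l (c *\<^sub>R h) = c * l h" if "h \<in> X" for c h
    using lin[OF that that, of c 0] by simp
  obtain v :: "'a \<Rightarrow> 'y \<Rightarrow>\<^sub>L real"
    where v: "weakstar_measurable M v" "AE \<omega> in M. \<forall>y. blinfun_apply (v \<omega>) y \<le> \<zeta> \<omega> * slope y \<omega>"
      "\<And>h. h \<in> X \<Longrightarrow> l h = (\<integral>\<omega>. blinfun_apply (v \<omega>) (h \<omega>) \<partial>M)"
  proof (rule weighted_selection[OF \<zeta>_Lq \<zeta>(2) X subset_refl, where l=l])
    show "l (a *\<^sub>R h + b *\<^sub>R k) = a * l h + b * l k" if "h \<in> X" "k \<in> X" for h k a b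
      using that by (rule lin)
    show "l h \<le> (\<integral>\<omega>. \<zeta> \<omega> * slope (h \<omega>) \<omega> \<partial>M)" if "h \<in> X" for h
      by (rule le_weighted_directional_derivative[OF \<zeta>_Lq \<zeta>(2) scale[OF that] \<zeta>(3) that])
  qed blast
  obtain s0 where s0: "measurable_selector M (\<lambda>\<omega>. subdiff (\<lambda>y. f y \<omega>) (x \<omega>)) s0"
    by (rule measurable_selector_exists)
\<comment> \<open>Where \<open>\<zeta>\<close> vanishes, so does \<open>v\<close>, and any selector will do.\<close>
  define s where "s \<omega> = (if 0 < \<zeta> \<omega> then (1 / \<zeta> \<omega>) *\<^sub>R v \<omega> else s0 \<omega>)" for \<omega>
  have "weakstar_measurable M s"
    unfolding weakstar_measurable_def
  proof
    fix y
    have [measurable]: "(\<lambda>\<omega>. blinfun_apply (v \<omega>) y) \<in> borel_measurable M" "(\<lambda>\<omega>. blinfun_apply (s0 \<omega>) y) \<in> borel_measurable M"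
      using v(1) s0 by (auto simp: weakstar_measurable_def measurable_selector_def)
    have "blinfun_apply (s \<omega>) y = (if 0 < \<zeta> \<omega> then 1 / \<zeta> \<omega> * blinfun_apply (v \<omega>) y else blinfun_apply (s0 \<omega>) y)" for \<omega>
      by (simp add: s_def blinfun.scaleR_left)
    then show "(\<lambda>\<omega>. blinfun_apply (s \<omega>) y) \<in> borel_measurable M" by simp
  qed
  moreover have "AE \<omega> in M. s0 \<omega> \<in> subdiff (\<lambda>y. f y \<omega>) (x \<omega>)" using s0 by (simp add: measurable_selector_def)
  with v(2) have "AE \<omega> in M. s \<omega> \<in> subdiff (\<lambda>y. f y \<omega>) (x \<omega>)"
  proof eventually_elim
    case (elim \<omega>)
    show ?case
    proof (cases "0 < \<zeta> \<omega>")
      case True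
      have "blinfun_apply (s \<omega>) y \<le> dir_deriv (\<lambda>y. f y \<omega>) (x \<omega>) y" for y
        using elim(1)[rule_format, of y] True by (simp add: s_def blinfun.scaleR_left slope_def field_simps)
      then show ?thesis by (rule subdiffI[OF f_convex])
    qed (use elim in \<open>simp add: s_def\<close>)
  qed
  ultimately have s: "measurable_selector M (\<lambda>\<omega>. subdiff (\<lambda>y. f y \<omega>) (x \<omega>)) s"
    by (simp add: measurable_selector_def)
  have \<zeta>s: "AE \<omega> in M. \<forall>y. \<zeta> \<omega> * blinfun_apply (s \<omega>) y = blinfun_apply (v \<omega>) y"
    using v(2)
  proof eventually_elim
    case (elim \<omega>)
    show ?case
    proof (cases "0 < \<zeta> \<omega>")
      case False
      then have \<zeta>0: "\<zeta> \<omega> = 0" using \<zeta>(2)[of \<omega>] by simp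
      have "blinfun_apply (v \<omega>) y = 0" for y
        using elim[rule_format, of y] elim[rule_format, of "- y"] by (simp add: \<zeta>0 blinfun.minus_right)
      then show ?thesis by (simp add: \<zeta>0)
    qed (simp add: s_def blinfun.scaleR_left)
  qed
  have "l = Lp_functional N p' (dual_cond_exp M G (\<lambda>\<omega>. \<zeta> \<omega> *\<^sub>R s \<omega>))"
  proof (rule extensionalityI[of _ X])
    show "l \<in> extensional X" using l by (simp add: Lp_subdiff_def Lp_dual_def)
    show "Lp_functional N p' (dual_cond_exp M G (\<lambda>\<omega>. \<zeta> \<omega> *\<^sub>R s \<omega>)) \<in> extensional X" by (simp add: Lp_functional_def)
    fix h assume h: "h \<in> X"
    have "l h = (\<integral>\<omega>. blinfun_apply (v \<omega>) (h \<omega>) \<partial>M)" by (rule v(3)[OF h])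
    also have "\<dots> = (\<integral>\<omega>. \<zeta> \<omega> * blinfun_apply (s \<omega>) (h \<omega>) \<partial>M)"
    proof (rule integral_cong_AE)
      show "(\<lambda>\<omega>. blinfun_apply (v \<omega>) (h \<omega>)) \<in> borel_measurable M"
        by (rule weakstar_measurable_apply[OF v(1) X_measurable[OF h]])
      show "(\<lambda>\<omega>. \<zeta> \<omega> * blinfun_apply (s \<omega>) (h \<omega>)) \<in> borel_measurable M"
        using pairing_integrable[OF \<zeta>(1) s h] by simp
      show "AE \<omega> in M. blinfun_apply (v \<omega>) (h \<omega>) = \<zeta> \<omega> * blinfun_apply (s \<omega>) (h \<omega>)"
        using \<zeta>s by eventually_elim simp
    qed
    also have "\<dots> = Lp_functional N p' (dual_cond_exp M G (\<lambda>\<omega>. \<zeta> \<omega> *\<^sub>R s \<omega>)) h"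
      by (rule Lp_functional_dual_cond_exp[OF \<zeta>(1) s h, symmetric])
    finally show "l h = Lp_functional N p' (dual_cond_exp M G (\<lambda>\<omega>. \<zeta> \<omega> *\<^sub>R s \<omega>)) h" .
  qed
  with \<zeta>(1) s show thesis by (rule that)
qed

lemma subdiff_composite:
  "Lp_subdiff N p' (\<rho> \<circ> F) x \<noteq> {} \<and>
    Lp_subdiff N p' (\<rho> \<circ> F) x =
      {Lp_functional N p' (dual_cond_exp M G (\<lambda>\<omega>. \<zeta> \<omega> *\<^sub>R s \<omega>)) | \<zeta> s.
        \<zeta> \<in> Lq_subdiff M p q \<rho> (F x) \<and>
        measurable_selector M (\<lambda>\<omega>. subdiff (\<lambda>y. f y \<omega>) (x \<omega>)) s}" (is "_ \<and> _ = ?R")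
proof -
  have "Lp_subdiff N p' (\<rho> \<circ> F) x \<subseteq> ?R"
  proof
    fix l assume "l \<in> Lp_subdiff N p' (\<rho> \<circ> F) x"
    then show "l \<in> ?R" by (rule subgradient_representation) blast
  qed
  moreover have "?R \<subseteq> Lp_subdiff N p' (\<rho> \<circ> F) x" using dual_cond_exp_in_subdiff by blast
  moreover have "?R \<noteq> {}"
  proof -
    obtain s where "measurable_selector M (\<lambda>\<omega>. subdiff (\<lambda>y. f y \<omega>) (x \<omega>)) s"
      by (rule measurable_selector_exists)
    moreover obtain \<zeta> where "\<zeta> \<in> Lq_subdiff M p q \<rho> (F x)" by (rule \<rho>_subgradient_exists)
    ultimately show ?thesis by blast
  qed
  ultimately show ?thesis by blast
qed

end

lemma convex_integrand_everywhere:
  assumes f: "convex_integrand M f"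
  obtains f0 where "\<And>\<omega>. convex_on UNIV (\<lambda>y. f0 y \<omega>)" "\<And>\<omega>. continuous_on UNIV (\<lambda>y. f0 y \<omega>)"
    "\<And>y. f0 y \<in> borel_measurable M" "AE \<omega> in M. \<forall>y. f0 y \<omega> = f y \<omega>"
proof -
  have ae: "AE \<omega> in M. convex_on UNIV (\<lambda>y. f y \<omega>) \<and> continuous_on UNIV (\<lambda>y. f y \<omega>)"
    and [measurable]: "\<And>y. f y \<in> borel_measurable M"
    using f by (auto simp: convex_integrand_def)
  obtain E where E: "{\<omega> \<in> space M. \<not> (convex_on UNIV (\<lambda>y. f y \<omega>) \<and> continuous_on UNIV (\<lambda>y. f y \<omega>))} \<subseteq> E"
    "emeasure M E = 0" "E \<in> sets M"
    using ae by (rule AE_E)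
  define f0 where "f0 y \<omega> = (if \<omega> \<in> E \<or> \<omega> \<notin> space M then 0 else f y \<omega>)" for y \<omega>
  show thesis
  proof (rule that[of f0])
    show "convex_on UNIV (\<lambda>y. f0 y \<omega>)" for \<omega>
      using E(1) by (cases "\<omega> \<in> E \<or> \<omega> \<notin> space M") (auto simp: f0_def convex_on_const)
    show "continuous_on UNIV (\<lambda>y. f0 y \<omega>)" for \<omega>
      using E(1) by (cases "\<omega> \<in> E \<or> \<omega> \<notin> space M") (auto simp: f0_def)
    show "f0 y \<in> borel_measurable M" for y
    proof -
      have "(\<lambda>\<omega>. if \<omega> \<in> E then 0 else f y \<omega>) \<in> borel_measurable M" using E(3) by measurable
      then show ?thesis by (rule measurable_cong[THEN iffD1, rotated]) (simp add: f0_def)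
    qed
    have "AE \<omega> in M. \<omega> \<notin> E" using E(2,3) by (intro AE_not_in) (simp add: null_sets_def)
    then show "AE \<omega> in M. \<forall>y. f0 y \<omega> = f y \<omega>" using AE_space by eventually_elim (simp add: f0_def)
  qed
qed

theorem theorem3p2:
  fixes M G :: "'a measure"
    and p p' q :: ennreal
    and f :: "'y::{banach, second_countable_topology} \<Rightarrow> 'a \<Rightarrow> real"
    and F :: "('a \<Rightarrow> 'y) \<Rightarrow> ('a \<Rightarrow> real)"
    and \<rho> :: "('a \<Rightarrow> real) \<Rightarrow> real"
    and x :: "'a \<Rightarrow> 'y"
  defines "N \<equiv> restr_to_subalg M G"
  defines "X \<equiv> (Lp_space N p' :: ('a \<Rightarrow> 'y) set)"
  assumes "prob_space M"
    and "subalgebra M G"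
    and "1 \<le> p" and "p < \<infinity>" and "p \<le> p'"
    and "1 / p + 1 / q = 1"
    and "convex_integrand M f"
    and "\<And>h. h \<in> X \<Longrightarrow> F h \<in> Lp_space M p"
    and "\<And>h. h \<in> X \<Longrightarrow> AE \<omega> in M. F h \<omega> = f (h \<omega>) \<omega>"
    and "x \<in> X"
    and "AE \<omega> in M. convex_on UNIV (\<lambda>y. f y \<omega>) \<and> isCont (\<lambda>y. f y \<omega>) (x \<omega>)"
    and "Lp_continuous_at N p' M p F x"
    and "Lp_convex M p \<rho>"
    and "Lp_nondecreasing M p \<rho>"
  shows "Lp_subdiff N p' (\<rho> \<circ> F) x \<noteq> {} \<and>
    Lp_subdiff N p' (\<rho> \<circ> F) x =
      {Lp_functional N p' (dual_cond_exp M G (\<lambda>\<omega>. \<zeta> \<omega> *\<^sub>R s \<omega>)) | \<zeta> s.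
        \<zeta> \<in> Lq_subdiff M p q \<rho> (F x) \<and>
        measurable_selector M (\<lambda>\<omega>. subdiff (\<lambda>y. f y \<omega>) (x \<omega>)) s}"
proof -
  obtain f0 where f0: "\<And>\<omega>. convex_on UNIV (\<lambda>y. f0 y \<omega>)" "\<And>\<omega>. continuous_on UNIV (\<lambda>y. f0 y \<omega>)"
    "\<And>y. f0 y \<in> borel_measurable M" "AE \<omega> in M. \<forall>y. f0 y \<omega> = f y \<omega>"
    using convex_integrand_everywhere[OF \<open>convex_integrand M f\<close>] by blast
  interpret composite_functional M G p p' q f0 F \<rho> x
  proof (intro composite_functional.intro composite_functional_axioms.intro)
    show "prob_space M" "subalgebra M G" "1 \<le> p" "p < \<infinity>" "p \<le> p'" "1 / p + 1 / q = 1"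
      "Lp_convex M p \<rho>" "Lp_nondecreasing M p \<rho>" by fact+
    show "Lp_continuous_at (restr_to_subalg M G) p' M p F x" "x \<in> Lp_space (restr_to_subalg M G) p'"
      using \<open>Lp_continuous_at N p' M p F x\<close> \<open>x \<in> X\<close> by (simp_all add: N_def X_def)
    fix h :: "'a \<Rightarrow> 'y" assume "h \<in> Lp_space (restr_to_subalg M G) p'"
    then have h: "h \<in> X" by (simp add: N_def X_def)
    show "F h \<in> Lp_space M p" using h by fact
    have "AE \<omega> in M. F h \<omega> = f (h \<omega>) \<omega>" using h by fact
    then show "AE \<omega> in M. F h \<omega> = f0 (h \<omega>) \<omega>" using f0(4) by eventually_elim simp
  qed (rule f0)+
  have selector_eq: "measurable_selector M (\<lambda>\<omega>. subdiff (\<lambda>y. f0 y \<omega>) (x \<omega>)) s \<longleftrightarrow>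
      measurable_selector M (\<lambda>\<omega>. subdiff (\<lambda>y. f y \<omega>) (x \<omega>)) s" for s
  proof -
    have "AE \<omega> in M. s \<omega> \<in> subdiff (\<lambda>y. f0 y \<omega>) (x \<omega>) \<longleftrightarrow> s \<omega> \<in> subdiff (\<lambda>y. f y \<omega>) (x \<omega>)"
      using f0(4) by eventually_elim (simp add: subdiff_def)
    then have "(AE \<omega> in M. s \<omega> \<in> subdiff (\<lambda>y. f0 y \<omega>) (x \<omega>)) \<longleftrightarrow> (AE \<omega> in M. s \<omega> \<in> subdiff (\<lambda>y. f y \<omega>) (x \<omega>))"
      by (rule eventually_cong)
    then show ?thesis by (simp add: measurable_selector_def)
  qed
  show ?thesis using subdiff_composite unfolding selector_eq N_def .
qed

end
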